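(* The continuous time functional Steiner point $x_t=s(W_t)$ is $d+1$ competitive in Euclidean space. In particular: (1) the movement cost is $d$-competitive: $\int_{0}^T \|x'_t\|\,dt \leq d\cdot\min_x W_T(x)$; (2) the service cost is $1$-competitive: $\int_{0}^T f_t(x_t)\,dt \leq \min_x W_T(x)$.
   Context: Setting: continuous-time chasing of convex functions in Euclidean $\mathbb R^d$ starting at $x_0=0$: the adversary gives $f_t:\mathbb R^d\to\mathbb R^+$ convex in $x$, piecewise continuous in $t$, finite everywhere; the player chooses online a bounded-variation path $x_t$ and pays $\int_0^T f_t(x_t)+\|x'_t\|\,dt$. The work function is $W_t(x)=\inf_{x_s:[0,t]\to\mathbb R^d,\,x_0=0}\int_0^t f_s(x_s)+\|x'_s\|\,ds$ over paths ending at $x$; the offline optimum is $\min_x W_T(x)$. For a convex $W$ with concave conjugate $W^*(v)=\min_w(W(w)-v^Tw)$ finite on the unit ball $B_1$, and $v^*=\arg\min_w(W(w)-v^Tw)$ (so $\nabla W(v^* )=v$), the functional Steiner point is $s(W)=\frac{1}{\mathrm{vol}(B_1)}\int_{v\in B_1} v^*\,dv = -d\,\frac{1}{|\mathbb S^{d-1}|}\int_{\theta\in\mathbb S^{d-1}} W^*(\theta)\,\theta\, d\theta$ (average over the ball, resp. sphere). *)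

theory Defs
  imports "HOL-Analysis.Analysis"
begin

text \<open>Piecewise continuity in the usual sense: finitely many discontinuities, with finite
  one-sided limits everywhere. (At the left end point \<open>{a..<t}\<close> is empty, so the left-hand
  condition is vacuous there; likewise at the right end point.)\<close>

definition piecewise_continuous_on :: "real \<Rightarrow> real \<Rightarrow> (real \<Rightarrow> real) \<Rightarrow> bool" where
  "piecewise_continuous_on a b g \<longleftrightarrow>
     (\<exists>S. finite S \<and> continuous_on ({a..b} - S) g) \<and>
     (\<forall>t\<in>{a..b}. (\<exists>l. (g \<longlongrightarrow> l) (at t within {a..<t})) \<and>
                 (\<exists>l. (g \<longlongrightarrow> l) (at t within {t<..b})))"

definition convex_requests :: "real \<Rightarrow> (real \<Rightarrow> 'a::euclidean_space \<Rightarrow> real) \<Rightarrow> bool" where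
  "convex_requests T f \<longleftrightarrow>
     (\<forall>t\<in>{0..T}. convex_on UNIV (f t) \<and> (\<forall>x. 0 \<le> f t x)) \<and>
     (\<forall>x. piecewise_continuous_on 0 T (\<lambda>t. f t x))"

text \<open>The movement cost \<open>\<integral> \<parallel>x'\<parallel> dt\<close> of a path of bounded variation is the total mass of its
  derivative measure, i.e. its total variation (jumps are charged). It is \<open>\<infinity>\<close> exactly for the
  paths of unbounded variation.\<close>

definition movement_cost :: "real \<Rightarrow> (real \<Rightarrow> 'a::euclidean_space) \<Rightarrow> ennreal" where
  "movement_cost T x =
     (SUP (n, \<tau>) \<in> {(n::nat, \<tau>::nat \<Rightarrow> real). mono_on {..n} \<tau> \<and> \<tau> ` {..n} \<subseteq> {0..T}}.
        \<Sum>i<n. ennreal (norm (x (\<tau> (Suc i)) - x (\<tau> i))))"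

definition service_cost ::
    "(real \<Rightarrow> 'a::euclidean_space \<Rightarrow> real) \<Rightarrow> real \<Rightarrow> (real \<Rightarrow> 'a) \<Rightarrow> ennreal" where
  "service_cost f T x = (\<integral>\<^sup>+t\<in>{0..T}. ennreal (f t (x t)) \<partial>lborel)"

definition total_cost ::
    "(real \<Rightarrow> 'a::euclidean_space \<Rightarrow> real) \<Rightarrow> real \<Rightarrow> (real \<Rightarrow> 'a) \<Rightarrow> ennreal" where
  "total_cost f T x = service_cost f T x + movement_cost T x"

text \<open>Paths of unbounded variation have cost \<open>\<infinity>\<close> and so do not affect the infimum. At time 0 the
  only admissible end point is 0: the value there is 0, and it is \<open>\<infinity>\<close> elsewhere.\<close>

definition work_function ::
    "(real \<Rightarrow> 'a::euclidean_space \<Rightarrow> real) \<Rightarrow> real \<Rightarrow> 'a \<Rightarrow> ennreal" where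
  "work_function f t x = (INF p\<in>{p. p 0 = 0 \<and> p t = x}. total_cost f t p)"

definition offline_opt :: "(real \<Rightarrow> 'a::euclidean_space \<Rightarrow> real) \<Rightarrow> real \<Rightarrow> ennreal" where
  "offline_opt f T = (INF x. work_function f T x)"

text \<open>\<open>conj_argmin W v\<close> is the point written \<open>v\<^sup>*\<close>. For convex \<open>W\<close> with conjugate finite on the
  unit ball, the minimiser exists and is unique for almost every \<open>v\<close> in the ball, so the choice
  made by \<^const>\<open>arg_min\<close> on the exceptional null set does not influence the Lebesgue integral
  below.\<close>

definition conj_argmin :: "('a::euclidean_space \<Rightarrow> ereal) \<Rightarrow> 'a \<Rightarrow> 'a" where
  "conj_argmin W v = arg_min (\<lambda>w. W w - ereal (v \<bullet> w)) (\<lambda>_. True)"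

definition functional_steiner_point :: "('a::euclidean_space \<Rightarrow> ereal) \<Rightarrow> 'a" where
  "functional_steiner_point W =
     (1 / measure lebesgue (cball (0::'a) 1)) *\<^sub>R (LINT v:cball 0 1|lebesgue. conj_argmin W v)"

definition steiner_path :: "(real \<Rightarrow> 'a::euclidean_space \<Rightarrow> real) \<Rightarrow> real \<Rightarrow> 'a" where
  "steiner_path f t = functional_steiner_point (\<lambda>w. enn2ereal (work_function f t w))"

text \<open>A strategy maps request families to paths; it is online if the position at time \<open>t\<close> depends
  only on the requests up to time \<open>t\<close>.\<close>

definition online ::
    "((real \<Rightarrow> 'a::euclidean_space \<Rightarrow> real) \<Rightarrow> real \<Rightarrow> 'a) \<Rightarrow> bool" where
  "online A \<longleftrightarrow> (\<forall>f g t. 0 \<le> t \<longrightarrow> (\<forall>s\<in>{0..t}. f s = g s) \<longrightarrow> A f t = A g t)"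

definition competitive ::
    "real \<Rightarrow> ((real \<Rightarrow> 'a::euclidean_space \<Rightarrow> real) \<Rightarrow> real \<Rightarrow> 'a) \<Rightarrow> bool" where
  "competitive c A \<longleftrightarrow> online A \<and>
     (\<forall>f T. 0 \<le> T \<longrightarrow> convex_requests T f \<longrightarrow>
        A f 0 = 0 \<and> movement_cost T (A f) < \<infinity> \<and>
        total_cost f T (A f) \<le> ennreal c * offline_opt f T)"

end

(* The concave conjugate G_t(v) = min_w (W_t(w) - v.w) has the minimiser m_t(v) as a supergradient (up to
   sign), whatever minimiser is selected, and G_t(v) increases in t. Only |v| < 1 is used.

   Movement: integrating by parts against a radial cut-off concentrated near the unit sphere bounds
   |s(W_t) - s(W_s)| by d times the boundary average of G_t - G_s. These averages telescope, and by
   concavity the last one is at most G_T(0) = min W_T.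

   Service: in time h the value G_t(v) grows by at least h f_t(m_t(v)) - O(h^2), because a near-optimal
   path ending in m_t(v) moves by O(h) only. Averaging over v with Jensen's inequality, the mean of G_t grows
   at rate at least f_t(s(W_t)), while it stays between 0 and G_T(0). *)

theory Submission
  imports Defs "HOL-Real_Asymp.Real_Asymp"
begin

section \<open>Supergradients of a concave function on the unit ball\<close>

text \<open>The minimisers come from an arbitrary selection, so not even their measurability is
  available beforehand, and the pointwise bound \<open>2 * C / (1 - norm v)\<close> is not
  integrable up to the sphere. Measurability is extracted from integration by parts with cut-offs
  that vanish near the sphere. Integrability comes from bounding \<open>norm (m v)\<close> by the
  radial part \<open>m v \<bullet> v\<close> plus a constant, and from controlling the integral of
  the radial part through dilations.

  The factor d is the ratio of surface to volume of the unit ball, met here as the bound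
  \<open>DIM('a) * \<epsilon>\<close> for the relative volume of a shell of width
  \<open>\<epsilon>\<close>. The quadratic error in the service estimate is uniform only for
  \<open>norm v \<le> r\<close> with \<open>r < 1\<close>, so the averages there run over
  \<open>cball 0 r\<close>, and \<open>r\<close> tends to 1 at the very end. Increments are taken
  backward in time because the path estimate over \<open>[s, t]\<close> involves the minimiser at
  the later time \<open>t\<close>. This leads to a lower left derivative in time, where Fatou's
  lemma and monotonicity replace differentiability.\<close>

lemma lborel_integral_affine:
  fixes g :: "'a::euclidean_space \<Rightarrow> real"
  assumes [measurable]: "g \<in> borel_measurable borel" and c: "c \<noteq> 0"
  shows "(\<integral>x. g x \<partial>lborel) = \<bar>c\<bar> ^ DIM('a) * (\<integral>x. g (t + c *\<^sub>R x) \<partial>lborel)"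
proof -
  have "(\<integral>x. g x \<partial>lborel) =
      (\<integral>x. g x \<partial>density (distr lborel borel (\<lambda>x. t + c *\<^sub>R x)) (\<lambda>_. ennreal (\<bar>c\<bar> ^ DIM('a))))"
    using lborel_affine[OF c, of t] by (simp add: ennreal_power)
  also have "\<dots> = (\<integral>x. \<bar>c\<bar> ^ DIM('a) * g x \<partial>distr lborel borel (\<lambda>x. t + c *\<^sub>R x))"
    by (subst integral_density) auto
  also have "\<dots> = (\<integral>x. \<bar>c\<bar> ^ DIM('a) * g (t + c *\<^sub>R x) \<partial>lborel)"
    by (subst integral_distr) auto
  finally show ?thesis by simp
qed

lemma integrable_bounded_support:
  fixes g :: "'a::euclidean_space \<Rightarrow> real"
  assumes "g \<in> borel_measurable borel" "\<And>x. \<bar>g x\<bar> \<le> B" "\<And>x. R \<le> norm x \<Longrightarrow> g x = 0"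
  shows "integrable lborel g"
proof (rule Bochner_Integration.integrable_bound)
  show "integrable lborel (\<lambda>x. B * indicator (ball (0::'a) R) x :: real)"
    by (intro integrable_mult_right integrable_real_indicator)
       (auto intro: emeasure_lborel_ball_finite[unfolded infinity_ennreal_def])
  show "AE x in lborel. norm (g x) \<le> norm (B * indicator (ball 0 R) x :: real)"
  proof (rule AE_I2)
    fix x
    show "norm (g x) \<le> norm (B * indicator (ball 0 R) x :: real)"
      using assms(2)[of x] assms(3)[of x] by (auto simp: indicator_def)
  qed
qed (use assms in auto)

text \<open>Abstracts a conjugate \<open>G\<close> with a selection \<open>m\<close> of minimisers:
  if \<open>m v\<close> minimises \<open>W w - v \<bullet> w\<close> with value \<open>G v\<close>,
  then \<open>- m v\<close> is a supergradient of \<open>G\<close> at \<open>v\<close>. All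
  assumptions are confined to the open ball, since a minimiser may fail to exist on the
  sphere.\<close>

locale ball_supergradient =
  fixes G :: "'a::euclidean_space \<Rightarrow> real" and m :: "'a \<Rightarrow> 'a" and C :: real
  assumes supergradient: "norm v < 1 \<Longrightarrow> norm u < 1 \<Longrightarrow> G u \<le> G v - m v \<bullet> (u - v)"
    and nonneg: "norm v < 1 \<Longrightarrow> 0 \<le> G v"
    and bounded: "norm v < 1 \<Longrightarrow> G v \<le> C"
begin

lemma C_nonneg: "0 \<le> C"
  using nonneg[of 0] bounded[of 0] by simp

text \<open>Moving from \<open>v\<close> in the direction of \<open>m v\<close> by half the distance
  to the sphere lowers \<open>G\<close> by at least \<open>norm (m v) * (1 - norm v) / 2\<close>,
  while \<open>G\<close> only ranges over \<open>[0, C]\<close>.\<close>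

lemma norm_gradient_le:
  assumes v: "norm v < 1"
  shows "norm (m v) * (1 - norm v) \<le> 2 * C"
proof (cases "m v = 0")
  case True
  then show ?thesis using C_nonneg by simp
next
  case False
  define u where "u = v + ((1 - norm v) / 2 / norm (m v)) *\<^sub>R m v"
  have "norm u \<le> norm v + (1 - norm v) / 2"
    unfolding u_def by (rule norm_triangle_le) (use v False in simp)
  then have u: "norm u < 1" using v by (simp add: field_simps)
  have "m v \<bullet> (u - v) = (1 - norm v) / 2 * norm (m v)"
    using False by (simp add: u_def power2_norm_eq_inner[symmetric] power2_eq_square)
  then show ?thesis
    using supergradient[OF v u] nonneg[OF u] bounded[OF v] by (simp add: field_simps)
qed

lemma norm_gradient_le_on_cball:
  assumes "norm v \<le> r" "r < 1"
  shows "norm (m v) \<le> 2 * C / (1 - r)"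
proof -
  have "norm (m v) * (1 - r) \<le> norm (m v) * (1 - norm v)"
    using assms by (intro mult_left_mono) auto
  also have "\<dots> \<le> 2 * C" using assms by (intro norm_gradient_le) auto
  finally show ?thesis using assms by (simp add: field_simps)
qed

lemma lipschitz_on_cball:
  assumes "norm u \<le> r" "norm v \<le> r" "r < 1"
  shows "\<bar>G u - G v\<bar> \<le> 2 * C / (1 - r) * norm (u - v)"
proof -
  have *: "G u - G v \<le> 2 * C / (1 - r) * norm (u - v)" if "norm u \<le> r" "norm v \<le> r" for u v
  proof -
    have "G u - G v \<le> - (m v \<bullet> (u - v))"
      using supergradient[of v u] that assms by simp
    also have "\<dots> \<le> norm (m v) * norm (u - v)"
      using Cauchy_Schwarz_ineq2[of "m v" "u - v"] by linarith
    also have "\<dots> \<le> 2 * C / (1 - r) * norm (u - v)"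
      using norm_gradient_le_on_cball[of v r] that assms by (intro mult_right_mono) auto
    finally show ?thesis .
  qed
  show ?thesis using *[of u v] *[of v u] assms by (simp add: norm_minus_commute)
qed

lemma continuous_on_cball:
  assumes "r < 1"
  shows "continuous_on (cball 0 r) G"
  by (rule lipschitz_on_continuous_on[of "2 * C / (1 - r)"])
     (use assms lipschitz_on_cball C_nonneg in \<open>auto intro!: lipschitz_onI simp: dist_norm\<close>)

lemma continuous_on_ball: "continuous_on (ball 0 1) G"
proof -
  have "isCont G v" if v: "norm v < 1" for v
  proof -
    obtain r where r: "norm v < r" "r < 1" using dense[OF v] by blast
    then show ?thesis
      using continuous_on_interior[OF continuous_on_cball[OF r(2)], of v] by simp
  qed
  then show ?thesis by (auto intro: continuous_at_imp_continuous_on)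
qed

text \<open>Nothing is known about \<open>G\<close> outside the open unit ball. The extension by
  zero is bounded and Borel on the whole space, so its translates and dilates can be
  integrated.\<close>

definition H :: "'a \<Rightarrow> real" where "H v = indicator (ball 0 1) v * G v"

lemma H_measurable [measurable]: "H \<in> borel_measurable borel"
  unfolding H_def
  using borel_measurable_continuous_on_indicator[OF _ continuous_on_ball] by simp

lemma H_eq: "norm v < 1 \<Longrightarrow> H v = G v"
  by (simp add: H_def)

lemma H_nonneg: "0 \<le> H v"
  using nonneg by (auto simp: H_def indicator_def)

lemma H_le: "H v \<le> C"
  using bounded C_nonneg by (auto simp: H_def indicator_def)

lemma abs_H_le: "\<bar>H v\<bar> \<le> C"
  using H_nonneg H_le by simp

text \<open>The supergradient lies between backward and forward difference quotients of \<open>G\<close>. After a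
  translation, the integrals of both quotients against \<open>\<phi>\<close> tend to the same limit, so the
  sandwiched function is measurable even though \<open>m\<close> is an arbitrary selection.\<close>

lemma integration_by_parts:
  assumes phi_nonneg: "\<And>v. 0 \<le> \<phi> v"
    and phi_lipschitz: "\<And>u v. \<bar>\<phi> u - \<phi> v\<bar> \<le> L * norm (u - v)"
    and phi_zero: "\<And>v. r \<le> norm v \<Longrightarrow> \<phi> v = 0" and r: "0 < r" "r < 1"
    and D: "AE v in lborel. ((\<lambda>h. (\<phi> (v + h *\<^sub>R e) - \<phi> v) / h) \<longlongrightarrow> D v) (at 0)"
    and [measurable]: "D \<in> borel_measurable borel"
  shows "has_bochner_integral lebesgue (\<lambda>v. \<phi> v * (m v \<bullet> e)) (\<integral>v. D v * H v \<partial>lborel)"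
proof -
  \<comment> \<open>The scaling gives \<open>h n * norm e < 1 - r\<close>, so \<open>v\<close> can
    be shifted by \<open>h n\<close> along \<open>e\<close> in both directions without leaving the
    unit ball whenever \<open>norm v < r\<close>, that is, wherever \<open>\<phi>\<close> may be
    nonzero.\<close>
  define h where "h n = (1 - r) / (norm e + 1) * inverse (real (Suc n))" for n
  have h_pos: "h n > 0" for n using r by (simp add: h_def add_nonneg_pos)
  have h_e: "h n * norm e < 1 - r" for n
  proof -
    have "h n * norm e \<le> (1 - r) / (norm e + 1) * norm e"
      unfolding h_def using r
      by (intro mult_right_mono mult_left_le) (auto simp: inverse_le_1_iff add_nonneg_pos)
    also have "\<dots> = (1 - r) * (norm e / (norm e + 1))" by simp
    also have "\<dots> < (1 - r) * 1"
      by (rule mult_strict_left_mono) (use r in \<open>auto simp: add_nonneg_pos\<close>)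
    finally show ?thesis by simp
  qed
  have h_lim: "h \<longlonglongrightarrow> 0"
    unfolding h_def by (rule tendsto_mult_right_zero[OF LIMSEQ_inverse_real_of_nat])
  have phi_cont: "continuous_on UNIV \<phi>"
  proof (rule lipschitz_on_continuous_on[of "max L 0"], rule lipschitz_onI)
    fix u v :: 'a
    have "L * norm (u - v) \<le> max L 0 * norm (u - v)" by (intro mult_right_mono) auto
    then show "dist (\<phi> u) (\<phi> v) \<le> max L 0 * dist u v"
      using phi_lipschitz[of u v] by (simp add: dist_norm)
  qed simp
  then have [measurable]: "\<phi> \<in> borel_measurable borel"
    by (rule borel_measurable_continuous_onI)
  have L: "0 \<le> L * norm e" using phi_lipschitz[of e 0] by simp
  \<comment> \<open>\<open>\<phi>\<close> vanishes at every basis vector because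
    \<open>r < 1\<close>. A point with \<open>norm v < r\<close> is within distance 2 of such a
    vector, so the Lipschitz bound controls \<open>\<phi>\<close> there.\<close>
  have phi_le: "\<bar>\<phi> v\<bar> \<le> \<bar>L\<bar> * 2" for v
  proof (cases "r \<le> norm v")
    case False
    obtain b :: 'a where b: "b \<in> Basis" using nonempty_Basis by blast
    have "\<phi> b = 0" using b r by (intro phi_zero) simp
    then have "\<bar>\<phi> v\<bar> \<le> L * norm (v - b)" using phi_lipschitz[of v b] by simp
    also have "\<dots> \<le> \<bar>L\<bar> * norm (v - b)" by (intro mult_right_mono) auto
    also have "\<dots> \<le> \<bar>L\<bar> * 2"
      using norm_triangle_ineq4[of v b] b False r by (intro mult_left_mono) auto
    finally show ?thesis .
  qed (simp add: phi_zero)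
  have int_phiH: "integrable lborel (\<lambda>v. \<phi> (v + a) * H (v + b))" for a b
  proof (rule integrable_bounded_support)
    fix v
    show "\<bar>\<phi> (v + a) * H (v + b)\<bar> \<le> (\<bar>L\<bar> * 2) * C"
      unfolding abs_mult using phi_le[of "v + a"] abs_H_le[of "v + b"] by (intro mult_mono) auto
    assume "r + norm a \<le> norm v"
    then show "\<phi> (v + a) * H (v + b) = 0"
      using norm_triangle_ineq2[of v "- a"] by (auto intro!: phi_zero)
  qed measurable
  have shift: "(\<integral>v. \<phi> v * H (v + a) \<partial>lborel) = (\<integral>v. \<phi> (v - a) * H v \<partial>lborel)" for a
    using lborel_integral_affine[of "\<lambda>v. \<phi> (v - a) * H v" 1 a] by (simp add: add.commute)
  \<comment> \<open>Backward and forward difference quotients of \<open>- H\<close> along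
    \<open>e\<close>, weighted by \<open>\<phi>\<close>. The supergradient inequality encloses
    \<open>X\<close> between them.\<close>
  define a where "a n v = (\<phi> v * H (v - h n *\<^sub>R e) - \<phi> v * H v) / h n" for n v
  define b where "b n v = (\<phi> v * H v - \<phi> v * H (v + h n *\<^sub>R e)) / h n" for n v
  define X where "X v = \<phi> v * (m v \<bullet> e)" for v
  have aX: "a n v \<le> X v" and Xb: "X v \<le> b n v" for n v
  proof -
    show "a n v \<le> X v"
    proof (cases "r \<le> norm v")
      case False
      have n1: "norm (v - h n *\<^sub>R e) < 1"
        using norm_triangle_ineq4[of v "h n *\<^sub>R e"] False h_e[of n] h_pos[of n] by simp
      have "G (v - h n *\<^sub>R e) - G v \<le> h n * (m v \<bullet> e)"
        using supergradient[of v "v - h n *\<^sub>R e"] n1 False r by simp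
      then have "\<phi> v * (G (v - h n *\<^sub>R e) - G v) \<le> \<phi> v * (h n * (m v \<bullet> e))"
        by (rule mult_left_mono) (rule phi_nonneg)
      then show ?thesis
        using n1 False r h_pos[of n] by (simp add: a_def X_def H_eq field_simps)
    qed (simp add: a_def X_def phi_zero)
    show "X v \<le> b n v"
    proof (cases "r \<le> norm v")
      case False
      have n1: "norm (v + h n *\<^sub>R e) < 1"
        using norm_triangle_ineq[of v "h n *\<^sub>R e"] False h_e[of n] h_pos[of n] by simp
      have "h n * (m v \<bullet> e) \<le> G v - G (v + h n *\<^sub>R e)"
        using supergradient[of v "v + h n *\<^sub>R e"] n1 False r by simp
      then have "\<phi> v * (h n * (m v \<bullet> e)) \<le> \<phi> v * (G v - G (v + h n *\<^sub>R e))"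
        by (rule mult_left_mono) (rule phi_nonneg)
      then show ?thesis
        using n1 False r h_pos[of n] by (simp add: b_def X_def H_eq field_simps)
    qed (simp add: b_def X_def phi_zero)
  qed
  have a_int: "integrable lborel (a n)" and b_int: "integrable lborel (b n)" for n
    using int_phiH[of 0 0] int_phiH[of 0 "- (h n *\<^sub>R e)"] int_phiH[of 0 "h n *\<^sub>R e"]
    by (auto simp: a_def[abs_def] b_def[abs_def])
  \<comment> \<open>A translation moves the difference quotient from \<open>H\<close> to
    \<open>\<phi>\<close>, which is differentiable almost everywhere along \<open>e\<close>. The
    integral of \<open>a\<close> then has step \<open>h n\<close> and that of \<open>b\<close> has
    step \<open>- h n\<close>, so both have the same limit.\<close>
  define Q where "Q k v = (\<phi> (v + k *\<^sub>R e) - \<phi> v) / k * H v" for k v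
  have a_eq: "(\<integral>v. a n v \<partial>lborel) = (\<integral>v. Q (h n) v \<partial>lborel)" for n
    using int_phiH[of 0 0] int_phiH[of 0 "- (h n *\<^sub>R e)"] int_phiH[of "h n *\<^sub>R e" 0]
      shift[of "- (h n *\<^sub>R e)"]
    by (simp add: a_def Q_def left_diff_distrib)
  have b_eq: "(\<integral>v. b n v \<partial>lborel) = (\<integral>v. Q (- h n) v \<partial>lborel)" for n
  proof -
    have "(\<integral>v. b n v \<partial>lborel) = (\<integral>v. (\<phi> v * H v - \<phi> (v - h n *\<^sub>R e) * H v) / h n \<partial>lborel)"
      using int_phiH[of 0 0] int_phiH[of 0 "h n *\<^sub>R e"] int_phiH[of "- (h n *\<^sub>R e)" 0]
        shift[of "h n *\<^sub>R e"]
      by (simp add: b_def)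
    also have "\<dots> = (\<integral>v. Q (- h n) v \<partial>lborel)"
      by (intro Bochner_Integration.integral_cong refl) (simp add: Q_def algebra_simps minus_divide_left)
    finally show ?thesis .
  qed
  have Q_lim: "(\<lambda>n. \<integral>v. Q (k n) v \<partial>lborel) \<longlonglongrightarrow> (\<integral>v. D v * H v \<partial>lborel)"
    if k: "k \<longlonglongrightarrow> 0" "\<And>n. k n \<noteq> 0" for k
  proof (rule integral_dominated_convergence[where w = "\<lambda>v. L * norm e * C * indicator (ball 0 1) v"])
    show "integrable lborel (\<lambda>v. L * norm e * C * indicator (ball (0::'a) 1) v)"
      by (intro integrable_mult_right integrable_real_indicator)
         (auto intro: emeasure_lborel_ball_finite[unfolded infinity_ennreal_def])
    have kk: "filterlim k (at 0) sequentially" using k by (simp add: filterlim_at)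
    show "AE v in lborel. (\<lambda>n. Q (k n) v) \<longlonglongrightarrow> D v * H v"
      using D
    proof eventually_elim
      case (elim v)
      show ?case unfolding Q_def
        by (intro tendsto_mult tendsto_const filterlim_compose[OF elim kk])
    qed
    show "AE v in lborel. norm (Q (k n) v) \<le> L * norm e * C * indicator (ball 0 1) v" for n
    proof (rule AE_I2)
      fix v
      have "\<bar>(\<phi> (v + k n *\<^sub>R e) - \<phi> v) / k n\<bar> \<le> L * norm e"
        using phi_lipschitz[of "v + k n *\<^sub>R e" v] k(2)[of n] by (simp add: field_simps)
      then have "\<bar>(\<phi> (v + k n *\<^sub>R e) - \<phi> v) / k n\<bar> * \<bar>H v\<bar> \<le> L * norm e * C"
        using abs_H_le[of v] L by (intro mult_mono) auto
      then show "norm (Q (k n) v) \<le> L * norm e * C * indicator (ball 0 1) v"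
        unfolding Q_def by (cases "norm v < 1") (auto simp: H_def abs_mult)
    qed
  qed (auto simp: Q_def)
  have lim_a: "(\<lambda>n. \<integral>v. a n v \<partial>lborel) \<longlonglongrightarrow> (\<integral>v. D v * H v \<partial>lborel)"
    unfolding a_eq by (intro Q_lim h_lim) (use h_pos in \<open>auto simp: less_imp_neq[symmetric]\<close>)
  have lim_b: "(\<lambda>n. \<integral>v. b n v \<partial>lborel) \<longlonglongrightarrow> (\<integral>v. D v * H v \<partial>lborel)"
    unfolding b_eq by (intro Q_lim) (use h_lim tendsto_minus[OF h_lim] h_pos in \<open>auto simp: less_imp_neq[symmetric]\<close>)
  \<comment> \<open>Gauge integrability follows from the enclosure alone, before \<open>X\<close> is
    known to be measurable.\<close>
  have "X integrable_on UNIV"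
  proof (rule integrable_straddle)
    fix \<epsilon> :: real assume "\<epsilon> > 0"
    moreover have "(\<lambda>n. \<bar>(\<integral>v. a n v \<partial>lborel) - (\<integral>v. b n v \<partial>lborel)\<bar>) \<longlonglongrightarrow> 0"
      using tendsto_rabs[OF tendsto_diff[OF lim_a lim_b]] by simp
    ultimately have "eventually (\<lambda>n. \<bar>(\<integral>v. a n v \<partial>lborel) - (\<integral>v. b n v \<partial>lborel)\<bar> < \<epsilon>) sequentially"
      by (rule order_tendstoD(2)[rotated])
    then obtain n where "\<bar>(\<integral>v. a n v \<partial>lborel) - (\<integral>v. b n v \<partial>lborel)\<bar> < \<epsilon>"
      by (auto simp: eventually_sequentially)
    then show "\<exists>g h i j. (g has_integral i) UNIV \<and> (h has_integral j) UNIV \<and> \<bar>i - j\<bar> < \<epsilon> \<and>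
        (\<forall>x\<in>UNIV. g x \<le> X x \<and> X x \<le> h x)"
      using has_integral_integral_lborel[OF a_int[of n]] has_integral_integral_lborel[OF b_int[of n]]
        aX Xb by blast
  qed
  moreover have a_int': "integrable lebesgue (a n)" and b_int': "integrable lebesgue (b n)" for n
    using a_int b_int by (auto intro: integrable_completion[THEN iffD2] borel_measurable_integrable)
  \<comment> \<open>Subtracting \<open>a 0\<close> makes the function nonnegative, and for
    nonnegative functions gauge integrability implies Lebesgue integrability.\<close>
  ultimately have "(\<lambda>v. X v - a 0 v) integrable_on UNIV"
    by (intro integrable_diff) (use has_integral_integral_lborel[OF a_int] in auto)
  then have "integrable lebesgue (\<lambda>v. X v - a 0 v)"
    using nonnegative_absolutely_integrable_1[of "\<lambda>v. X v - a 0 v" UNIV] aX[of 0]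
    by (auto simp: set_integrable_def)
  from Bochner_Integration.integrable_add[OF this a_int'[of 0]]
  have X_int: "integrable lebesgue X" by simp
  have "(\<integral>v. a n v \<partial>lborel) \<le> (\<integral>v. X v \<partial>lebesgue)" "(\<integral>v. X v \<partial>lebesgue) \<le> (\<integral>v. b n v \<partial>lborel)" for n
    using integral_mono[OF a_int' X_int] integral_mono[OF X_int b_int'] aX Xb
      borel_measurable_integrable[OF a_int] borel_measurable_integrable[OF b_int]
    by (auto simp: integral_completion)
  then have "(\<integral>v. X v \<partial>lebesgue) = (\<integral>v. D v * H v \<partial>lborel)"
    using LIMSEQ_le_const2[OF lim_a] LIMSEQ_le_const[OF lim_b] by (meson order_antisym)
  then show ?thesis
    using X_int unfolding X_def by (simp add: has_bochner_integral_iff)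
qed

end

section \<open>Radial cut-offs and shells near the unit sphere\<close>

definition ramp :: "real \<Rightarrow> 'a::euclidean_space \<Rightarrow> real" where
  "ramp \<epsilon> v = max 0 (min 1 ((1 - \<epsilon> - norm v) / \<epsilon>))"

text \<open>The region where \<open>ramp\<close> has slope \<open>1 / \<epsilon>\<close>. It keeps
  distance \<open>\<epsilon>\<close> from the unit sphere, so that the cut-off has support in a ball
  of radius less than 1, as integration by parts requires.\<close>

definition shell :: "real \<Rightarrow> 'a::euclidean_space set" where
  "shell \<epsilon> = {v. 1 - 2 * \<epsilon> < norm v \<and> norm v < 1 - \<epsilon>}"

definition ramp_deriv :: "real \<Rightarrow> 'a::euclidean_space \<Rightarrow> 'a \<Rightarrow> real" where
  "ramp_deriv \<epsilon> e v = - (1 / \<epsilon>) * (e \<bullet> sgn v) * indicator (shell \<epsilon>) v"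

lemma ramp_nonneg: "0 \<le> ramp \<epsilon> v" and ramp_le_1: "ramp \<epsilon> v \<le> 1"
  by (auto simp: ramp_def)

lemma ramp_measurable [measurable]: "ramp \<epsilon> \<in> borel_measurable borel"
  unfolding ramp_def[abs_def] by measurable

lemma shell_measurable [measurable]: "shell \<epsilon> \<in> sets borel"
  unfolding shell_def by measurable

lemma ramp_lipschitz: "\<epsilon> > 0 \<Longrightarrow> \<bar>ramp \<epsilon> u - ramp \<epsilon> v\<bar> \<le> 1 / \<epsilon> * norm (u - v)"
proof -
  assume "\<epsilon> > 0"
  have "\<bar>ramp \<epsilon> u - ramp \<epsilon> v\<bar> \<le> \<bar>(1 - \<epsilon> - norm u) / \<epsilon> - (1 - \<epsilon> - norm v) / \<epsilon>\<bar>"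
    unfolding ramp_def by (auto simp: max_def min_def)
  also have "(1 - \<epsilon> - norm u) / \<epsilon> - (1 - \<epsilon> - norm v) / \<epsilon> = (norm v - norm u) / \<epsilon>"
    by (simp add: diff_divide_distrib)
  also have "\<bar>\<dots>\<bar> \<le> norm (u - v) / \<epsilon>"
    using \<open>\<epsilon> > 0\<close> norm_triangle_ineq3[of v u]
    by (simp add: divide_right_mono norm_minus_commute)
  finally show ?thesis by simp
qed

lemma ramp_eq_0: "\<epsilon> > 0 \<Longrightarrow> 1 - \<epsilon> \<le> norm v \<Longrightarrow> ramp \<epsilon> v = 0"
  by (simp add: ramp_def divide_nonpos_pos max_def min_def zero_le_divide_iff)

lemma ramp_eq_1: "\<epsilon> > 0 \<Longrightarrow> norm v \<le> 1 - 2 * \<epsilon> \<Longrightarrow> ramp \<epsilon> v = 1"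
  by (simp add: ramp_def max_def min_def field_simps)

text \<open>Differentiability can fail only on the spheres of radius \<open>1 - \<epsilon>\<close>
  and \<open>1 - 2 * \<epsilon>\<close>, which are null sets. The kink of the norm at the origin is
  harmless because \<open>ramp\<close> is constant near it.\<close>

lemma ramp_derivative:
  assumes eps: "0 < \<epsilon>" "2 * \<epsilon> < 1"
  shows "AE v in lborel. ((\<lambda>h. (ramp \<epsilon> (v + h *\<^sub>R e) - ramp \<epsilon> v) / h) \<longlongrightarrow> ramp_deriv \<epsilon> e v) (at 0)"
proof -
  have sph: "AE v in lborel. norm (v::'a) \<noteq> r" for r
  proof -
    have "sphere (0::'a) r \<in> null_sets lebesgue"
      using negligible_sphere negligible_iff_null_sets by blast
    then have "sphere (0::'a) r \<in> null_sets lborel"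
      by (subst null_sets_completion_iff[symmetric]) auto
    then show ?thesis by (rule AE_I') (auto simp: dist_norm)
  qed
  from sph[of "1 - \<epsilon>"] sph[of "1 - 2 * \<epsilon>"] show ?thesis
  proof eventually_elim
    case (elim v)
    have nlim: "((\<lambda>h. norm (v + h *\<^sub>R e)) \<longlongrightarrow> norm v) (at 0)"
    proof -
      have "((\<lambda>h. norm (v + h *\<^sub>R e)) \<longlongrightarrow> norm (v + 0 *\<^sub>R e)) (at 0)"
        by (intro tendsto_intros)
      then show ?thesis by simp
    qed
    consider "norm v < 1 - 2 * \<epsilon>" | "v \<in> shell \<epsilon>" | "1 - \<epsilon> < norm v"
      using elim by (force simp: shell_def)
    then show ?case
    proof cases
      case 1
      have "eventually (\<lambda>h. norm (v + h *\<^sub>R e) < 1 - 2 * \<epsilon>) (at 0)"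
        by (rule order_tendstoD(2)[OF nlim 1])
      then have "eventually (\<lambda>h. (ramp \<epsilon> (v + h *\<^sub>R e) - ramp \<epsilon> v) / h = ramp_deriv \<epsilon> e v) (at 0)"
        by eventually_elim (use 1 eps in \<open>auto simp: ramp_eq_1 ramp_deriv_def shell_def\<close>)
      then show ?thesis by (rule tendsto_eventually)
    next
      case 3
      have "eventually (\<lambda>h. norm (v + h *\<^sub>R e) > 1 - \<epsilon>) (at 0)"
        by (rule order_tendstoD(1)[OF nlim 3])
      then have "eventually (\<lambda>h. (ramp \<epsilon> (v + h *\<^sub>R e) - ramp \<epsilon> v) / h = ramp_deriv \<epsilon> e v) (at 0)"
        by eventually_elim (use 3 eps in \<open>auto simp: ramp_eq_0 ramp_deriv_def shell_def\<close>)
      then show ?thesis by (rule tendsto_eventually)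
    next
      case 2
      then have v: "v \<noteq> 0" using eps by (auto simp: shell_def)
      have in_shell: "ramp \<epsilon> w = (1 - \<epsilon> - norm w) / \<epsilon>"
        if "1 - 2 * \<epsilon> < norm w" "norm w < 1 - \<epsilon>" for w :: 'a
        using that eps by (simp add: ramp_def max_def min_def field_simps)
      have "((\<lambda>h. norm (v + h *\<^sub>R e)) has_derivative (\<lambda>h. (h *\<^sub>R e) \<bullet> sgn (v + 0 *\<^sub>R e))) (at 0)"
        by (rule has_derivative_compose[where g = norm, OF _ has_derivative_norm])
           (use v in \<open>auto intro!: derivative_eq_intros\<close>)
      then have "((\<lambda>h. norm (v + h *\<^sub>R e)) has_real_derivative (e \<bullet> sgn v)) (at 0)"
        by (simp add: has_field_derivative_def mult_commute_abs)
      then have "((\<lambda>h. (norm (v + h *\<^sub>R e) - norm v) / h) \<longlongrightarrow> e \<bullet> sgn v) (at 0)"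
        by (simp add: DERIV_def)
      then have "((\<lambda>h. - (1 / \<epsilon>) * ((norm (v + h *\<^sub>R e) - norm v) / h)) \<longlongrightarrow> - (1 / \<epsilon>) * (e \<bullet> sgn v)) (at 0)"
        by (rule tendsto_mult_left)
      moreover have "eventually (\<lambda>h. 1 - 2 * \<epsilon> < norm (v + h *\<^sub>R e) \<and> norm (v + h *\<^sub>R e) < 1 - \<epsilon>) (at 0)"
        using order_tendstoD[OF nlim] 2 by (auto simp: shell_def intro: eventually_conj)
      then have "eventually (\<lambda>h. - (1 / \<epsilon>) * ((norm (v + h *\<^sub>R e) - norm v) / h) =
          (ramp \<epsilon> (v + h *\<^sub>R e) - ramp \<epsilon> v) / h) (at 0)"
      proof eventually_elim
        case (elim h)
        then have "(ramp \<epsilon> (v + h *\<^sub>R e) - ramp \<epsilon> v) = - (1 / \<epsilon>) * (norm (v + h *\<^sub>R e) - norm v)"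
          using 2 eps by (simp add: in_shell shell_def field_simps)
        then show ?case by simp
      qed
      ultimately show ?thesis
        using 2 by (simp add: ramp_deriv_def tendsto_cong)
    qed
  qed
qed

text \<open>The choice \<open>1 / (real k + 3)\<close> keeps \<open>2 * \<epsilon> < 1\<close> for
  every \<open>k\<close>, including 0. Convergence holds at every point, with values that are
  eventually constant.\<close>

lemma ramp_tendsto:
  fixes v :: "'a::euclidean_space"
  shows "(\<lambda>k. ramp (1 / (real k + 3)) v) \<longlonglongrightarrow> indicator (ball 0 1) v"
proof (cases "norm v < 1")
  case True
  have "(\<lambda>k. 1 - 2 * (1 / (real k + 3))) \<longlonglongrightarrow> 1"
    by real_asymp
  then have "eventually (\<lambda>k. norm v < 1 - 2 * (1 / (real k + 3))) sequentially"
    by (rule order_tendstoD) (use True in simp)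
  then have "eventually (\<lambda>k. ramp (1 / (real k + 3)) v = indicator (ball 0 1) v) sequentially"
    by eventually_elim (use True in \<open>simp add: ramp_eq_1\<close>)
  then show ?thesis by (rule tendsto_eventually)
next
  case False
  have "ramp (1 / (real k + 3)) v = 0" for k
  proof (rule ramp_eq_0)
    show pos: "0 < 1 / (real k + 3)" by simp
    then show "1 - 1 / (real k + 3) \<le> norm v" using False by linarith
  qed
  then show ?thesis using False by simp
qed

text \<open>The function \<open>x ^ n\<close> has derivative at most \<open>n\<close> on
  \<open>[0, 1]\<close>. With the dimension as exponent this becomes the factor d of the movement
  bound.\<close>

lemma power_diff_le:
  fixes a b :: real
  assumes "0 \<le> b" "b \<le> a" "a \<le> 1"
  shows "a ^ n - b ^ n \<le> n * (a - b)"
proof (induction n)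
  case (Suc n)
  have "a ^ Suc n - b ^ Suc n = a * (a ^ n - b ^ n) + b ^ n * (a - b)"
    by (simp add: algebra_simps)
  also have "\<dots> \<le> 1 * (a ^ n - b ^ n) + 1 * (a - b)"
    using assms by (intro add_mono mult_right_mono) (auto simp: power_mono power_le_one)
  finally show ?case using Suc by (simp add: algebra_simps)
qed simp

lemma measure_shell_le:
  fixes \<epsilon> :: real
  assumes eps: "0 < \<epsilon>" "2 * \<epsilon> < 1"
  shows "measure lborel (shell \<epsilon> :: 'a::euclidean_space set) \<le> DIM('a) * \<epsilon> * measure lborel (ball (0::'a) 1)"
proof -
  have sh: "shell \<epsilon> = ball (0::'a) (1 - \<epsilon>) - cball 0 (1 - 2 * \<epsilon>)"
    by (auto simp: shell_def)
  have "measure lborel (shell \<epsilon> :: 'a set) =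
      measure lborel (ball (0::'a) (1 - \<epsilon>)) - measure lborel (cball (0::'a) (1 - 2 * \<epsilon>))"
    unfolding sh
  proof (rule measure_Diff)
    show "emeasure lborel (ball (0::'a) (1 - \<epsilon>)) \<noteq> \<infinity>"
      using emeasure_lborel_ball_finite[of "0::'a" "1 - \<epsilon>"] by simp
    show "cball (0::'a) (1 - 2 * \<epsilon>) \<subseteq> ball 0 (1 - \<epsilon>)" using eps by auto
  qed simp_all
  also have "\<dots> = unit_ball_vol DIM('a) * ((1 - \<epsilon>) ^ DIM('a) - (1 - 2 * \<epsilon>) ^ DIM('a))"
    using eps by (simp add: content_ball content_cball right_diff_distrib)
  also have "\<dots> \<le> unit_ball_vol DIM('a) * (DIM('a) * ((1 - \<epsilon>) - (1 - 2 * \<epsilon>)))"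
    using eps by (intro mult_left_mono power_diff_le) auto
  also have "\<dots> = DIM('a) * \<epsilon> * measure lborel (ball (0::'a) 1)"
    by (simp add: content_ball)
  finally show ?thesis .
qed

section \<open>Measurability and integrability of the supergradient up to the sphere\<close>

context ball_supergradient
begin

lemma H_eq_0: "1 \<le> norm v \<Longrightarrow> H v = 0"
  by (simp add: H_def)

lemma ramp_integral:
  assumes eps: "0 < \<epsilon>" "2 * \<epsilon> < 1"
  shows "has_bochner_integral lebesgue (\<lambda>v. ramp \<epsilon> v * (m v \<bullet> e)) (\<integral>v. ramp_deriv \<epsilon> e v * H v \<partial>lborel)"
  by (rule integration_by_parts[where r = "1 - \<epsilon>", OF ramp_nonneg ramp_lipschitz ramp_eq_0 _ _ ramp_derivative])
     (use eps in \<open>auto simp: ramp_deriv_def[abs_def]\<close>)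

text \<open>Each component is the pointwise limit of its products with \<open>ramp\<close>, whose
  measurability is part of the conclusion of integration by parts.\<close>

lemma gradient_measurable: "(\<lambda>v. indicator (ball 0 1) v *\<^sub>R m v) \<in> borel_measurable lebesgue"
proof (subst borel_measurable_euclidean_space, intro ballI)
  fix e :: 'a
  have "(\<lambda>v. indicator (ball 0 1) v * (m v \<bullet> e)) \<in> borel_measurable lebesgue"
  proof (rule borel_measurable_LIMSEQ_real)
    show "(\<lambda>v. ramp (1 / (real k + 3)) v * (m v \<bullet> e)) \<in> borel_measurable lebesgue" for k
      using ramp_integral[of "1 / (real k + 3)" e]
      by (auto simp: has_bochner_integral_iff field_simps)
    show "(\<lambda>k. ramp (1 / (real k + 3)) v * (m v \<bullet> e)) \<longlonglongrightarrow> indicator (ball 0 1) v * (m v \<bullet> e)" for v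
      by (intro tendsto_intros ramp_tendsto)
  qed
  then show "(\<lambda>v. (indicator (ball 0 1) v *\<^sub>R m v) \<bullet> e) \<in> borel_measurable lebesgue" by simp
qed

lemma gradient_measurable_subset:
  assumes "S \<subseteq> ball 0 1" and [measurable]: "S \<in> sets lebesgue"
  shows "(\<lambda>v. indicator S v *\<^sub>R m v) \<in> borel_measurable lebesgue"
proof -
  have "(\<lambda>v. indicator S v *\<^sub>R (indicator (ball 0 1) v *\<^sub>R m v)) \<in> borel_measurable lebesgue"
    using gradient_measurable by measurable
  moreover have "(\<lambda>v. indicator S v *\<^sub>R (indicator (ball 0 1) v *\<^sub>R m v)) = (\<lambda>v. indicator S v *\<^sub>R m v)"
    using assms(1) by (auto simp: indicator_def fun_eq_iff)
  ultimately show ?thesis by simp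
qed

text \<open>The supergradient inequality is tested at the point of norm 1/2 in the direction of
  \<open>m v\<close>, away from the sphere. This reduces integrability of \<open>norm (m v)\<close>
  near the sphere to a bound for the integral of \<open>m v \<bullet> v\<close>.\<close>

lemma norm_gradient_le_radial: 
  assumes v: "norm v < 1"
  shows "norm (m v) \<le> 2 * (m v \<bullet> v + C)"
proof -
  define u where "u = (1 / 2) *\<^sub>R sgn (m v)"
  have u: "norm u < 1" by (simp add: u_def norm_sgn)
  have "m v \<bullet> u = norm (m v) / 2"
    by (cases "m v = 0") (simp_all add: u_def sgn_div_norm power2_norm_eq_inner[symmetric] power2_eq_square)
  then show ?thesis
    using supergradient[OF v u] nonneg[OF u] bounded[OF v] by (simp add: inner_diff_right)
qed

lemma integrable_H_indicator:
  assumes [measurable]: "S \<in> sets borel"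
  shows "integrable lborel (\<lambda>v. indicator S v * H v)"
  by (rule integrable_bounded_support[where B = C and R = 1])
     (use abs_H_le C_nonneg in \<open>auto simp: indicator_def H_eq_0\<close>)

lemma integrable_gradient_cball:
  assumes r: "0 < r" "r < 1"
  shows "integrable lebesgue (\<lambda>v. indicator (cball 0 r) v *\<^sub>R m v)"
proof (rule Bochner_Integration.integrable_bound)
  show "integrable lebesgue (\<lambda>x. 2 * C / (1 - r) * indicator (cball (0::'a) r) x :: real)"
    by (intro integrable_mult_right integrable_real_indicator)
       (use emeasure_lborel_cball_finite[of "0::'a" r] in auto)
  show "(\<lambda>v. indicator (cball 0 r) v *\<^sub>R m v) \<in> borel_measurable lebesgue"
    by (rule gradient_measurable_subset) (use r in auto)
  show "AE v in lebesgue. norm (indicator (cball 0 r) v *\<^sub>R m v) \<le> norm (2 * C / (1 - r) * indicator (cball 0 r) v)"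
    using norm_gradient_le_on_cball r C_nonneg by (auto simp: indicator_def)
qed

lemma integrable_radial_cball:
  assumes r: "0 < r" "r < 1"
  shows "integrable lebesgue (\<lambda>v. indicator (cball 0 r) v * (m v \<bullet> v))"
proof (rule Bochner_Integration.integrable_bound[OF integrable_norm[OF integrable_gradient_cball[OF r]]])
  show "(\<lambda>v. indicator (cball 0 r) v * (m v \<bullet> v)) \<in> borel_measurable lebesgue"
  proof -
    have [measurable]: "(\<lambda>v. indicator (cball 0 r) v *\<^sub>R m v) \<in> borel_measurable lebesgue"
      using integrable_gradient_cball[OF r] by (rule borel_measurable_integrable)
    have "(\<lambda>v. (indicator (cball 0 r) v *\<^sub>R m v) \<bullet> v) \<in> borel_measurable lebesgue"
      by (intro borel_measurable_inner) (auto intro: measurable_completion)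
    then show ?thesis by simp
  qed
  have "\<bar>m v \<bullet> v\<bar> \<le> norm (m v)" if "norm v \<le> r" for v
  proof -
    have "\<bar>m v \<bullet> v\<bar> \<le> norm (m v) * norm v" by (rule Cauchy_Schwarz_ineq2)
    also have "\<dots> \<le> norm (m v) * 1" using that r by (intro mult_left_mono) auto
    finally show ?thesis by simp
  qed
  then show "AE v in lebesgue. norm (indicator (cball 0 r) v * (m v \<bullet> v)) \<le> norm (norm (indicator (cball 0 r) v *\<^sub>R m v))"
    by (auto simp: indicator_def)
qed

text \<open>The dilation \<open>v \<mapsto> (1 + h) v\<close> turns the supergradient inequality into a bound for the radial
  part of \<open>m\<close> that stays finite up to the boundary of the ball.\<close>

lemma radial_integral_le:
  assumes r: "0 < r" "r < 1"
  shows "(\<integral>v. indicator (cball 0 r) v * (m v \<bullet> v) \<partial>lebesgue) \<le> DIM('a) * C * measure lborel (ball (0::'a) 1)"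
proof -
  \<comment> \<open>Half of the gap gives \<open>(1 + h) * r \<le> (1 + r) / 2 < 1\<close>, so the
    dilated ball stays inside the open unit ball.\<close>
  define h where "h = (1 - r) / 2"
  have h: "h > 0" using r by (simp add: h_def)
  have hr: "(1 + h) * r < 1"
  proof -
    have "(1 + h) * r = r + h * r" by (simp add: algebra_simps)
    also have "\<dots> \<le> r + h" using h r by simp
    also have "\<dots> < 1" using r by (simp add: h_def field_simps)
    finally show ?thesis .
  qed
  let ?I = "indicator (cball (0::'a) r) :: 'a \<Rightarrow> real"
  have [measurable]: "cball (0::'a) r \<in> sets borel" by simp
  have [measurable]: "(\<lambda>v. ?I v * H ((1 + h) *\<^sub>R v)) \<in> borel_measurable borel" by measurable
  have int1: "integrable lborel (\<lambda>v. ?I v * H v)"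
    by (rule integrable_H_indicator) auto
  have int2: "integrable lborel (\<lambda>v. ?I v * H ((1 + h) *\<^sub>R v))"
    by (rule integrable_bounded_support[where B = C and R = 1])
       (use r abs_H_le C_nonneg in \<open>auto simp: indicator_def\<close>)
  note int3 = integrable_radial_cball[OF r]
  have "(\<integral>v. ?I v * (m v \<bullet> v) \<partial>lebesgue) \<le> (\<integral>v. (?I v * H v - ?I v * H ((1 + h) *\<^sub>R v)) / h \<partial>lebesgue)"
  proof (rule integral_mono[OF int3])
    show "integrable lebesgue (\<lambda>v. (?I v * H v - ?I v * H ((1 + h) *\<^sub>R v)) / h)"
      using int1 int2
      by (intro integrable_divide_zero Bochner_Integration.integrable_diff integrable_completion[THEN iffD2])
         (auto intro: borel_measurable_integrable)
    fix v :: 'a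
    show "?I v * (m v \<bullet> v) \<le> (?I v * H v - ?I v * H ((1 + h) *\<^sub>R v)) / h"
    proof (cases "norm v \<le> r")
      case True
      have "norm ((1 + h) *\<^sub>R v) \<le> (1 + h) * r" using True h by (simp add: mult_left_mono)
      then have n: "norm ((1 + h) *\<^sub>R v) < 1" using hr by linarith
      have "G ((1 + h) *\<^sub>R v) \<le> G v - m v \<bullet> ((1 + h) *\<^sub>R v - v)"
        by (rule supergradient) (use True r n in auto)
      also have "(1 + h) *\<^sub>R v - v = h *\<^sub>R v" by (simp add: algebra_simps)
      finally show ?thesis using True r n h H_eq[OF n] by (simp add: H_eq field_simps)
    qed simp
  qed
  also have "\<dots> = (\<integral>v. (?I v * H v - ?I v * H ((1 + h) *\<^sub>R v)) / h \<partial>lborel)"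
    by (rule integral_completion) measurable
  also have "\<dots> = ((\<integral>v. ?I v * H v \<partial>lborel) - (\<integral>v. ?I v * H ((1 + h) *\<^sub>R v) \<partial>lborel)) / h"
    using int1 int2 by simp
  also have "\<dots> \<le> DIM('a) * (\<integral>v. ?I v * H v \<partial>lborel)"
  proof -
    define J where "J = (\<integral>v. ?I v * H v \<partial>lborel)"
    define K where "K = (\<integral>v. ?I v * H ((1 + h) *\<^sub>R v) \<partial>lborel)"
    have J0: "0 \<le> J" unfolding J_def by (intro Bochner_Integration.integral_nonneg) (simp add: H_nonneg)
    have Keq: "(\<integral>v. indicator (cball 0 ((1 + h) * r)) (0 + (1 + h) *\<^sub>R v) * H (0 + (1 + h) *\<^sub>R v) \<partial>lborel) = K"
      unfolding K_def
    proof (rule Bochner_Integration.integral_cong[OF refl])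
      fix v :: 'a
      have "norm ((1 + h) *\<^sub>R v) \<le> (1 + h) * r \<longleftrightarrow> norm v \<le> r" using h by simp
      then show "indicator (cball 0 ((1 + h) * r)) (0 + (1 + h) *\<^sub>R v) * H (0 + (1 + h) *\<^sub>R v) =
          ?I v * H ((1 + h) *\<^sub>R v)"
        by (simp only: indicator_def mem_cball_0 add_0)
    qed
    \<comment> \<open>Enlarging the domain to the dilated ball and substituting
      \<open>(1 + h) *\<^sub>R v\<close> compares \<open>J\<close> with \<open>K\<close> at the cost
      of the Jacobian.\<close>
    have "J \<le> (\<integral>v. indicator (cball 0 ((1 + h) * r)) v * H v \<partial>lborel)"
      unfolding J_def
    proof (rule integral_mono[OF int1])
      show "integrable lborel (\<lambda>v. indicator (cball 0 ((1 + h) * r)) v * H v)"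
        by (rule integrable_H_indicator) auto
      fix v :: 'a
      have "r \<le> (1 + h) * r" using h r by simp
      then have "cball (0::'a) r \<subseteq> cball 0 ((1 + h) * r)" by (rule subset_cball)
      then show "?I v * H v \<le> indicator (cball 0 ((1 + h) * r)) v * H v"
        by (intro mult_right_mono H_nonneg indicator_leI) (rule subsetD)
    qed
    also have "\<dots> = \<bar>1 + h\<bar> ^ DIM('a) *
        (\<integral>v. indicator (cball 0 ((1 + h) * r)) (0 + (1 + h) *\<^sub>R v) * H (0 + (1 + h) *\<^sub>R v) \<partial>lborel)"
    proof (rule lborel_integral_affine[of "\<lambda>v. indicator (cball 0 ((1 + h) * r)) v * H v" "1 + h" 0])
      show "(\<lambda>v. indicator (cball 0 ((1 + h) * r)) v * H v) \<in> borel_measurable borel"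
        using borel_measurable_integrable[OF integrable_H_indicator, of "cball 0 ((1 + h) * r)"] by simp
      show "1 + h \<noteq> 0" using h by simp
    qed
    finally have JK: "J \<le> (1 + h) ^ DIM('a) * K" using h by (simp only: Keq abs_of_pos add_pos_pos zero_less_one)
    \<comment> \<open>By Bernoulli's inequality the inverse Jacobian is at least
      \<open>1 - h * DIM('a)\<close>. The division by \<open>h\<close> is thereby absorbed, and the
      bound stays the same when \<open>r\<close> tends to 1 and \<open>h\<close> to 0.\<close>
    define q where "q = 1 / (1 + h)"
    have "(1 - h * DIM('a)) * J \<le> q ^ DIM('a) * J"
    proof (rule mult_right_mono[OF _ J0])
      have "1 - h * DIM('a) \<le> 1 + DIM('a) * (- (h / (1 + h)))"
        using h by (simp add: field_simps)
      also have "\<dots> \<le> (1 + - (h / (1 + h))) ^ DIM('a)"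
        using h by (intro Bernoulli_inequality) (simp add: field_simps)
      also have "\<dots> = q ^ DIM('a)" using h by (simp add: q_def field_simps)
      finally show "1 - h * DIM('a) \<le> q ^ DIM('a)" .
    qed
    also have "\<dots> \<le> q ^ DIM('a) * ((1 + h) ^ DIM('a) * K)"
      using JK h by (intro mult_left_mono) (auto simp: q_def)
    also have "\<dots> = K" using h by (simp add: q_def power_one_over)
    finally have "J - K \<le> h * DIM('a) * J" by (simp add: algebra_simps)
    then have "(J - K) / h \<le> DIM('a) * J" using h by (simp add: field_simps)
    then show ?thesis unfolding J_def K_def .
  qed
  also have "\<dots> \<le> DIM('a) * (C * measure lborel (ball (0::'a) 1))"
  proof (rule mult_left_mono)
    have "(\<integral>v. ?I v * H v \<partial>lborel) \<le> (\<integral>v. C * indicator (ball (0::'a) 1) v \<partial>lborel)"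
    proof (rule integral_mono[OF int1])
      show "integrable lborel (\<lambda>v. C * indicator (ball (0::'a) 1) v)"
        by (intro integrable_mult_right integrable_real_indicator)
           (use emeasure_lborel_ball_finite[of "0::'a" 1] in auto)
      show "?I v * H v \<le> C * indicator (ball (0::'a) 1) v" for v
        using H_le[of v] C_nonneg r by (auto simp: indicator_def H_def)
    qed
    then show "(\<integral>v. ?I v * H v \<partial>lborel) \<le> C * measure lborel (ball (0::'a) 1)" by simp
  qed simp
  finally show ?thesis by (simp add: mult.assoc)
qed

text \<open>Fatou's lemma along radii increasing to 1: the bound \<open>B\<close> for the integral
  of the norm over the smaller balls does not depend on the radius.\<close>

lemma integrable_gradient: "integrable lebesgue (\<lambda>v. indicator (ball 0 1) v *\<^sub>R m v)"
proof (rule integrableI_bounded[OF gradient_measurable])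
  define \<rho> where "\<rho> k = 1 - 1 / (real k + 2)" for k
  have rho: "0 < \<rho> k" "\<rho> k < 1" for k by (auto simp: \<rho>_def field_simps)
  have rho_lim: "\<rho> \<longlonglongrightarrow> 1" unfolding \<rho>_def by real_asymp
  define B where "B = 2 * (DIM('a) * C * measure lborel (ball (0::'a) 1) + C * measure lborel (ball (0::'a) 1))"
  have le_B: "(\<integral>\<^sup>+v. ennreal (norm (indicator (cball 0 (\<rho> k)) v *\<^sub>R m v)) \<partial>lebesgue) \<le> ennreal B" for k
  proof -
    let ?I = "indicator (cball (0::'a) (\<rho> k)) :: 'a \<Rightarrow> real"
    note int = integrable_gradient_cball[OF rho[of k]]
    note int3 = integrable_radial_cball[OF rho[of k]]
    have int4: "integrable lebesgue (\<lambda>v. C * ?I v)"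
      by (intro integrable_mult_right integrable_real_indicator)
         (use emeasure_lborel_cball_finite[of "0::'a" "\<rho> k"] in auto)
    have "(\<integral>v. norm (?I v *\<^sub>R m v) \<partial>lebesgue) \<le> (\<integral>v. 2 * (?I v * (m v \<bullet> v) + C * ?I v) \<partial>lebesgue)"
    proof (rule integral_mono[OF integrable_norm[OF int]])
      show "integrable lebesgue (\<lambda>v. 2 * (?I v * (m v \<bullet> v) + C * ?I v))"
        using int3 int4 by auto
      show "norm (?I v *\<^sub>R m v) \<le> 2 * (?I v * (m v \<bullet> v) + C * ?I v)" for v
        using norm_gradient_le_radial[of v] rho[of k] by (auto simp: indicator_def)
    qed
    also have "\<dots> = 2 * ((\<integral>v. ?I v * (m v \<bullet> v) \<partial>lebesgue) + C * measure lebesgue (cball (0::'a) (\<rho> k)))"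
      using int3 int4 by simp
    also have "\<dots> \<le> B"
    proof -
      have "measure lebesgue (cball (0::'a) (\<rho> k)) \<le> measure lebesgue (ball (0::'a) 1)"
        by (rule measure_mono_fmeasurable) (use rho[of k] in auto)
      then have "C * measure lebesgue (cball (0::'a) (\<rho> k)) \<le> C * measure lborel (ball (0::'a) 1)"
        using C_nonneg by (intro mult_left_mono) (auto simp: measure_completion)
      then show ?thesis using radial_integral_le[OF rho[of k]] by (simp add: B_def)
    qed
    finally show ?thesis
      using nn_integral_eq_integral[OF integrable_norm[OF int]] by (simp add: ennreal_leI)
  qed
  have "(\<integral>\<^sup>+v. ennreal (norm (indicator (ball 0 1) v *\<^sub>R m v)) \<partial>lebesgue) =
      (\<integral>\<^sup>+v. liminf (\<lambda>k. ennreal (norm (indicator (cball 0 (\<rho> k)) v *\<^sub>R m v))) \<partial>lebesgue)"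
  proof (rule nn_integral_cong)
    fix v :: 'a
    have "eventually (\<lambda>k. ennreal (norm (indicator (cball 0 (\<rho> k)) v *\<^sub>R m v)) =
        ennreal (norm (indicator (ball 0 1) v *\<^sub>R m v))) sequentially"
    proof (cases "norm v < 1")
      case True
      then have "eventually (\<lambda>k. norm v < \<rho> k) sequentially"
        by (intro order_tendstoD[OF rho_lim])
      then show ?thesis by eventually_elim (use True in auto)
    next
      case False
      then have "\<not> norm v \<le> \<rho> k" for k using rho(2)[of k] by linarith
      then show ?thesis using False by simp
    qed
    then have "(\<lambda>k. ennreal (norm (indicator (cball 0 (\<rho> k)) v *\<^sub>R m v))) \<longlonglongrightarrow>
        ennreal (norm (indicator (ball 0 1) v *\<^sub>R m v))"
      by (rule tendsto_eventually)
    then show "ennreal (norm (indicator (ball 0 1) v *\<^sub>R m v)) =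
        liminf (\<lambda>k. ennreal (norm (indicator (cball 0 (\<rho> k)) v *\<^sub>R m v)))"
      by (rule lim_imp_Liminf[OF trivial_limit_sequentially, symmetric])
  qed
  also have "\<dots> \<le> liminf (\<lambda>k. \<integral>\<^sup>+v. ennreal (norm (indicator (cball 0 (\<rho> k)) v *\<^sub>R m v)) \<partial>lebesgue)"
  proof (rule nn_integral_liminf)
    fix k
    have "(\<lambda>v. indicator (cball 0 (\<rho> k)) v *\<^sub>R m v) \<in> borel_measurable lebesgue"
      using integrable_gradient_cball[OF rho[of k]] by (rule borel_measurable_integrable)
    then show "(\<lambda>v. ennreal (norm (indicator (cball 0 (\<rho> k)) v *\<^sub>R m v))) \<in> borel_measurable lebesgue"
      by measurable
  qed
  also have "\<dots> \<le> ennreal B"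
  proof -
    have "liminf (\<lambda>k. \<integral>\<^sup>+v. ennreal (norm (indicator (cball 0 (\<rho> k)) v *\<^sub>R m v)) \<partial>lebesgue)
        \<le> liminf (\<lambda>k::nat. ennreal B)"
      by (rule Liminf_mono, rule always_eventually, rule allI, rule le_B)
    also have "\<dots> = ennreal B" by (rule Liminf_const) (rule trivial_limit_sequentially)
    finally show ?thesis .
  qed
  also have "\<dots> < \<infinity>" by simp
  finally show "(\<integral>\<^sup>+v. ennreal (norm (indicator (ball 0 1) v *\<^sub>R m v)) \<partial>lebesgue) < \<infinity>" .
qed

text \<open>Dominated by \<open>norm (m v)\<close> on the ball, now known to be integrable.
  Estimates obtained by integration by parts for the cut-off integrals can thus be carried over to
  the whole ball.\<close>

lemma ramp_integral_tendsto:
  "(\<lambda>k. \<integral>v. ramp (1 / (real k + 3)) v *\<^sub>R m v \<partial>lebesgue) \<longlonglongrightarrow> (\<integral>v. indicator (ball 0 1) v *\<^sub>R m v \<partial>lebesgue)"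
proof -
  have eq: "ramp \<epsilon> v *\<^sub>R m v = ramp \<epsilon> v *\<^sub>R (indicator (ball 0 1) v *\<^sub>R m v)" if "\<epsilon> > 0" for \<epsilon> v
    using ramp_eq_0[OF that, of v] that by (cases "norm v < 1") auto
  have [measurable]: "ramp \<epsilon> \<in> borel_measurable lebesgue" for \<epsilon>
    by (rule measurable_completion) simp
  note [measurable] = gradient_measurable
  have "(\<lambda>k. \<integral>v. ramp (1 / (real k + 3)) v *\<^sub>R (indicator (ball 0 1) v *\<^sub>R m v) \<partial>lebesgue) \<longlonglongrightarrow>
      (\<integral>v. indicator (ball 0 1) v *\<^sub>R m v \<partial>lebesgue)"
  proof (rule integral_dominated_convergence[where w = "\<lambda>v. norm (indicator (ball 0 1) v *\<^sub>R m v)"])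
    show "AE v in lebesgue. (\<lambda>k. ramp (1 / (real k + 3)) v *\<^sub>R (indicator (ball 0 1) v *\<^sub>R m v)) \<longlonglongrightarrow>
        indicator (ball 0 1) v *\<^sub>R m v"
    proof (rule AE_I2)
      fix v :: 'a
      have "(\<lambda>k. ramp (1 / (real k + 3)) v *\<^sub>R (indicator (ball 0 1) v *\<^sub>R m v)) \<longlonglongrightarrow>
          indicator (ball 0 1) v *\<^sub>R (indicator (ball 0 1) v *\<^sub>R m v)"
        by (intro tendsto_intros ramp_tendsto)
      then show "(\<lambda>k. ramp (1 / (real k + 3)) v *\<^sub>R (indicator (ball 0 1) v *\<^sub>R m v)) \<longlonglongrightarrow>
          indicator (ball 0 1) v *\<^sub>R m v"
        by (cases "norm v < 1") simp_all
    qed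
    show "AE v in lebesgue. norm (ramp (1 / (real k + 3)) v *\<^sub>R (indicator (ball 0 1) v *\<^sub>R m v)) \<le>
        norm (indicator (ball 0 1) v *\<^sub>R m v)" for k
      unfolding norm_scaleR[of "ramp _ _"]
      by (intro AE_I2 mult_left_le_one_le) (simp_all add: ramp_nonneg ramp_le_1)
    show "(\<lambda>v. indicator (ball 0 1) v *\<^sub>R m v) \<in> borel_measurable lebesgue"
      by (rule gradient_measurable)
    show "(\<lambda>v. ramp (1 / (real k + 3)) v *\<^sub>R (indicator (ball 0 1) v *\<^sub>R m v)) \<in> borel_measurable lebesgue" for k
      by (intro borel_measurable_scaleR gradient_measurable) measurable
    show "integrable lebesgue (\<lambda>v. norm (indicator (ball 0 1) v *\<^sub>R m v))"
      by (rule integrable_norm[OF integrable_gradient])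
  qed
  then show ?thesis by (subst eq) auto
qed

text \<open>Pairing \<open>v\<close> with \<open>- v\<close> cancels the linear term of the
  supergradient inequality at 0, which leaves \<open>G v + G (- v) \<le> 2 * G 0\<close>. The
  movement bound applies this to shells, the service bound to balls.\<close>

lemma integral_symmetric_le:
  assumes [measurable]: "S \<in> sets borel" and sub: "S \<subseteq> ball 0 1"
    and sym: "\<And>v. - v \<in> S \<longleftrightarrow> v \<in> S"
  shows "(\<integral>v. indicator S v * H v \<partial>lborel) \<le> measure lborel S * G 0"
proof -
  have fin: "emeasure lborel S < \<infinity>"
    using emeasure_mono[OF sub, of lborel] emeasure_lborel_ball_finite[of "0::'a" 1]
    by (auto intro: le_less_trans)
  have int: "integrable lborel (\<lambda>v. indicator S v * H v)"
    by (rule integrable_H_indicator) auto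
  have "(\<integral>v. indicator S v * H v \<partial>lborel) =
      \<bar>-1\<bar> ^ DIM('a) * (\<integral>v. indicator S (0 + (-1) *\<^sub>R v) * H (0 + (-1) *\<^sub>R v) \<partial>lborel)"
    by (rule lborel_integral_affine[of "\<lambda>v. indicator S v * H v" "-1" 0]) auto
  also have "\<dots> = (\<integral>v. indicator S v * H (- v) \<partial>lborel)"
    using sym by (simp add: indicator_def)
  finally have eq: "(\<integral>v. indicator S v * H v \<partial>lborel) = (\<integral>v. indicator S v * H (- v) \<partial>lborel)" .
  have int': "integrable lborel (\<lambda>v. indicator S v * H (- v))"
    by (rule integrable_bounded_support[where B = C and R = 1])
       (use sub abs_H_le C_nonneg in \<open>auto simp: indicator_def\<close>)
  have "2 * (\<integral>v. indicator S v * H v \<partial>lborel) = (\<integral>v. indicator S v * H v + indicator S v * H (- v) \<partial>lborel)"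
    using int int' eq by simp
  also have "\<dots> \<le> (\<integral>v. 2 * G 0 * indicator S v \<partial>lborel)"
  proof (rule integral_mono)
    show "integrable lborel (\<lambda>v. 2 * G 0 * indicator S v :: real)"
      using fin by (intro integrable_mult_right integrable_real_indicator) auto
    fix v
    show "indicator S v * H v + indicator S v * H (- v) \<le> 2 * G 0 * indicator S v"
    proof (cases "v \<in> S")
      case True
      then have "norm v < 1" using sub by auto
      then show ?thesis
        using supergradient[of 0 v] supergradient[of 0 "- v"] True by (simp add: H_eq)
    qed simp
  qed (use int int' in auto)
  also have "\<dots> = 2 * (measure lborel S * G 0)"
    by simp
  finally show ?thesis by simp
qed

end

section \<open>Variation of the ball integral\<close>

definition ball_integral :: "('a::euclidean_space \<Rightarrow> 'a) \<Rightarrow> 'a" where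
  "ball_integral m = (\<integral>v. indicator (ball 0 1) v *\<^sub>R m v \<partial>lebesgue)"

context ball_supergradient
begin

lemma integrable_ramp:
  assumes eps: "0 < \<epsilon>"
  shows "integrable lebesgue (\<lambda>v. ramp \<epsilon> v *\<^sub>R m v)"
proof -
  have "integrable lebesgue (\<lambda>v. ramp \<epsilon> v *\<^sub>R (indicator (ball 0 1) v *\<^sub>R m v))"
  proof (rule Bochner_Integration.integrable_bound[OF integrable_gradient])
    have [measurable]: "ramp \<epsilon> \<in> borel_measurable lebesgue"
      by (rule measurable_completion) simp
    show "(\<lambda>v. ramp \<epsilon> v *\<^sub>R (indicator (ball 0 1) v *\<^sub>R m v)) \<in> borel_measurable lebesgue"
      by (intro borel_measurable_scaleR gradient_measurable) measurable
    show "AE v in lebesgue. norm (ramp \<epsilon> v *\<^sub>R (indicator (ball 0 1) v *\<^sub>R m v)) \<le>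
        norm (indicator (ball 0 1) v *\<^sub>R m v)"
      unfolding norm_scaleR[of "ramp _ _"]
      by (intro AE_I2 mult_left_le_one_le) (simp_all add: ramp_nonneg ramp_le_1)
  qed
  moreover have "(\<lambda>v. ramp \<epsilon> v *\<^sub>R (indicator (ball 0 1) v *\<^sub>R m v)) = (\<lambda>v. ramp \<epsilon> v *\<^sub>R m v)"
  proof
    fix v :: 'a
    show "ramp \<epsilon> v *\<^sub>R (indicator (ball 0 1) v *\<^sub>R m v) = ramp \<epsilon> v *\<^sub>R m v"
      using ramp_eq_0[OF eps, of v] eps by (cases "norm v < 1") auto
  qed
  ultimately show ?thesis by simp
qed

lemma ramp_integral_inner:
  assumes eps: "0 < \<epsilon>" "2 * \<epsilon> < 1"
  shows "(\<integral>v. ramp \<epsilon> v *\<^sub>R m v \<partial>lebesgue) \<bullet> e = (\<integral>v. ramp_deriv \<epsilon> e v * H v \<partial>lborel)"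
proof -
  have "(\<integral>v. ramp \<epsilon> v *\<^sub>R m v \<partial>lebesgue) \<bullet> e = (\<integral>v. (ramp \<epsilon> v *\<^sub>R m v) \<bullet> e \<partial>lebesgue)"
    by (rule integral_inner_left[symmetric]) (rule integrable_ramp[OF eps(1)])
  also have "\<dots> = (\<integral>v. ramp_deriv \<epsilon> e v * H v \<partial>lborel)"
    using ramp_integral[OF eps, of e] by (simp add: has_bochner_integral_iff)
  finally show ?thesis .
qed

lemma integrable_ramp_deriv:
  assumes eps: "0 < \<epsilon>" "2 * \<epsilon> < 1"
  shows "integrable lborel (\<lambda>v. ramp_deriv \<epsilon> e v * H v)"
proof (rule Bochner_Integration.integrable_bound)
  show "integrable lborel (\<lambda>v. 1 / \<epsilon> * norm e * (indicator (shell \<epsilon>) v * H v))"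
    by (intro integrable_mult_right integrable_H_indicator shell_measurable)
  show "(\<lambda>v. ramp_deriv \<epsilon> e v * H v) \<in> borel_measurable lborel"
    by (simp add: ramp_deriv_def[abs_def])
  show "AE v in lborel. norm (ramp_deriv \<epsilon> e v * H v) \<le> norm (1 / \<epsilon> * norm e * (indicator (shell \<epsilon>) v * H v))"
  proof (rule AE_I2)
    fix v :: 'a
    have "\<bar>e \<bullet> sgn v\<bar> \<le> norm e * norm (sgn v)" by (rule Cauchy_Schwarz_ineq2)
    also have "\<dots> \<le> norm e * 1" by (intro mult_left_mono) (auto simp: norm_sgn)
    finally have "1 / \<epsilon> * \<bar>e \<bullet> sgn v\<bar> \<le> 1 / \<epsilon> * norm e"
      using eps by (intro mult_left_mono) auto
    then have "1 / \<epsilon> * \<bar>e \<bullet> sgn v\<bar> * (indicator (shell \<epsilon>) v * \<bar>H v\<bar>) \<le>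
        1 / \<epsilon> * norm e * (indicator (shell \<epsilon>) v * \<bar>H v\<bar>)"
      by (rule mult_right_mono) simp
    then show "norm (ramp_deriv \<epsilon> e v * H v) \<le> norm (1 / \<epsilon> * norm e * (indicator (shell \<epsilon>) v * H v))"
      using eps by (simp add: ramp_deriv_def abs_mult mult.assoc)
  qed
qed

text \<open>The slope \<open>1 / \<epsilon>\<close> of the cut-off cancels the width of the shell,
  so the bound is uniform in \<open>\<epsilon>\<close>.\<close>

lemma shell_integral_le:
  assumes eps: "0 < \<epsilon>" "2 * \<epsilon> < 1"
  shows "1 / \<epsilon> * (\<integral>v. indicator (shell \<epsilon>) v * H v \<partial>lborel) \<le> DIM('a) * measure lborel (ball (0::'a) 1) * G 0"
proof -
  have "(\<integral>v. indicator (shell \<epsilon>) v * H v \<partial>lborel) \<le> measure lborel (shell \<epsilon> :: 'a set) * G 0"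
    by (rule integral_symmetric_le) (use eps in \<open>auto simp: shell_def\<close>)
  also have "\<dots> \<le> (DIM('a) * \<epsilon> * measure lborel (ball (0::'a) 1)) * G 0"
    by (intro mult_right_mono measure_shell_le eps nonneg) simp
  finally show ?thesis using eps by (simp add: field_simps)
qed

end

text \<open>The difference is tested against the unit vector \<open>e\<close> pointing along it.
  Integration by parts leaves an integral of the nonnegative function \<open>G2 - G1\<close> over
  the shell with weight \<open>- (e \<bullet> sgn v) / \<epsilon>\<close>, which is at most
  \<open>1 / \<epsilon>\<close>.\<close>

lemma ramp_difference_le:
  fixes G1 G2 :: "'a::euclidean_space \<Rightarrow> real"
  assumes 1: "ball_supergradient G1 m1 C" and 2: "ball_supergradient G2 m2 C"
    and le: "\<And>v. norm v < 1 \<Longrightarrow> G1 v \<le> G2 v" and eps: "0 < \<epsilon>" "2 * \<epsilon> < 1"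
  shows "norm ((\<integral>v. ramp \<epsilon> v *\<^sub>R m2 v \<partial>lebesgue) - (\<integral>v. ramp \<epsilon> v *\<^sub>R m1 v \<partial>lebesgue)) \<le>
    1 / \<epsilon> * (\<integral>v. indicator (shell \<epsilon>) v * ball_supergradient.H G2 v \<partial>lborel) -
    1 / \<epsilon> * (\<integral>v. indicator (shell \<epsilon>) v * ball_supergradient.H G1 v \<partial>lborel)"
proof -
  interpret g1: ball_supergradient G1 m1 C by fact
  interpret g2: ball_supergradient G2 m2 C by fact
  define x where "x = (\<integral>v. ramp \<epsilon> v *\<^sub>R m2 v \<partial>lebesgue) - (\<integral>v. ramp \<epsilon> v *\<^sub>R m1 v \<partial>lebesgue)"
  define e where "e = sgn x"
  have "norm x = x \<bullet> e"
    by (cases "x = 0") (simp_all add: e_def sgn_div_norm power2_norm_eq_inner[symmetric] power2_eq_square)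
  also have "\<dots> = (\<integral>v. ramp_deriv \<epsilon> e v * g2.H v \<partial>lborel) - (\<integral>v. ramp_deriv \<epsilon> e v * g1.H v \<partial>lborel)"
    by (simp add: x_def inner_diff_left g1.ramp_integral_inner[OF eps] g2.ramp_integral_inner[OF eps])
  also have "\<dots> = (\<integral>v. ramp_deriv \<epsilon> e v * g2.H v - ramp_deriv \<epsilon> e v * g1.H v \<partial>lborel)"
    using g1.integrable_ramp_deriv[OF eps] g2.integrable_ramp_deriv[OF eps] by simp
  also have "\<dots> \<le> (\<integral>v. 1 / \<epsilon> * (indicator (shell \<epsilon>) v * g2.H v) - 1 / \<epsilon> * (indicator (shell \<epsilon>) v * g1.H v) \<partial>lborel)"
  proof (rule integral_mono)
    show "integrable lborel (\<lambda>v. ramp_deriv \<epsilon> e v * g2.H v - ramp_deriv \<epsilon> e v * g1.H v)"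
      using g1.integrable_ramp_deriv[OF eps] g2.integrable_ramp_deriv[OF eps] by simp
    show "integrable lborel (\<lambda>v. 1 / \<epsilon> * (indicator (shell \<epsilon>) v * g2.H v) - 1 / \<epsilon> * (indicator (shell \<epsilon>) v * g1.H v))"
      by (intro Bochner_Integration.integrable_diff integrable_mult_right
          g1.integrable_H_indicator g2.integrable_H_indicator shell_measurable)
    fix v :: 'a
    have "\<bar>e \<bullet> sgn v\<bar> \<le> norm e * norm (sgn v)" by (rule Cauchy_Schwarz_ineq2)
    also have "\<dots> \<le> 1" by (auto simp: norm_sgn e_def)
    finally have "- (e \<bullet> sgn v) \<le> 1" by simp
    then have "1 / \<epsilon> * (- (e \<bullet> sgn v)) \<le> 1 / \<epsilon> * 1"
      using eps by (intro mult_left_mono) auto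
    moreover have "0 \<le> indicator (shell \<epsilon>) v * (g2.H v - g1.H v)"
      using le[of v] by (auto simp: g1.H_def g2.H_def indicator_def)
    ultimately have "1 / \<epsilon> * (- (e \<bullet> sgn v)) * (indicator (shell \<epsilon>) v * (g2.H v - g1.H v)) \<le>
        1 / \<epsilon> * 1 * (indicator (shell \<epsilon>) v * (g2.H v - g1.H v))"
      by (rule mult_right_mono)
    then show "ramp_deriv \<epsilon> e v * g2.H v - ramp_deriv \<epsilon> e v * g1.H v \<le>
        1 / \<epsilon> * (indicator (shell \<epsilon>) v * g2.H v) - 1 / \<epsilon> * (indicator (shell \<epsilon>) v * g1.H v)"
      by (simp add: ramp_deriv_def algebra_simps)
  qed
  also have "\<dots> = 1 / \<epsilon> * (\<integral>v. indicator (shell \<epsilon>) v * g2.H v \<partial>lborel) -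
      1 / \<epsilon> * (\<integral>v. indicator (shell \<epsilon>) v * g1.H v \<partial>lborel)"
    using g1.integrable_H_indicator[OF shell_measurable] g2.integrable_H_indicator[OF shell_measurable]
    by simp
  finally show ?thesis unfolding x_def .
qed

text \<open>Summed along an increasing chain, the shell averages telescope, and concavity bounds the last
  one by the value at the centre.\<close>

lemma ball_integral_variation_le:
  fixes G :: "nat \<Rightarrow> 'a::euclidean_space \<Rightarrow> real"
  assumes sg: "\<And>i. i \<le> n \<Longrightarrow> ball_supergradient (G i) (m i) C"
    and mono: "\<And>i v. i < n \<Longrightarrow> norm v < 1 \<Longrightarrow> G i v \<le> G (Suc i) v"
  shows "(\<Sum>i<n. norm (ball_integral (m (Suc i)) - ball_integral (m i))) \<le>
    DIM('a) * measure lborel (ball (0::'a) 1) * G n 0"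
\<comment> \<open>The telescoping takes place at a fixed cut-off. Since its bound is independent of
  the cut-off, it passes to the limit in the finite sum.\<close>
proof (rule LIMSEQ_le_const2)
  define R where "R k i = (\<integral>v. ramp (1 / (real k + 3)) v *\<^sub>R m i v \<partial>lebesgue)" for k i
  have "(\<lambda>k. R k i) \<longlonglongrightarrow> ball_integral (m i)" if "i \<le> n" for i
    unfolding R_def ball_integral_def
    by (rule ball_supergradient.ramp_integral_tendsto[OF sg[OF that]])
  then show "(\<lambda>k. \<Sum>i<n. norm (R k (Suc i) - R k i)) \<longlonglongrightarrow>
      (\<Sum>i<n. norm (ball_integral (m (Suc i)) - ball_integral (m i)))"
    by (intro tendsto_sum tendsto_norm tendsto_diff) auto
  show "\<exists>N. \<forall>k\<ge>N. (\<Sum>i<n. norm (R k (Suc i) - R k i)) \<le> DIM('a) * measure lborel (ball (0::'a) 1) * G n 0"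
  proof (intro exI[of _ 0] allI impI)
    fix k :: nat
    define \<epsilon> where "\<epsilon> = 1 / (real k + 3)"
    have eps: "0 < \<epsilon>" "2 * \<epsilon> < 1" by (auto simp: \<epsilon>_def field_simps)
    define J where "J i = 1 / \<epsilon> * (\<integral>v. indicator (shell \<epsilon>) v * ball_supergradient.H (G i) v \<partial>lborel)" for i
    have "(\<Sum>i<n. norm (R k (Suc i) - R k i)) \<le> (\<Sum>i<n. J (Suc i) - J i)"
      unfolding R_def J_def \<epsilon>_def[symmetric]
      by (intro sum_mono ramp_difference_le[where C = C, OF _ _ _ eps] sg mono) auto
    also have "\<dots> = J n - J 0" by (rule sum_lessThan_telescope)
    also have "\<dots> \<le> J n"
    proof -
      interpret g0: ball_supergradient "G 0" "m 0" C by (rule sg) simp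
      have "0 \<le> J 0" unfolding J_def using eps
        by (intro mult_nonneg_nonneg Bochner_Integration.integral_nonneg) (auto simp: g0.H_nonneg)
      then show ?thesis by simp
    qed
    also have "\<dots> \<le> DIM('a) * measure lborel (ball (0::'a) 1) * G n 0"
    proof -
      interpret gn: ball_supergradient "G n" "m n" C by (rule sg) simp
      show ?thesis unfolding J_def by (rule gn.shell_integral_le[OF eps])
    qed
    finally show "(\<Sum>i<n. norm (R k (Suc i) - R k i)) \<le> DIM('a) * measure lborel (ball (0::'a) 1) * G n 0" .
  qed
qed

section \<open>Work functions and their conjugates\<close>

text \<open>Admissible paths are arbitrary functions, so the service cost may be the lower integral of a
  non-measurable function; the next two lemmas therefore assume no measurability of the integrands.\<close>

lemma nn_integral_superadd:
  "(\<integral>\<^sup>+x. f x \<partial>M) + (\<integral>\<^sup>+x. g x \<partial>M) \<le> (\<integral>\<^sup>+x. f x + g x \<partial>M)"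
proof -
  let ?F = "{u. simple_function M u \<and> u \<le> f}" and ?G = "{u. simple_function M u \<and> u \<le> g}"
  have ne: "?F \<noteq> {}" "?G \<noteq> {}"
    by (auto intro!: exI[of _ "\<lambda>_. 0"] simp: le_fun_def)
  have le: "integral\<^sup>S M u + integral\<^sup>S M v \<le> (\<integral>\<^sup>+x. f x + g x \<partial>M)" if "u \<in> ?F" "v \<in> ?G" for u v
  proof -
    have "integral\<^sup>S M u + integral\<^sup>S M v = (\<integral>\<^sup>+x. u x + v x \<partial>M)"
      using that by (simp add: nn_integral_eq_simple_integral[symmetric] nn_integral_add borel_measurable_simple_function)
    also have "\<dots> \<le> (\<integral>\<^sup>+x. f x + g x \<partial>M)"
      using that by (intro nn_integral_mono add_mono) (auto simp: le_fun_def)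
    finally show ?thesis .
  qed
  show ?thesis
    unfolding nn_integral_def[of M f] nn_integral_def[of M g]
      ennreal_SUP_add_left[OF ne(1), symmetric]
  proof (rule SUP_least)
    fix u assume u: "u \<in> ?F"
    show "integral\<^sup>S M u + Sup (integral\<^sup>S M ` ?G) \<le> (\<integral>\<^sup>+x. f x + g x \<partial>M)"
      using ennreal_SUP_add_right[OF ne(2), of "integral\<^sup>S M u" "integral\<^sup>S M"] le[OF u]
      by (metis (no_types, lifting) SUP_least)
  qed
qed

lemma nn_integral_Un_disjoint:
  assumes [measurable]: "A \<in> sets M" "B \<in> sets M" and disj: "A \<inter> B = {}"
  shows "(\<integral>\<^sup>+x\<in>A \<union> B. F x \<partial>M) = (\<integral>\<^sup>+x\<in>A. F x \<partial>M) + (\<integral>\<^sup>+x\<in>B. F x \<partial>M)"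
proof (rule antisym)
  show "(\<integral>\<^sup>+x\<in>A \<union> B. F x \<partial>M) \<le> (\<integral>\<^sup>+x\<in>A. F x \<partial>M) + (\<integral>\<^sup>+x\<in>B. F x \<partial>M)"
    unfolding nn_integral_def[of M "\<lambda>x. F x * indicator (A \<union> B) x"]
  proof (rule SUP_least, clarify)
    fix g assume g: "simple_function M g" "g \<le> (\<lambda>x. F x * indicator (A \<union> B) x)"
    have le: "g x \<le> F x * indicator (A \<union> B) x" for x using g(2) by (auto simp: le_fun_def)
    have [measurable]: "g \<in> borel_measurable M" using g(1) by (rule borel_measurable_simple_function)
    have "integral\<^sup>S M g = (\<integral>\<^sup>+x. g x \<partial>M)" by (rule nn_integral_eq_simple_integral[OF g(1), symmetric])
    \<comment> \<open>The simple function \<open>g\<close> vanishes off \<open>A \<union> B\<close>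
      and is measurable, so additivity of the integral is available for it although it is not for
      \<open>F\<close>.\<close>
    also have "\<dots> = (\<integral>\<^sup>+x. g x * indicator A x + g x * indicator B x \<partial>M)"
    proof (rule nn_integral_cong)
      fix x show "g x = g x * indicator A x + g x * indicator B x"
        using le[of x] disj by (auto simp: indicator_def split: if_splits)
    qed
    also have "\<dots> = (\<integral>\<^sup>+x. g x * indicator A x \<partial>M) + (\<integral>\<^sup>+x. g x * indicator B x \<partial>M)"
      by (rule nn_integral_add) measurable
    also have "\<dots> \<le> (\<integral>\<^sup>+x\<in>A. F x \<partial>M) + (\<integral>\<^sup>+x\<in>B. F x \<partial>M)"
    proof (intro add_mono nn_integral_mono)
      fix x show "g x * indicator A x \<le> F x * indicator A x" "g x * indicator B x \<le> F x * indicator B x"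
        using le[of x] by (auto simp: indicator_def split: if_splits)
    qed
    finally show "integral\<^sup>S M g \<le> (\<integral>\<^sup>+x\<in>A. F x \<partial>M) + (\<integral>\<^sup>+x\<in>B. F x \<partial>M)" .
  qed
  have "(\<integral>\<^sup>+x\<in>A. F x \<partial>M) + (\<integral>\<^sup>+x\<in>B. F x \<partial>M) \<le> (\<integral>\<^sup>+x. F x * indicator A x + F x * indicator B x \<partial>M)"
    by (rule nn_integral_superadd)
  also have "\<dots> = (\<integral>\<^sup>+x\<in>A \<union> B. F x \<partial>M)"
    using disj by (intro nn_integral_cong) (auto simp: indicator_def)
  finally show "(\<integral>\<^sup>+x\<in>A. F x \<partial>M) + (\<integral>\<^sup>+x\<in>B. F x \<partial>M) \<le> (\<integral>\<^sup>+x\<in>A \<union> B. F x \<partial>M)" .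
qed

section \<open>Cutting, prolonging and altering paths\<close>

lemma service_cost_split:
  assumes "0 \<le> s" "s \<le> t"
  shows "service_cost f t p = service_cost f s p + (\<integral>\<^sup>+u\<in>{s<..t}. ennreal (f u (p u)) \<partial>lborel)"
proof -
  have "{0..t} = {0..s} \<union> {s<..t}" using assms by auto
  then show ?thesis
    unfolding service_cost_def by (simp only:) (rule nn_integral_Un_disjoint; auto)
qed

lemma movement_cost_ge:
  assumes "mono_on {..n} \<tau>" "\<tau> ` {..n} \<subseteq> {0..t}"
  shows "(\<Sum>i<n. ennreal (norm (x (\<tau> (Suc i)) - x (\<tau> i)))) \<le> movement_cost t x"
  unfolding movement_cost_def using assms by (intro SUP_upper2[of "(n, \<tau>)"]) auto

lemma movement_cost_leI:
  assumes "\<And>n \<tau>. mono_on {..n} \<tau> \<Longrightarrow> \<tau> ` {..n} \<subseteq> {0..t} \<Longrightarrow>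
    (\<Sum>i<n. ennreal (norm (x (\<tau> (Suc i)) - x (\<tau> i)))) \<le> B"
  shows "movement_cost t x \<le> B"
  unfolding movement_cost_def using assms by (intro SUP_least) auto

text \<open>A partition of \<open>[0, a]\<close> can be prolonged by the points \<open>a\<close> and
  \<open>b\<close>. The extra increment from its last point to \<open>a\<close> is nonnegative and
  is dropped.\<close>

lemma movement_cost_add_step:
  assumes ab: "0 \<le> a" "a \<le> b"
  shows "movement_cost a p + ennreal (norm (p b - p a)) \<le> movement_cost b p"
proof -
  let ?P = "{(n::nat, \<tau>::nat \<Rightarrow> real). mono_on {..n} \<tau> \<and> \<tau> ` {..n} \<subseteq> {0..a}}"
  have "(0, \<lambda>_. 0) \<in> ?P" using ab by (auto simp: mono_on_def)
  then have ne: "?P \<noteq> {}" by blast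
  show ?thesis
    unfolding movement_cost_def[of a] ennreal_SUP_add_left[OF ne, symmetric]
  proof (intro SUP_least, clarify)
    fix n :: nat and \<tau> :: "nat \<Rightarrow> real" assume \<tau>: "mono_on {..n} \<tau>" "\<tau> ` {..n} \<subseteq> {0..a}"
    define \<sigma> where "\<sigma> i = (if i \<le> n then \<tau> i else if i = Suc n then a else b)" for i
    have in_a: "0 \<le> \<tau> i" "\<tau> i \<le> a" if "i \<le> n" for i using \<tau>(2) that by auto
    have mono: "\<tau> i \<le> \<tau> j" if "i \<le> j" "j \<le> n" for i j using \<tau>(1) that by (auto simp: mono_on_def)
    have "(\<Sum>i<Suc (Suc n). ennreal (norm (p (\<sigma> (Suc i)) - p (\<sigma> i)))) \<le> movement_cost b p"
    proof (rule movement_cost_ge)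
      show "mono_on {..Suc (Suc n)} \<sigma>"
        using mono in_a ab order_trans[OF in_a(2) ab(2)] by (intro mono_onI) (auto simp: \<sigma>_def)
      show "\<sigma> ` {..Suc (Suc n)} \<subseteq> {0..b}"
        using in_a ab order_trans[OF in_a(2) ab(2)] by (auto simp: \<sigma>_def)
    qed
    moreover have "(\<Sum>i<n. ennreal (norm (p (\<sigma> (Suc i)) - p (\<sigma> i)))) =
        (\<Sum>i<n. ennreal (norm (p (\<tau> (Suc i)) - p (\<tau> i))))"
      by (intro sum.cong) (auto simp: \<sigma>_def)
    ultimately have "(\<Sum>i<n. ennreal (norm (p (\<tau> (Suc i)) - p (\<tau> i)))) + ennreal (norm (p a - p (\<tau> n))) +
        ennreal (norm (p b - p a)) \<le> movement_cost b p"
      by (simp add: \<sigma>_def)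
    then show "(\<Sum>i<n. ennreal (norm (p (\<tau> (Suc i)) - p (\<tau> i)))) + ennreal (norm (p b - p a)) \<le> movement_cost b p"
      by (rule order_trans[rotated]) (simp add: add_increasing2 add_right_mono)
  qed
qed

lemma movement_cost_0 [simp]: "movement_cost 0 p = 0"
proof -
  have "movement_cost 0 p \<le> 0"
  proof (rule movement_cost_leI)
    fix n :: nat and \<tau> :: "nat \<Rightarrow> real" assume "\<tau> ` {..n} \<subseteq> {0..0}"
    then have "\<tau> i = 0" if "i \<le> n" for i using that by auto
    then show "(\<Sum>i<n. ennreal (norm (p (\<tau> (Suc i)) - p (\<tau> i)))) \<le> 0" by simp
  qed
  then show ?thesis by simp
qed

lemma movement_cost_stay:
  assumes "0 \<le> s"
  shows "movement_cost t (\<lambda>u. p (min u s)) \<le> movement_cost s p"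
proof (rule movement_cost_leI)
  fix n :: nat and \<tau> :: "nat \<Rightarrow> real" assume \<tau>: "mono_on {..n} \<tau>" "\<tau> ` {..n} \<subseteq> {0..t}"
  show "(\<Sum>i<n. ennreal (norm (p (min (\<tau> (Suc i)) s) - p (min (\<tau> i) s)))) \<le> movement_cost s p"
    by (rule movement_cost_ge[of n "\<lambda>i. min (\<tau> i) s"])
       (use \<tau> assms in \<open>auto simp: mono_on_def min_def intro: order_trans\<close>)
qed

text \<open>Sample times are increasing and bounded by \<open>t\<close>, so once they reach
  \<open>t\<close> they remain there. Hence at most one increment is affected;
  \<open>\<kappa>\<close> marks the samples equal to \<open>t\<close>, and its increments telescope
  to at most 1.\<close>

lemma movement_cost_upd:
  "movement_cost t (p(t := y)) \<le> movement_cost t p + ennreal (norm (p t - y))"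
proof (rule movement_cost_leI)
  fix n :: nat and \<tau> :: "nat \<Rightarrow> real" assume \<tau>: "mono_on {..n} \<tau>" "\<tau> ` {..n} \<subseteq> {0..t}"
  let ?q = "p(t := y)"
  define \<kappa> :: "nat \<Rightarrow> real" where "\<kappa> i = (if \<tau> i = t then 1 else 0)" for i
  have chi: "\<kappa> i \<le> \<kappa> (Suc i)" if "i < n" for i
  proof -
    have "\<tau> (Suc i) \<in> {0..t}" by (rule subsetD[OF \<tau>(2)]) (use that in auto)
    then have "\<tau> i \<le> \<tau> (Suc i)" "\<tau> (Suc i) \<le> t" using \<tau>(1) that by (auto simp: mono_on_def)
    then show ?thesis by (auto simp: \<kappa>_def)
  qed
  have step: "norm (?q (\<tau> (Suc i)) - ?q (\<tau> i)) \<le> norm (p (\<tau> (Suc i)) - p (\<tau> i)) + norm (p t - y) * (\<kappa> (Suc i) - \<kappa> i)"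
    if "i < n" for i
  proof -
    have "\<tau> (Suc i) \<in> {0..t}" by (rule subsetD[OF \<tau>(2)]) (use that in auto)
    then have "\<tau> i \<le> \<tau> (Suc i)" "\<tau> (Suc i) \<le> t" using \<tau>(1) that by (auto simp: mono_on_def)
    moreover have "norm (y - p (\<tau> i)) \<le> norm (p t - p (\<tau> i)) + norm (p t - y)"
      using norm_triangle_ineq4[of "p t - p (\<tau> i)" "p t - y"] by simp
    ultimately show ?thesis by (auto simp: \<kappa>_def)
  qed
  have "(\<Sum>i<n. norm (?q (\<tau> (Suc i)) - ?q (\<tau> i))) \<le>
      (\<Sum>i<n. norm (p (\<tau> (Suc i)) - p (\<tau> i)) + norm (p t - y) * (\<kappa> (Suc i) - \<kappa> i))"
    by (intro sum_mono step) simp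
  also have "\<dots> = (\<Sum>i<n. norm (p (\<tau> (Suc i)) - p (\<tau> i))) + norm (p t - y) * (\<kappa> n - \<kappa> 0)"
    by (simp only: sum.distrib sum_distrib_left[symmetric] sum_lessThan_telescope)
  also have "\<dots> \<le> (\<Sum>i<n. norm (p (\<tau> (Suc i)) - p (\<tau> i))) + norm (p t - y) * 1"
    by (intro add_left_mono mult_left_mono) (auto simp: \<kappa>_def)
  finally have le: "(\<Sum>i<n. norm (?q (\<tau> (Suc i)) - ?q (\<tau> i))) \<le>
      (\<Sum>i<n. norm (p (\<tau> (Suc i)) - p (\<tau> i))) + norm (p t - y)" by simp
  have "(\<Sum>i<n. ennreal (norm (?q (\<tau> (Suc i)) - ?q (\<tau> i)))) = ennreal (\<Sum>i<n. norm (?q (\<tau> (Suc i)) - ?q (\<tau> i)))"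
    by (rule sum_ennreal) simp
  also have "\<dots> \<le> ennreal ((\<Sum>i<n. norm (p (\<tau> (Suc i)) - p (\<tau> i))) + norm (p t - y))"
    using le by (rule ennreal_leI)
  also have "\<dots> = (\<Sum>i<n. ennreal (norm (p (\<tau> (Suc i)) - p (\<tau> i)))) + ennreal (norm (p t - y))"
    by (simp add: ennreal_plus sum_nonneg sum_ennreal)
  also have "\<dots> \<le> movement_cost t p + ennreal (norm (p t - y))"
    by (intro add_right_mono movement_cost_ge \<tau>)
  finally show "(\<Sum>i<n. ennreal (norm (?q (\<tau> (Suc i)) - ?q (\<tau> i)))) \<le> movement_cost t p + ennreal (norm (p t - y))" .
qed

lemma total_cost_ge_norm: "0 \<le> t \<Longrightarrow> p 0 = 0 \<Longrightarrow> ennreal (norm (p t)) \<le> total_cost f t p"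
  using movement_cost_add_step[of 0 t p] by (simp add: total_cost_def add_increasing)

lemma work_function_le: "p 0 = 0 \<Longrightarrow> p t = x \<Longrightarrow> work_function f t x \<le> total_cost f t p"
  unfolding work_function_def by (intro INF_lower) auto

lemma work_function_geI:
  "(\<And>p. p 0 = 0 \<Longrightarrow> p t = x \<Longrightarrow> B \<le> total_cost f t p) \<Longrightarrow> B \<le> work_function f t x"
  unfolding work_function_def by (intro INF_greatest) auto

lemma work_function_ge_norm: "0 \<le> t \<Longrightarrow> ennreal (norm x) \<le> work_function f t x"
  by (rule work_function_geI) (metis total_cost_ge_norm)

lemma service_cost_0 [simp]: "service_cost f 0 p = 0"
proof -
  have "service_cost f 0 p = (\<integral>\<^sup>+t. 0 \<partial>(lborel :: real measure))"
    unfolding service_cost_def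
    by (rule nn_integral_cong_AE, rule AE_mp[OF AE_lborel_singleton[of 0]]) (auto simp: indicator_def)
  then show ?thesis by simp
qed

lemma work_function_0: "work_function f 0 x = (if x = 0 then 0 else \<infinity>)"
proof (cases "x = 0")
  case True
  then have "work_function f 0 x \<le> total_cost f 0 (\<lambda>_. 0)" by (intro work_function_le) auto
  then show ?thesis using True by (simp add: total_cost_def)
next
  case False
  then have "{p. p (0::real) = 0 \<and> p 0 = x} = {}" by auto
  then have "work_function f 0 x = \<infinity>" unfolding work_function_def by (simp only: image_empty Inf_empty infinity_ennreal_def)
  then show ?thesis using False by simp
qed

text \<open>The end point of a path is altered at the single instant \<open>t\<close>: this is a
  null set for the service cost and adds one jump of length \<open>norm (x - y)\<close>. As
  \<open>0 < t\<close>, the starting point is untouched.\<close>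

lemma work_function_lipschitz:
  assumes t: "0 < t"
  shows "work_function f t y \<le> work_function f t x + ennreal (norm (x - y))"
proof -
  have *: "work_function f t y \<le> total_cost f t p + ennreal (norm (x - y))" if p: "p 0 = 0" "p t = x" for p
  proof -
    have "service_cost f t (p(t := y)) = service_cost f t p"
      unfolding service_cost_def
      by (rule nn_integral_cong_AE, rule AE_mp[OF AE_lborel_singleton[of t]]) auto
    then have "total_cost f t (p(t := y)) \<le> total_cost f t p + ennreal (norm (x - y))"
      using movement_cost_upd[of t p y] p by (simp add: total_cost_def add.assoc add_left_mono)
    moreover have "work_function f t y \<le> total_cost f t (p(t := y))"
      by (rule work_function_le) (use p t in auto)
    ultimately show ?thesis by (rule order_trans[rotated])
  qed
  then have "(work_function f t y) - ennreal (norm (x - y)) \<le> work_function f t x"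
    by (intro work_function_geI) (simp add: ennreal_minus_le_iff add.commute)
  then show ?thesis by (simp add: ennreal_minus_le_iff add.commute)
qed

section \<open>Bounds for piecewise continuous and for convex functions\<close>

lemma piecewise_continuous_on_bounded:
  assumes "piecewise_continuous_on a b g"
  shows "\<exists>B. \<forall>t\<in>{a..b}. \<bar>g t\<bar> \<le> B"
proof -
  have "\<exists>d B. d > 0 \<and> (\<forall>s\<in>{a..b}. dist s t < d \<longrightarrow> \<bar>g s\<bar> \<le> B)" if t: "t \<in> {a..b}" for t
  proof -
    obtain l r where l: "(g \<longlongrightarrow> l) (at t within {a..<t})" and r: "(g \<longlongrightarrow> r) (at t within {t<..b})"
      using assms t unfolding piecewise_continuous_on_def by blast
    have "eventually (\<lambda>s. \<bar>g s\<bar> < \<bar>l\<bar> + 1) (at t within {a..<t})"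
      by (rule order_tendstoD(2)[OF tendsto_rabs[OF l]]) simp
    then obtain d1 where d1: "d1 > 0" "\<And>s. s \<in> {a..<t} \<Longrightarrow> dist s t < d1 \<Longrightarrow> \<bar>g s\<bar> < \<bar>l\<bar> + 1"
      by (auto simp: eventually_at)
    have "eventually (\<lambda>s. \<bar>g s\<bar> < \<bar>r\<bar> + 1) (at t within {t<..b})"
      by (rule order_tendstoD(2)[OF tendsto_rabs[OF r]]) simp
    then obtain d2 where d2: "d2 > 0" "\<And>s. s \<in> {t<..b} \<Longrightarrow> dist s t < d2 \<Longrightarrow> \<bar>g s\<bar> < \<bar>r\<bar> + 1"
      by (auto simp: eventually_at)
    \<comment> \<open>The value at \<open>t\<close> itself enters the maximum because the one-sided
      limits say nothing about it.\<close>
    have "\<bar>g s\<bar> \<le> max (\<bar>g t\<bar>) (max (\<bar>l\<bar> + 1) (\<bar>r\<bar> + 1))" if "s \<in> {a..b}" "dist s t < min d1 d2" for s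
      using d1(2)[of s] d2(2)[of s] that
      by (cases s t rule: linorder_cases) (simp_all add: le_max_iff_disj less_imp_le)
    then show ?thesis
      using d1(1) d2(1) by (intro exI[of _ "min d1 d2"] exI[of _ "max (\<bar>g t\<bar>) (max (\<bar>l\<bar> + 1) (\<bar>r\<bar> + 1))"]) auto
  qed
  then obtain d B where dB: "\<And>t. t \<in> {a..b} \<Longrightarrow> d t > 0"
      "\<And>t s. t \<in> {a..b} \<Longrightarrow> s \<in> {a..b} \<Longrightarrow> dist s t < d t \<Longrightarrow> \<bar>g s\<bar> \<le> B t"
    by metis
  have cover: "{a..b} \<subseteq> (\<Union>t\<in>{a..b}. ball t (d t))"
  proof
    fix t assume "t \<in> {a..b}"
    then show "t \<in> (\<Union>t\<in>{a..b}. ball t (d t))" using dB(1)[of t] by (intro UN_I[of t]) auto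
  qed
  obtain K where K: "K \<subseteq> {a..b}" "finite K" "{a..b} \<subseteq> (\<Union>t\<in>K. ball t (d t))"
    by (rule compactE_image[OF compact_Icc _ cover]) auto
  have "\<bar>g s\<bar> \<le> (\<Sum>t\<in>K. \<bar>B t\<bar>)" if s: "s \<in> {a..b}" for s
  proof -
    obtain t where t: "t \<in> K" "dist s t < d t" using K(3) s by (auto simp: dist_commute)
    have "\<bar>g s\<bar> \<le> \<bar>B t\<bar>" using dB(2)[of t s] t s K(1) by (meson abs_ge_self order_trans subsetD)
    also have "\<dots> \<le> (\<Sum>t\<in>K. \<bar>B t\<bar>)" using K(2) t(1) by (intro member_le_sum) auto
    finally show ?thesis .
  qed
  then show ?thesis by blast
qed

lemma piecewise_continuous_on_measurable:
  assumes "piecewise_continuous_on a b g"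
  shows "(\<lambda>t. indicator {a..b} t * g t :: real) \<in> borel_measurable borel"
proof -
  obtain S where S: "finite S" "continuous_on ({a..b} - S) g"
    using assms unfolding piecewise_continuous_on_def by blast
  have [measurable]: "{a..b} - S \<in> sets borel"
    using borel_closed[OF finite_imp_closed[OF S(1)]] by (intro sets.Diff) auto
  have "(\<lambda>t. indicator ({a..b} - S) t *\<^sub>R g t) \<in> borel_measurable borel"
    by (rule borel_measurable_continuous_on_indicator) (use S in auto)
  then show ?thesis
    by (rule measurable_discrete_difference[where X = S])
       (use S(1) in \<open>auto simp: indicator_def intro: countable_finite\<close>)
qed

text \<open>The segment from \<open>x\<close> to \<open>y\<close> is prolonged by length 1 to
  \<open>z\<close>. Then \<open>y\<close> is a convex combination of \<open>x\<close> and
  \<open>z\<close> in which \<open>z\<close> has weight \<open>d / (d + 1) \<le> d\<close>.\<close>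

lemma convex_on_lipschitz:
  fixes g :: "'a::real_normed_vector \<Rightarrow> real"
  assumes conv: "convex_on UNIV g" and bound: "\<And>x. norm x \<le> R + 1 \<Longrightarrow> 0 \<le> g x \<and> g x \<le> M"
    and xy: "norm x \<le> R" "norm y \<le> R"
  shows "g y - g x \<le> M * norm (y - x)"
proof (cases "x = y")
  case False
  define d where "d = norm (y - x)"
  have d: "d > 0" using False by (simp add: d_def)
  define z where "z = y + (1 / d) *\<^sub>R (y - x)"
  define u where "u = d / (d + 1)"
  have u: "0 \<le> u" "u \<le> 1" "u \<le> d" using d by (auto simp: u_def field_simps)
  have "norm z \<le> norm y + 1"
    unfolding z_def by (rule norm_triangle_le) (use d in \<open>simp add: d_def\<close>)
  then have z: "norm z \<le> R + 1" using xy by simp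
  have "(1 - u) *\<^sub>R x + u *\<^sub>R z = x + u *\<^sub>R ((1 + 1 / d) *\<^sub>R (y - x))"
    by (simp add: z_def algebra_simps)
  also have "u *\<^sub>R ((1 + 1 / d) *\<^sub>R (y - x)) = y - x"
  proof -
    have "d + 1 \<noteq> 0" "1 + 1 / d = (d + 1) / d" using d by (simp_all add: add_divide_distrib)
    then have "u * (1 + 1 / d) = 1" using d by (simp add: u_def)
    then show ?thesis by simp
  qed
  finally have "y = (1 - u) *\<^sub>R x + u *\<^sub>R z" by simp
  then have "g y \<le> (1 - u) * g x + u * g z"
    using convex_onD[OF conv, of u x z] u by simp
  then have "g y - g x \<le> u * (g z - g x)" by (simp add: algebra_simps)
  also have "\<dots> \<le> u * M" using bound[OF z] bound[of x] xy u by (intro mult_left_mono) auto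
  also have "\<dots> \<le> d * M" using bound[OF z] u by (intro mult_right_mono) auto
  finally show ?thesis by (simp add: d_def mult.commute)
qed simp

section \<open>Minimisers and conjugates of the work function\<close>

lemma work_function_finite:
  assumes "0 < t" "work_function f t 0 < \<infinity>"
  shows "work_function f t x < \<infinity>"
proof (rule le_less_trans[OF work_function_lipschitz[OF assms(1)]])
  show "work_function f t 0 + ennreal (norm (0 - x)) < \<infinity>" using assms(2) by simp
qed

text \<open>The bound \<open>norm w\<close> from below makes the objective grow at least like
  \<open>(1 - norm v) * norm w\<close>, and for \<open>0 < t\<close> it is continuous, so a minimum
  over a large ball is global. At time 0 the only point of finite value is the origin.\<close>

lemma work_function_argmin_exists:
  fixes v :: "'a::euclidean_space"
  assumes t: "0 \<le> t" and fin: "work_function f t 0 < \<infinity>" and v: "norm v < 1"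
  shows "\<exists>w. is_arg_min (\<lambda>w. enn2ereal (work_function f t w) - ereal (v \<bullet> w)) (\<lambda>_. True) w"
proof (cases "t = 0")
  case True
  have "is_arg_min (\<lambda>w. enn2ereal (work_function f t w) - ereal (v \<bullet> w)) (\<lambda>_. True) 0"
    using True by (auto simp: is_arg_min_def work_function_0 zero_ennreal.rep_eq)
  then show ?thesis ..
next
  case False
  then have t: "0 < t" using t by simp
  define h where "h w = enn2real (work_function f t w) - v \<bullet> w" for w
  have W: "work_function f t w = ennreal (enn2real (work_function f t w))" for w
    using work_function_finite[OF t fin, of w] by simp
  have eq: "enn2ereal (work_function f t w) - ereal (v \<bullet> w) = ereal (h w)" for w
    by (subst W) (simp add: h_def enn2ereal_ennreal)
  have lip: "enn2real (work_function f t y) \<le> enn2real (work_function f t x) + norm (x - y)" for x y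
  proof -
    have "ennreal (enn2real (work_function f t y)) \<le> ennreal (enn2real (work_function f t x) + norm (x - y))"
      using work_function_lipschitz[OF t, of f y x] W[of x] W[of y] by (simp add: ennreal_plus)
    then show ?thesis by (subst (asm) ennreal_le_iff) auto
  qed
  have cont: "continuous_on A h" for A
  proof -
    have "continuous_on A (\<lambda>w. enn2real (work_function f t w))"
    proof (rule lipschitz_on_continuous_on[of 1], rule lipschitz_onI)
      show "dist (enn2real (work_function f t x)) (enn2real (work_function f t y)) \<le> 1 * dist x y" for x y
        using lip[of x y] lip[of y x] by (simp add: dist_norm norm_minus_commute abs_le_iff)
    qed simp
    then show ?thesis unfolding h_def by (intro continuous_intros)
  qed
  have coercive: "(1 - norm v) * norm w \<le> h w" for w
  proof -
    have "norm w \<le> enn2real (work_function f t w)"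
      using work_function_ge_norm[of t w f] t W[of w]
      by (metis ennreal_le_iff enn2real_nonneg less_imp_le)
    moreover have "v \<bullet> w \<le> norm v * norm w" by (rule norm_cauchy_schwarz)
    ultimately show ?thesis by (simp add: h_def algebra_simps)
  qed
  \<comment> \<open>Outside this radius the coercive bound already exceeds the value
    \<open>h 0\<close>.\<close>
  define K where "K = h 0 / (1 - norm v)"
  have K: "0 \<le> K" using v by (simp add: K_def h_def)
  obtain w where w: "norm w \<le> K" "\<And>y. norm y \<le> K \<Longrightarrow> h w \<le> h y"
    using continuous_attains_inf[OF compact_cball _ cont, of 0 K] K by auto
  have "h w \<le> h y" for y
  proof (cases "norm y \<le> K")
    case False
    then have "(1 - norm v) * K \<le> (1 - norm v) * norm y" using v by (intro mult_left_mono) auto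
    also have "(1 - norm v) * K = h 0" using v by (simp add: K_def)
    finally show ?thesis using coercive[of y] w(2)[of 0] K by simp
  qed (use w in auto)
  then have "is_arg_min (\<lambda>w. enn2ereal (work_function f t w) - ereal (v \<bullet> w)) (\<lambda>_. True) w"
    unfolding eq by (simp add: is_arg_min_def not_less)
  then show ?thesis ..
qed

definition minimiser :: "(real \<Rightarrow> 'a::euclidean_space \<Rightarrow> real) \<Rightarrow> real \<Rightarrow> 'a \<Rightarrow> 'a" where
  "minimiser f t v = conj_argmin (\<lambda>w. enn2ereal (work_function f t w)) v"

text \<open>The value at the selected minimiser serves in place of an infimum: for
  \<open>norm v < 1\<close> the minimum is attained once the work function is finite at 0, and the
  result is a real number.\<close>

definition conjugate :: "(real \<Rightarrow> 'a::euclidean_space \<Rightarrow> real) \<Rightarrow> real \<Rightarrow> 'a \<Rightarrow> real" where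
  "conjugate f t v = enn2real (work_function f t (minimiser f t v)) - v \<bullet> minimiser f t v"

lemma
  fixes v :: "'a::euclidean_space"
  assumes t: "0 \<le> t" and fin: "work_function f t 0 < \<infinity>" and v: "norm v < 1"
  shows work_function_minimiser_finite: "work_function f t (minimiser f t v) < \<infinity>"
    and conjugate_le: "work_function f t w < \<infinity> \<Longrightarrow> conjugate f t v \<le> enn2real (work_function f t w) - v \<bullet> w"
proof -
  define g where "g w = enn2ereal (work_function f t w) - ereal (v \<bullet> w)" for w
  have "is_arg_min g (\<lambda>_. True) (minimiser f t v)"
    unfolding minimiser_def conj_argmin_def arg_min_def g_def
    using work_function_argmin_exists[OF assms] by (rule someI_ex)
  then have min: "g (minimiser f t v) \<le> g w" for w
    by (auto simp: is_arg_min_def not_less)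
  have eq: "g w = ereal (enn2real (work_function f t w) - v \<bullet> w)" if "work_function f t w < \<infinity>" for w
  proof -
    have "work_function f t w = ennreal (enn2real (work_function f t w))" using that by simp
    then have "enn2ereal (work_function f t w) = ereal (enn2real (work_function f t w))"
      by (metis enn2ereal_ennreal enn2real_nonneg)
    then show ?thesis by (simp add: g_def)
  qed
  show fin': "work_function f t (minimiser f t v) < \<infinity>"
  proof (rule ccontr)
    assume "\<not> ?thesis"
    then have "work_function f t (minimiser f t v) = \<infinity>" by (simp add: less_top[symmetric])
    then have "g (minimiser f t v) = \<infinity>" by (simp add: g_def)
    then show False using min[of 0] eq[OF fin] by simp
  qed
  show "conjugate f t v \<le> enn2real (work_function f t w) - v \<bullet> w" if "work_function f t w < \<infinity>"
    using min[of w] eq[OF that] eq[OF fin'] by (simp add: conjugate_def)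
qed

text \<open>The minimiser for \<open>v\<close> is a competitor for \<open>u\<close>, which is the
  supergradient inequality. Nonnegativity comes from the lower bound \<open>norm w\<close> of the
  work function, and the upper bound from the competitor 0.\<close>

lemma conjugate_supergradient:
  assumes t: "0 \<le> t" and C: "work_function f t 0 \<le> ennreal C" "0 \<le> C"
  shows "ball_supergradient (conjugate f t) (minimiser f t) C"
proof
  have fin: "work_function f t 0 < \<infinity>" using C(1) by (simp add: order_le_less_trans less_top)
  fix v :: 'a assume v: "norm v < 1"
  show "conjugate f t u \<le> conjugate f t v - minimiser f t v \<bullet> (u - v)" if "norm u < 1" for u
    using conjugate_le[OF t fin that work_function_minimiser_finite[OF t fin v]]
    by (simp add: conjugate_def[of f t v] inner_diff_right inner_diff_left inner_commute)
  have "norm (minimiser f t v) \<le> enn2real (work_function f t (minimiser f t v))"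
    using work_function_ge_norm[OF t, of "minimiser f t v" f] work_function_minimiser_finite[OF t fin v]
    by (metis ennreal_enn2real ennreal_le_iff enn2real_nonneg infinity_ennreal_def)
  moreover have "v \<bullet> minimiser f t v \<le> norm v * norm (minimiser f t v)" by (rule norm_cauchy_schwarz)
  moreover have "norm v * norm (minimiser f t v) \<le> 1 * norm (minimiser f t v)"
    using v by (intro mult_right_mono) auto
  ultimately show "0 \<le> conjugate f t v" by (simp add: conjugate_def)
  have "conjugate f t v \<le> enn2real (work_function f t 0)" using conjugate_le[OF t fin v fin] by simp
  also have "\<dots> \<le> C" using enn2real_mono[OF C(1)] C(2) by simp
  finally show "conjugate f t v \<le> C" .
qed

text \<open>A near-optimal path to the minimiser at time \<open>t\<close> is cut at time
  \<open>s\<close>; its initial piece bounds the work function at \<open>p s\<close>. Movement costs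
  1 per unit length, whereas the linear term gains at most \<open>norm v\<close>, so the surplus
  \<open>(1 - norm v) * norm (p t - p r)\<close> remains. It later limits how far the path can stray
  from its end point.\<close>

lemma work_function_split_near_optimal:
  fixes v :: "'a::euclidean_space"
  assumes s: "0 \<le> s" "s \<le> t" and fin: "work_function f s 0 < \<infinity>" "work_function f t 0 < \<infinity>"
    and v: "norm v < 1" and eps: "\<epsilon> > 0"
  obtains p where "p t = minimiser f t v"
    and "(\<integral>\<^sup>+u\<in>{s<..t}. ennreal (f u (p u)) \<partial>lborel) < \<infinity>"
    and "\<And>r. r \<in> {s..t} \<Longrightarrow> conjugate f s v + enn2real (\<integral>\<^sup>+u\<in>{s<..t}. ennreal (f u (p u)) \<partial>lborel) +
      (1 - norm v) * norm (p t - p r) \<le> conjugate f t v + \<epsilon>"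
proof -
  define x where "x = minimiser f t v"
  have t: "0 \<le> t" using s by simp
  have Wx: "work_function f t x < \<infinity>" unfolding x_def by (rule work_function_minimiser_finite[OF t fin(2) v])
  then have "work_function f t x < work_function f t x + ennreal \<epsilon>"
    using eps by (simp add: ennreal_add_left_cancel_less[of _ 0, simplified] less_top)
  then obtain p where p: "p 0 = 0" "p t = x" "total_cost f t p < work_function f t x + ennreal \<epsilon>"
    unfolding work_function_def[of f t x] by (auto simp: INF_less_iff)
  define A where "A = (\<integral>\<^sup>+u\<in>{s<..t}. ennreal (f u (p u)) \<partial>lborel)"
  have serv: "service_cost f t p = service_cost f s p + A"
    unfolding A_def by (rule service_cost_split[OF s])
  have total: "work_function f s (p s) + A + ennreal (norm (p r - p s)) + ennreal (norm (p t - p r)) \<le>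
      ennreal (enn2real (work_function f t x) + \<epsilon>)" if r: "r \<in> {s..t}" for r
  proof -
    have "movement_cost s p + ennreal (norm (p r - p s)) + ennreal (norm (p t - p r)) \<le> movement_cost t p"
      using movement_cost_add_step[of s r p] movement_cost_add_step[of r t p] r s
      by (auto intro: order_trans[OF add_right_mono])
    then have "(service_cost f s p + movement_cost s p) + A + ennreal (norm (p r - p s)) + ennreal (norm (p t - p r)) \<le>
        total_cost f t p"
      unfolding total_cost_def serv by (simp add: ac_simps add_left_mono)
    moreover have "work_function f s (p s) \<le> service_cost f s p + movement_cost s p"
      using work_function_le[of p s "p s" f] p(1) by (simp add: total_cost_def)
    ultimately have "work_function f s (p s) + A + ennreal (norm (p r - p s)) + ennreal (norm (p t - p r)) \<le> total_cost f t p"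
      by (meson add_right_mono order_trans)
    also have "\<dots> \<le> work_function f t x + ennreal \<epsilon>" using p(3) by simp
    also have "\<dots> = ennreal (enn2real (work_function f t x) + \<epsilon>)"
      using Wx eps by (simp add: ennreal_plus)
    finally show ?thesis .
  qed
  have finA: "A < \<infinity>" and finW: "work_function f s (p s) < \<infinity>"
    using total[of s] s by (auto simp: less_top[symmetric] top_unique)
  show ?thesis
  proof (rule that)
    show "p t = minimiser f t v" using p(2) by (simp add: x_def)
    show "(\<integral>\<^sup>+u\<in>{s<..t}. ennreal (f u (p u)) \<partial>lborel) < \<infinity>" using finA by (simp add: A_def)
    fix r assume r: "r \<in> {s..t}"
    have "ennreal (enn2real (work_function f s (p s)) + enn2real A + norm (p r - p s) + norm (p t - p r)) \<le>
        ennreal (enn2real (work_function f t x) + \<epsilon>)"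
      using total[OF r] finA finW by (simp add: ennreal_plus)
    then have le: "enn2real (work_function f s (p s)) + enn2real A + norm (p r - p s) + norm (p t - p r) \<le>
        enn2real (work_function f t x) + \<epsilon>"
      using eps by (subst (asm) ennreal_le_iff) (auto simp: add_nonneg_pos less_imp_le)
    have "conjugate f s v \<le> enn2real (work_function f s (p s)) - v \<bullet> p s"
      by (rule conjugate_le[OF s(1) fin(1) v finW])
    moreover have "conjugate f t v = enn2real (work_function f t x) - v \<bullet> p t"
      by (simp add: conjugate_def x_def[symmetric] p(2))
    \<comment> \<open>The piece over \<open>[s, r]\<close> is charged with factor 1 and cancels
      against its movement cost; only the piece over \<open>[r, t]\<close> keeps
      \<open>norm v\<close> and leaves a surplus.\<close>
    moreover have "v \<bullet> (p t - p s) \<le> norm v * norm (p t - p r) + 1 * norm (p r - p s)"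
    proof -
      have "v \<bullet> (p t - p s) \<le> norm v * norm (p t - p s)" by (rule norm_cauchy_schwarz)
      also have "\<dots> \<le> norm v * (norm (p t - p r) + norm (p r - p s))"
        using norm_triangle_ineq[of "p t - p r" "p r - p s"] by (intro mult_left_mono) auto
      also have "\<dots> = norm v * norm (p t - p r) + norm v * norm (p r - p s)" by (simp add: algebra_simps)
      also have "\<dots> \<le> norm v * norm (p t - p r) + 1 * norm (p r - p s)"
        using v by (intro add_left_mono mult_right_mono) auto
      finally show ?thesis .
    qed
    ultimately show "conjugate f s v + enn2real (\<integral>\<^sup>+u\<in>{s<..t}. ennreal (f u (p u)) \<partial>lborel) +
        (1 - norm v) * norm (p t - p r) \<le> conjugate f t v + \<epsilon>"
      using le by (simp add: A_def[symmetric] inner_diff_right algebra_simps)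
  qed
qed

lemma conjugate_mono:
  fixes v :: "'a::euclidean_space"
  assumes "0 \<le> s" "s \<le> t" "work_function f s 0 < \<infinity>" "work_function f t 0 < \<infinity>" "norm v < 1"
  shows "conjugate f s v \<le> conjugate f t v"
proof (rule field_le_epsilon)
  fix \<epsilon> :: real assume "0 < \<epsilon>"
  show "conjugate f s v \<le> conjugate f t v + \<epsilon>"
  proof (rule work_function_split_near_optimal[OF assms \<open>0 < \<epsilon>\<close>])
    fix p
    assume "\<And>r. r \<in> {s..t} \<Longrightarrow> conjugate f s v + enn2real (\<integral>\<^sup>+u\<in>{s<..t}. ennreal (f u (p u)) \<partial>lborel) +
      (1 - norm v) * norm (p t - p r) \<le> conjugate f t v + \<epsilon>"
    from this[of t] assms(2)
    have "conjugate f s v + enn2real (\<integral>\<^sup>+u\<in>{s<..t}. ennreal (f u (p u)) \<partial>lborel) \<le> conjugate f t v + \<epsilon>" by simp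
    moreover have "0 \<le> enn2real (\<integral>\<^sup>+u\<in>{s<..t}. ennreal (f u (p u)) \<partial>lborel)" by (rule enn2real_nonneg)
    ultimately show ?thesis by linarith
  qed
qed

text \<open>A path ending in \<open>x\<close> at time \<open>s\<close> is continued by resting at
  \<open>x\<close>, which adds no movement.\<close>

lemma work_function_stay_le:
  assumes s: "0 \<le> s" "s \<le> t" and fin: "(\<integral>\<^sup>+u\<in>{s<..t}. ennreal (f u x) \<partial>lborel) < \<infinity>"
  shows "work_function f t x \<le> work_function f s x + (\<integral>\<^sup>+u\<in>{s<..t}. ennreal (f u x) \<partial>lborel)"
proof -
  define A where "A = (\<integral>\<^sup>+u\<in>{s<..t}. ennreal (f u x) \<partial>lborel)"
  have "work_function f t x \<le> total_cost f s p + A" if p: "p 0 = 0" "p s = x" for p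
  proof -
    let ?q = "\<lambda>u. p (min u s)"
    have "work_function f t x \<le> total_cost f t ?q"
      by (rule work_function_le) (use p s in \<open>auto simp: min_def\<close>)
    also have "service_cost f t ?q = service_cost f s p + A"
    proof -
      have "service_cost f s ?q = service_cost f s p"
        unfolding service_cost_def by (intro nn_integral_cong) (auto simp: indicator_def min_def)
      moreover have "(\<integral>\<^sup>+u\<in>{s<..t}. ennreal (f u (?q u)) \<partial>lborel) = A"
        unfolding A_def using p by (intro nn_integral_cong) (auto simp: indicator_def min_def)
      ultimately show ?thesis by (simp add: service_cost_split[OF s])
    qed
    then have "total_cost f t ?q \<le> total_cost f s p + A"
      unfolding total_cost_def using movement_cost_stay[OF s(1), of t p]
      by (simp add: ac_simps add_left_mono)
    finally show ?thesis .
  qed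
  then have "work_function f t x - A \<le> work_function f s x"
    using fin by (intro work_function_geI) (auto simp: ennreal_minus_le_iff A_def add.commute)
  then show ?thesis using fin by (auto simp: ennreal_minus_le_iff A_def add.commute)
qed

section \<open>Movement and service cost of the Steiner path\<close>

text \<open>Separates the point \<open>(s, g s)\<close> from the strict epigraph. The hyperplane
  cannot be vertical because the epigraph has points above every \<open>x\<close>, so normalising
  its last coefficient gives the slope.\<close>

lemma convex_on_subgradient_exists:
  fixes g :: "'a::euclidean_space \<Rightarrow> real"
  assumes "convex_on UNIV g"
  shows "\<exists>y. \<forall>x. g s + y \<bullet> (x - s) \<le> g x"
proof -
  let ?S = "{z :: 'a \<times> real. g (fst z) < snd z}"
  have convex: "convex ?S"
  proof (rule convexI)
    fix z w :: "'a \<times> real" and u v :: real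
    assume zw: "z \<in> ?S" "w \<in> ?S" and uv: "0 \<le> u" "0 \<le> v" "u + v = 1"
    have "g (u *\<^sub>R fst z + v *\<^sub>R fst w) \<le> u * g (fst z) + v * g (fst w)"
      using assms uv by (auto simp: convex_on_def)
    also have "\<dots> < u * snd z + v * snd w"
    proof (cases "u = 0")
      case False
      then show ?thesis using zw uv by (intro add_less_le_mono mult_strict_left_mono mult_left_mono) auto
    qed (use zw uv in auto)
    finally show "u *\<^sub>R z + v *\<^sub>R w \<in> ?S" by simp
  qed
  have "(s, g s + 1) \<in> ?S" by simp
  then have ne: "?S \<noteq> {}" by blast
  have disj: "?S \<inter> {(s, g s)} = {}" by simp
  obtain a b where ab: "a \<noteq> 0" "\<forall>z\<in>?S. a \<bullet> z \<le> b" "\<forall>z\<in>{(s, g s)}. b \<le> a \<bullet> z"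
    using separating_hyperplane_sets[OF convex convex_singleton ne insert_not_empty disj] by blast
  obtain a1 a2 where a: "a = (a1, a2)" by (cases a)
  have sep: "a1 \<bullet> x + a2 * r \<le> a1 \<bullet> s + a2 * g s" if "g x < r" for x r
  proof -
    have "a \<bullet> (x, r) \<le> b" using ab(2) that by simp
    also have "b \<le> a \<bullet> (s, g s)" using ab(3) by simp
    finally show ?thesis by (simp add: a inner_prod_def)
  qed
  have "a2 \<le> 0" using sep[of s "g s + 1"] by (simp add: algebra_simps)
  moreover have "a2 \<noteq> 0"
  proof
    assume "a2 = 0"
    then have "a1 \<bullet> a1 \<le> 0" using sep[of "s + a1" "g (s + a1) + 1"] by (simp add: inner_add_right)
    then have "a1 = 0" using inner_ge_zero[of a1] by (metis inner_eq_zero_iff order_antisym)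
    then show False using ab(1) a \<open>a2 = 0\<close> by (simp add: zero_prod_def)
  qed
  ultimately have a2: "a2 < 0" by simp
  have "g s + ((1 / - a2) *\<^sub>R a1) \<bullet> (x - s) \<le> g x" for x
  proof (rule field_le_epsilon)
    fix e :: real assume "0 < e"
    then have "a1 \<bullet> (x - s) \<le> (- a2) * (g x + e - g s)"
      using sep[of x "g x + e"] by (simp add: inner_diff_right algebra_simps)
    then have "a1 \<bullet> (x - s) / (- a2) \<le> g x + e - g s"
      using a2 by (subst pos_divide_le_eq) (auto simp: mult.commute)
    then show "g s + ((1 / - a2) *\<^sub>R a1) \<bullet> (x - s) \<le> g x + e" by simp
  qed
  then show ?thesis by blast
qed

section \<open>The lower left derivative of a monotone function\<close>

lemma nn_integral_backward_quotient_le: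
  fixes g :: "real \<Rightarrow> real"
  assumes mono: "mono g" and zero: "\<And>t. t < 0 \<Longrightarrow> g t = 0" and T: "0 \<le> T" and h: "0 < h"
  shows "(\<integral>\<^sup>+t\<in>{0..T}. ennreal ((g t - g (t - h)) / h) \<partial>lborel) \<le> ennreal (g T)"
proof -
  have [measurable]: "g \<in> borel_measurable borel" by (rule borel_measurable_mono[OF mono])
  have g_nonneg: "0 \<le> g t" for t
    using zero[of "min t 0 - 1"] monoD[OF mono, of "min t 0 - 1" t] by simp
  have int1: "integrable lborel (\<lambda>t. indicator {0..T} t * g t)"
    by (rule integrable_bounded_support[where B = "g T" and R = "T + 1"])
       (use monoD[OF mono, of _ T] g_nonneg in \<open>auto simp: indicator_def\<close>)
  have int2: "integrable lborel (\<lambda>t. indicator {0..T} t * g (t - h))"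
  proof (rule integrable_bounded_support[where B = "g T" and R = "T + 1"])
    show "\<bar>indicator {0..T} t * g (t - h)\<bar> \<le> g T" for t
      using monoD[OF mono, of "t - h" T] h g_nonneg by (auto simp: indicator_def)
  qed (auto simp: indicator_def)
  have int3: "integrable lborel (\<lambda>t. indicator {- h..T - h} t * g t)"
  proof (rule integrable_bounded_support[where B = "g T" and R = "T + h + 1"])
    show "\<bar>indicator {- h..T - h} t * g t\<bar> \<le> g T" for t
      using monoD[OF mono, of t T] h g_nonneg by (auto simp: indicator_def)
  qed (use T h in \<open>auto simp: indicator_def\<close>)
  have "(\<integral>t. indicator {- h..T - h} t * g t \<partial>lborel) =
      \<bar>1\<bar> ^ DIM(real) * (\<integral>t. indicator {- h..T - h} (- h + 1 *\<^sub>R t) * g (- h + 1 *\<^sub>R t) \<partial>lborel)"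
    by (rule lborel_integral_affine[of "\<lambda>t. indicator {- h..T - h} t * g t" 1 "- h"]) auto
  also have "\<dots> = (\<integral>t. indicator {0..T} t * g (t - h) \<partial>lborel)"
  proof -
    have "indicator {- h..T - h} (- h + 1 *\<^sub>R t) * g (- h + 1 *\<^sub>R t) = indicator {0..T} t * g (t - h)" for t
      by (simp add: indicator_def)
    then show ?thesis by (simp only: abs_one power_one mult_1)
  qed
  finally have shift: "(\<integral>t. indicator {- h..T - h} t * g t \<partial>lborel) = (\<integral>t. indicator {0..T} t * g (t - h) \<partial>lborel)" .
  have "(\<integral>t. indicator {0..T} t * g t - indicator {0..T} t * g (t - h) \<partial>lborel) =
      (\<integral>t. indicator {0..T} t * g t - indicator {- h..T - h} t * g t \<partial>lborel)"
    using int1 int2 int3 shift by simp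
  \<comment> \<open>After the time shift the two integrals cancel except on the last interval of
    length \<open>h\<close>, where \<open>g \<le> g T\<close>; before time 0 the function
    vanishes.\<close>
  also have "\<dots> \<le> (\<integral>t. g T * indicator {T - h..T} t \<partial>lborel)"
  proof (rule integral_mono)
    show "indicator {0..T} t * g t - indicator {- h..T - h} t * g t \<le> g T * indicator {T - h..T} t" for t
      using monoD[OF mono, of t T] zero[of t] h g_nonneg[of t] g_nonneg[of T]
      by (auto simp: indicator_def)
    show "integrable lborel (\<lambda>t. g T * indicator {T - h..T} t)"
      by (intro integrable_mult_right integrable_real_indicator) (use h in auto)
  qed (use int1 int3 in auto)
  also have "\<dots> = h * g T" using h by simp
  finally have le: "(\<integral>t. indicator {0..T} t * g t - indicator {0..T} t * g (t - h) \<partial>lborel) \<le> h * g T" .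
  have "(\<integral>\<^sup>+t\<in>{0..T}. ennreal ((g t - g (t - h)) / h) \<partial>lborel) =
      (\<integral>\<^sup>+t. ennreal ((indicator {0..T} t * g t - indicator {0..T} t * g (t - h)) / h) \<partial>lborel)"
    by (intro nn_integral_cong) (auto simp: indicator_def)
  also have "\<dots> = ennreal (\<integral>t. (indicator {0..T} t * g t - indicator {0..T} t * g (t - h)) / h \<partial>lborel)"
    using int1 int2 h monoD[OF mono] by (intro nn_integral_eq_integral) (auto simp: indicator_def)
  also have "(\<integral>t. (indicator {0..T} t * g t - indicator {0..T} t * g (t - h)) / h \<partial>lborel) \<le> g T"
    using le h by (simp add: pos_divide_le_eq mult.commute)
  finally show ?thesis by (simp add: ennreal_leI)
qed

text \<open>Taking the lower limit along one fixed sequence of steps keeps it measurable and within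
  the scope of Fatou's lemma.\<close>

definition lower_left_derivative :: "(real \<Rightarrow> real) \<Rightarrow> real \<Rightarrow> ennreal" where
  "lower_left_derivative g t = liminf (\<lambda>n. ennreal ((g t - g (t - 1 / real (Suc n))) / (1 / real (Suc n))))"

lemma lower_left_derivative_measurable [measurable]:
  "mono g \<Longrightarrow> lower_left_derivative g \<in> borel_measurable borel"
  unfolding lower_left_derivative_def[abs_def]
  using borel_measurable_mono[of g] by measurable

text \<open>Fatou's lemma for the backward quotients gives the inequality half of the fundamental
  theorem of calculus; jumps and singular growth of \<open>g\<close> only enlarge the right-hand
  side.\<close>

lemma nn_integral_lower_left_derivative_le:
  fixes g :: "real \<Rightarrow> real"
  assumes mono: "mono g" and zero: "\<And>t. t < 0 \<Longrightarrow> g t = 0" and T: "0 \<le> T"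
  shows "(\<integral>\<^sup>+t\<in>{0..T}. lower_left_derivative g t \<partial>lborel) \<le> ennreal (g T)"
proof -
  have [measurable]: "g \<in> borel_measurable borel" by (rule borel_measurable_mono[OF mono])
  let ?q = "\<lambda>n t. ennreal ((g t - g (t - 1 / real (Suc n))) / (1 / real (Suc n)))"
  have "(\<integral>\<^sup>+t\<in>{0..T}. lower_left_derivative g t \<partial>lborel) =
      (\<integral>\<^sup>+t. liminf (\<lambda>n. ?q n t * indicator {0..T} t) \<partial>lborel)"
    unfolding lower_left_derivative_def
    by (intro nn_integral_cong) (auto simp: indicator_def Liminf_const)
  also have "\<dots> \<le> liminf (\<lambda>n. \<integral>\<^sup>+t\<in>{0..T}. ?q n t \<partial>lborel)"
    by (rule nn_integral_liminf) measurable
  also have "\<dots> \<le> liminf (\<lambda>n::nat. ennreal (g T))"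
    by (intro Liminf_mono always_eventually allI nn_integral_backward_quotient_le mono zero T) auto
  also have "\<dots> = ennreal (g T)" by (rule Liminf_const) simp
  finally show ?thesis .
qed

section \<open>Estimates for the requests that are uniform in time\<close>

lemma convex_requests_bounded:
  fixes f :: "real \<Rightarrow> 'a::euclidean_space \<Rightarrow> real"
  assumes req: "convex_requests T f"
  shows "\<exists>M\<ge>0. \<forall>t\<in>{0..T}. \<forall>x. norm x \<le> R \<longrightarrow> f t x \<le> M"
proof -
  define d where "d = \<bar>R\<bar> + 1"
  have "d > 0" by (simp add: d_def)
  \<comment> \<open>A cube containing the ball of radius \<open>R\<close> is the hull of finitely
    many points. At each of them the request is bounded in time, and convexity carries the bound to
    the whole cube.\<close>
  then obtain S :: "'a set" where S: "finite S"
      "cbox (0 - (\<Sum>i\<in>Basis. d *\<^sub>R i)) (0 + (\<Sum>i\<in>Basis. d *\<^sub>R i)) = convex hull S"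
    by (rule cube_convex_hull)
  have "\<exists>B. \<forall>t\<in>{0..T}. \<bar>f t q\<bar> \<le> B" for q
    using req by (intro piecewise_continuous_on_bounded) (simp add: convex_requests_def)
  then obtain B where B: "\<And>q t. t \<in> {0..T} \<Longrightarrow> \<bar>f t q\<bar> \<le> B q" by metis
  define M where "M = (\<Sum>q\<in>S. \<bar>B q\<bar>)"
  have "f t x \<le> M" if t: "t \<in> {0..T}" and x: "norm x \<le> R" for t x
  proof -
    have "convex_on (convex hull S) (f t)"
      by (rule convex_on_subset[of UNIV]) (use req t in \<open>auto simp: convex_requests_def\<close>)
    moreover have "\<forall>q\<in>S. f t q \<le> M"
    proof
      fix q assume q: "q \<in> S"
      have "f t q \<le> \<bar>B q\<bar>" using B[OF t, of q] by linarith
      also have "\<dots> \<le> M" unfolding M_def using S(1) q by (intro member_le_sum) auto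
      finally show "f t q \<le> M" .
    qed
    ultimately have "\<forall>y\<in>convex hull S. f t y \<le> M" by (rule convex_on_convex_hull_bound)
    moreover have "x \<in> convex hull S"
      unfolding S(2)[symmetric] mem_box
    proof
      fix i :: 'a assume i: "i \<in> Basis"
      have "- d \<le> x \<bullet> i" "x \<bullet> i \<le> d" using Basis_le_norm[OF i, of x] x by (auto simp: d_def)
      then show "(0 - (\<Sum>i\<in>Basis. d *\<^sub>R i)) \<bullet> i \<le> x \<bullet> i \<and> x \<bullet> i \<le> (0 + (\<Sum>i\<in>Basis. d *\<^sub>R i)) \<bullet> i"
        using i by (simp add: inner_diff_left inner_sum_left inner_Basis if_distrib cong: if_cong)
    qed
    ultimately show ?thesis by blast
  qed
  moreover have "0 \<le> M" unfolding M_def by (intro sum_nonneg) auto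
  ultimately show ?thesis by blast
qed

lemma convex_requests_lipschitz:
  fixes f :: "real \<Rightarrow> 'a::euclidean_space \<Rightarrow> real"
  assumes req: "convex_requests T f"
  shows "\<exists>L\<ge>0. \<forall>t\<in>{0..T}. \<forall>x y. norm x \<le> R \<longrightarrow> norm y \<le> R \<longrightarrow> f t y - f t x \<le> L * norm (y - x)"
proof -
  obtain M where M: "M \<ge> 0" "\<And>t x. t \<in> {0..T} \<Longrightarrow> norm x \<le> R + 1 \<Longrightarrow> f t x \<le> M"
    using convex_requests_bounded[OF req, of "R + 1"] by blast
  have "f t y - f t x \<le> M * norm (y - x)" if "t \<in> {0..T}" "norm x \<le> R" "norm y \<le> R" for t x y
    by (rule convex_on_lipschitz[where R = R]) (use req M that in \<open>auto simp: convex_requests_def\<close>)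
  then show ?thesis using M(1) by blast
qed

text \<open>The finite set of discontinuities depends on \<open>x\<close>. Collecting those of a
  countable dense set of points gives one countable set, and the Lipschitz bound uniform in time
  extends continuity from the dense set to all \<open>x\<close>.\<close>

lemma convex_requests_continuous_in_time:
  fixes f :: "real \<Rightarrow> 'a::euclidean_space \<Rightarrow> real"
  assumes req: "convex_requests T f"
  shows "\<exists>E. countable E \<and> (\<forall>t\<in>{0..T} - E. \<forall>x. ((\<lambda>u. f u x) \<longlongrightarrow> f t x) (at t within {0..T}))"
proof -
  have "\<exists>S. finite S \<and> continuous_on ({0..T} - S) (\<lambda>t. f t q)" for q
    using req unfolding convex_requests_def piecewise_continuous_on_def by blast
  then obtain S where S: "\<And>q. finite (S q)" "\<And>q. continuous_on ({0..T} - S q) (\<lambda>t. f t q)" by metis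
  obtain D :: "'a set" where D: "countable D" "\<And>X. open X \<Longrightarrow> X \<noteq> {} \<Longrightarrow> \<exists>d\<in>D. d \<in> X"
    using countable_dense_exists by blast
  define E where "E = (\<Union>q\<in>D. S q)"
  have "((\<lambda>u. f u x) \<longlongrightarrow> f t x) (at t within {0..T})" if t: "t \<in> {0..T} - E" for t x
  proof (rule tendstoI)
    fix \<epsilon> :: real assume eps: "\<epsilon> > 0"
    obtain L where L: "L \<ge> 0" "\<And>u y z. u \<in> {0..T} \<Longrightarrow> norm y \<le> norm x + 1 \<Longrightarrow> norm z \<le> norm x + 1 \<Longrightarrow>
        f u z - f u y \<le> L * norm (z - y)"
      using convex_requests_lipschitz[OF req, of "norm x + 1"] by blast
    \<comment> \<open>Within \<open>\<delta>\<close> the Lipschitz bound changes a request by less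
      than a third of \<open>\<epsilon>\<close>; \<open>L + 1\<close> avoids division by zero, and
      the cap 1 keeps \<open>q\<close> in the ball where \<open>L\<close> is valid.\<close>
    define \<delta> where "\<delta> = min 1 (\<epsilon> / (3 * (L + 1)))"
    have delta: "\<delta> > 0" using eps L(1) by (simp add: \<delta>_def)
    then obtain q where q: "q \<in> D" "q \<in> ball x \<delta>" using D(2)[of "ball x \<delta>"] by auto
    then have xq: "norm (x - q) < \<delta>" by (simp add: dist_norm)
    have nq: "norm q \<le> norm x + 1"
      using norm_triangle_ineq2[of q x] xq by (simp add: norm_minus_commute \<delta>_def)
    have close: "\<bar>f u x - f u q\<bar> < \<epsilon> / 3" if u: "u \<in> {0..T}" for u
    proof -
      have "\<bar>f u x - f u q\<bar> \<le> L * norm (x - q)"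
        using L(2)[OF u, of x q] L(2)[OF u, of q x] nq by (simp add: norm_minus_commute)
      also have "\<dots> \<le> L * \<delta>" using xq L(1) by (intro mult_left_mono) auto
      also have "\<dots> < (L + 1) * \<delta>" using delta by simp
      also have "\<dots> \<le> (L + 1) * (\<epsilon> / (3 * (L + 1)))" using L(1) by (intro mult_left_mono) (auto simp: \<delta>_def)
      also have "\<dots> = \<epsilon> / 3" using L(1) by (simp add: divide_simps)
      finally show ?thesis .
    qed
    have tS: "t \<in> {0..T} - S q" using t q(1) by (auto simp: E_def)
    have "((\<lambda>u. f u q) \<longlongrightarrow> f t q) (at t within {0..T} - S q)"
      using S(2)[of q] tS by (auto simp: continuous_on_def)
    moreover have "at t within {0..T} - S q = at t within {0..T}"
    proof (rule at_within_nhd[of t "- S q"])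
      show "open (- S q)" using S(1)[of q] by (simp add: finite_imp_closed open_Compl)
    qed (use tS in auto)
    ultimately have "((\<lambda>u. f u q) \<longlongrightarrow> f t q) (at t within {0..T})" by simp
    then have "eventually (\<lambda>u. dist (f u q) (f t q) < \<epsilon> / 3) (at t within {0..T})"
      by (rule tendstoD) (use eps in simp)
    moreover have "eventually (\<lambda>u. u \<in> {0..T}) (at t within {0..T})"
      by (auto simp: eventually_at_filter)
    ultimately show "eventually (\<lambda>u. dist (f u x) (f t x) < \<epsilon>) (at t within {0..T})"
    proof eventually_elim
      case (elim u)
      then have "\<bar>f u q - f t q\<bar> < \<epsilon> / 3" "\<bar>f u x - f u q\<bar> < \<epsilon> / 3" "\<bar>f t x - f t q\<bar> < \<epsilon> / 3"
        using close[of u] close[of t] t by (auto simp: dist_real_def)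
      then show ?case unfolding dist_real_def by linarith
    qed
  qed
  moreover have "countable E"
    unfolding E_def using D(1) S(1) by (intro countable_UN) (auto intro: countable_finite)
  ultimately show ?thesis by blast
qed

lemma convex_requests_convex: "convex_requests T f \<Longrightarrow> t \<in> {0..T} \<Longrightarrow> convex_on UNIV (f t)"
  by (simp add: convex_requests_def)

lemma convex_requests_integrable:
  fixes f :: "real \<Rightarrow> 'a::euclidean_space \<Rightarrow> real"
  assumes req: "convex_requests T f" and st: "0 \<le> s" "t \<le> T"
  shows "integrable lborel (\<lambda>u. indicator {s<..t} u * f u x)"
proof -
  have pc: "piecewise_continuous_on 0 T (\<lambda>u. f u x)" using req by (simp add: convex_requests_def)
  obtain B where B: "\<And>u. u \<in> {0..T} \<Longrightarrow> \<bar>f u x\<bar> \<le> B"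
    using piecewise_continuous_on_bounded[OF pc] by blast
  have [measurable]: "(\<lambda>u. indicator {0..T} u * f u x) \<in> borel_measurable borel"
    by (rule piecewise_continuous_on_measurable[OF pc])
  have eq: "(\<lambda>u. indicator {s<..t} u * f u x) = (\<lambda>u. indicator {s<..t} u * (indicator {0..T} u * f u x))"
    using st by (auto simp: indicator_def fun_eq_iff)
  show ?thesis
    unfolding eq
  proof (rule integrable_bounded_support[where B = "\<bar>B\<bar>" and R = "T + 1"])
    show "(\<lambda>u. indicator {s<..t} u * (indicator {0..T} u * f u x)) \<in> borel_measurable borel" by measurable
    show "\<bar>indicator {s<..t} u * (indicator {0..T} u * f u x)\<bar> \<le> \<bar>B\<bar>" for u
      using B[of u] by (auto simp: indicator_def)
    show "indicator {s<..t} u * (indicator {0..T} u * f u x) = 0" if "T + 1 \<le> norm u" for u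
      using that st by (auto simp: indicator_def)
  qed
qed

text \<open>Convex in \<open>x\<close>, so that Jensen's inequality can be applied to a whole time
  interval at once.\<close>

definition cumulative_cost :: "(real \<Rightarrow> 'a::euclidean_space \<Rightarrow> real) \<Rightarrow> real \<Rightarrow> real \<Rightarrow> 'a \<Rightarrow> real" where
  "cumulative_cost f s t x = (\<integral>u. indicator {s<..t} u * f u x \<partial>lborel)"

lemma cumulative_cost_convex:
  fixes f :: "real \<Rightarrow> 'a::euclidean_space \<Rightarrow> real"
  assumes req: "convex_requests T f" and st: "0 \<le> s" "t \<le> T"
  shows "convex_on UNIV (cumulative_cost f s t)"
proof (rule convex_onI)
  fix c :: real and x y :: 'a assume c: "0 < c" "c < 1"
  note int = convex_requests_integrable[OF req st]
  have "cumulative_cost f s t ((1 - c) *\<^sub>R x + c *\<^sub>R y) \<le>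
      (\<integral>u. (1 - c) * (indicator {s<..t} u * f u x) + c * (indicator {s<..t} u * f u y) \<partial>lborel)"
    unfolding cumulative_cost_def
  proof (rule integral_mono[OF int])
    show "integrable lborel (\<lambda>u. (1 - c) * (indicator {s<..t} u * f u x) + c * (indicator {s<..t} u * f u y))"
      using int[of x] int[of y] by auto
    fix u
    show "indicator {s<..t} u * f u ((1 - c) *\<^sub>R x + c *\<^sub>R y) \<le>
        (1 - c) * (indicator {s<..t} u * f u x) + c * (indicator {s<..t} u * f u y)"
      using convex_onD[OF convex_requests_convex[OF req, of u], of c x y] c st
      by (auto simp: indicator_def)
  qed
  also have "\<dots> = (1 - c) * cumulative_cost f s t x + c * cumulative_cost f s t y"
    using int[of x] int[of y] by (simp add: cumulative_cost_def)
  finally show "cumulative_cost f s t ((1 - c) *\<^sub>R x + c *\<^sub>R y) \<le>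
      (1 - c) * cumulative_cost f s t x + c * cumulative_cost f s t y" .
qed simp

section \<open>Growth of the conjugate in time\<close>

lemma work_function_0_bounded:
  fixes f :: "real \<Rightarrow> 'a::euclidean_space \<Rightarrow> real"
  assumes req: "convex_requests T f"
  shows "\<exists>C\<ge>0. \<forall>t\<in>{0..T}. work_function f t 0 \<le> ennreal C"
proof (cases "0 \<le> T")
  case True
  obtain M where M: "M \<ge> 0" "\<And>t x. t \<in> {0..T} \<Longrightarrow> norm x \<le> 0 \<Longrightarrow> f t x \<le> M"
    using convex_requests_bounded[OF req, of 0] by blast
  have "work_function f t 0 \<le> ennreal (M * T)" if t: "t \<in> {0..T}" for t
  proof -
    have "work_function f t 0 \<le> total_cost f t (\<lambda>_. 0)" by (rule work_function_le) auto
    also have "movement_cost t (\<lambda>_. 0 :: 'a) \<le> 0" by (rule movement_cost_leI) simp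
    then have "total_cost f t (\<lambda>_. 0) = service_cost f t (\<lambda>_. 0)" by (simp add: total_cost_def)
    also have "\<dots> \<le> (\<integral>\<^sup>+u. ennreal M * indicator {0..T} u \<partial>lborel)"
      unfolding service_cost_def using M(2)[of _ 0] t
      by (intro nn_integral_mono) (auto simp: indicator_def intro: ennreal_leI)
    also have "\<dots> = ennreal (M * T)"
      using True M(1) by (subst nn_integral_cmult_indicator) (auto simp: ennreal_mult)
    finally show ?thesis .
  qed
  then show ?thesis using True M(1) by (intro exI[of _ "M * T"]) auto
qed (auto intro: exI[of _ 0])

text \<open>Resting at the minimiser of time \<open>s\<close> is affordable. This upper bound limits
  what a near-optimal path can spend on \<open>[s, t]\<close>, and hence its displacement.\<close>

lemma conjugate_growth:
  fixes v :: "'a::euclidean_space"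
  assumes req: "convex_requests T f" and st: "0 \<le> s" "s \<le> t" "t \<le> T" and v: "norm v < 1"
    and M: "0 \<le> M" "\<And>u. u \<in> {0..T} \<Longrightarrow> f u (minimiser f s v) \<le> M"
  shows "conjugate f t v \<le> conjugate f s v + M * (t - s)"
proof -
  obtain C where C: "C \<ge> 0" "\<And>t. t \<in> {0..T} \<Longrightarrow> work_function f t 0 \<le> ennreal C"
    using work_function_0_bounded[OF req] by blast
  have fin: "work_function f u 0 < \<infinity>" if "u \<in> {0..T}" for u
    using C(2)[OF that] by (simp add: order_le_less_trans less_top)
  define x where "x = minimiser f s v"
  have Wx: "work_function f s x < \<infinity>"
    unfolding x_def by (rule work_function_minimiser_finite) (use fin st v in auto)
  have "(\<integral>\<^sup>+u\<in>{s<..t}. ennreal (f u x) \<partial>lborel) \<le> (\<integral>\<^sup>+u. ennreal M * indicator {s<..t} u \<partial>lborel)"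
    using M(2) st by (intro nn_integral_mono) (auto simp: indicator_def x_def intro: ennreal_leI)
  also have "\<dots> = ennreal (M * (t - s))"
    using st M(1) by (subst nn_integral_cmult_indicator) (auto simp: ennreal_mult)
  finally have le: "(\<integral>\<^sup>+u\<in>{s<..t}. ennreal (f u x) \<partial>lborel) \<le> ennreal (M * (t - s))" .
  then have "(\<integral>\<^sup>+u\<in>{s<..t}. ennreal (f u x) \<partial>lborel) < \<infinity>" by (simp add: order_le_less_trans less_top)
  from work_function_stay_le[of s t f x, OF st(1,2) this]
  have "work_function f t x \<le> work_function f s x + ennreal (M * (t - s))"
    using le by (meson add_left_mono order_trans)
  also have "\<dots> = ennreal (enn2real (work_function f s x) + M * (t - s))"
    using Wx M(1) st by (simp add: ennreal_plus)
  finally have W: "work_function f t x \<le> ennreal (enn2real (work_function f s x) + M * (t - s))" .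
  then have "work_function f t x < \<infinity>" by (simp add: order_le_less_trans less_top)
  then have "conjugate f t v \<le> enn2real (work_function f t x) - v \<bullet> x"
    using st v fin by (intro conjugate_le) auto
  also have "enn2real (work_function f t x) \<le> enn2real (work_function f s x) + M * (t - s)"
    by (rule enn2real_leI[OF _ W]) (use M(1) st in auto)
  finally show ?thesis by (simp add: conjugate_def x_def)
qed

text \<open>A near-optimal path for \<open>conjugate f t v\<close> moves by \<open>O(t - s)\<close> during \<open>[s, t]\<close>, so up to a quadratic
  error it pays the service cost of its end point \<open>minimiser f t v\<close>.\<close>

lemma conjugate_increment_ge:
  fixes f :: "real \<Rightarrow> 'a::euclidean_space \<Rightarrow> real"
  assumes req: "convex_requests T f" and r: "0 \<le> r" "r < 1"
  shows "\<exists>K\<ge>0. \<forall>s t v. 0 \<le> s \<longrightarrow> s \<le> t \<longrightarrow> t \<le> T \<longrightarrow> norm v \<le> r \<longrightarrow>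
    cumulative_cost f s t (minimiser f t v) - K * (t - s)\<^sup>2 \<le> conjugate f t v - conjugate f s v"
proof -
  obtain C where C: "C \<ge> 0" "\<And>t. t \<in> {0..T} \<Longrightarrow> work_function f t 0 \<le> ennreal C"
    using work_function_0_bounded[OF req] by blast
  have fin: "work_function f u 0 < \<infinity>" if "u \<in> {0..T}" for u
    using C(2)[OF that] by (simp add: order_le_less_trans less_top)
  have sg: "ball_supergradient (conjugate f t) (minimiser f t) C" if "t \<in> {0..T}" for t
    using that C by (intro conjugate_supergradient) auto
  define R where "R = 2 * C / (1 - r)"
  have norm_min: "norm (minimiser f t v) \<le> R" if "t \<in> {0..T}" "norm v \<le> r" for t v
    unfolding R_def by (rule ball_supergradient.norm_gradient_le_on_cball[OF sg[OF that(1)] that(2) r(2)])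
  obtain M where M: "M \<ge> 0" "\<And>t x. t \<in> {0..T} \<Longrightarrow> norm x \<le> R \<Longrightarrow> f t x \<le> M"
    using convex_requests_bounded[OF req, of R] by blast
  \<comment> \<open>A bound on the speed of near-optimal paths: over time \<open>h\<close> they have
    at most \<open>M * h\<close> from the growth of the conjugate plus slack \<open>h\<close> to
    spend, and moving costs at least \<open>1 - r\<close> per unit length.\<close>
  define K1 where "K1 = (M + 1) / (1 - r)"
  have K1: "K1 \<ge> 0" using M r by (simp add: K1_def)
  \<comment> \<open>The radius covers every position reached from the ball of radius
    \<open>R\<close> at speed \<open>K1\<close> within time \<open>T\<close>.\<close>
  obtain L where L: "L \<ge> 0" "\<And>t x y. t \<in> {0..T} \<Longrightarrow> norm x \<le> R + K1 * T \<Longrightarrow> norm y \<le> R + K1 * T \<Longrightarrow>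
      f t y - f t x \<le> L * norm (y - x)"
    using convex_requests_lipschitz[OF req, of "R + K1 * T"] by blast
  have "cumulative_cost f s t (minimiser f t v) - (L * K1) * (t - s)\<^sup>2 \<le> conjugate f t v - conjugate f s v"
    if st: "0 \<le> s" "s \<le> t" "t \<le> T" and v: "norm v \<le> r" for s t v
  proof (cases "s = t")
    case True
    then show ?thesis by (simp add: cumulative_cost_def)
  next
    case False
    define h where "h = t - s"
    have h: "h > 0" using False st by (simp add: h_def)
    define x where "x = minimiser f t v"
    have nx: "norm x \<le> R" unfolding x_def by (rule norm_min) (use st v in auto)
    have v1: "norm v < 1" using v r by simp
    have "cumulative_cost f s t x - (L * K1) * h\<^sup>2 + conjugate f s v \<le> conjugate f t v + \<epsilon>"
      if eps: "0 < \<epsilon>" for \<epsilon>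
    \<comment> \<open>Slack at most \<open>h\<close> keeps the displacement of order
      \<open>h\<close>; slack at most \<open>\<epsilon>\<close> disappears in the limit.\<close>
    proof (rule work_function_split_near_optimal[OF st(1,2) fin fin v1, of "min \<epsilon> h"])
      fix p
      define A where "A = (\<integral>\<^sup>+u\<in>{s<..t}. ennreal (f u (p u)) \<partial>lborel)"
      assume pt: "p t = minimiser f t v" and finA: "(\<integral>\<^sup>+u\<in>{s<..t}. ennreal (f u (p u)) \<partial>lborel) < \<infinity>"
        and split: "\<And>r. r \<in> {s..t} \<Longrightarrow> conjugate f s v +
          enn2real (\<integral>\<^sup>+u\<in>{s<..t}. ennreal (f u (p u)) \<partial>lborel) +
          (1 - norm v) * norm (p t - p r) \<le> conjugate f t v + min \<epsilon> h"
      have growth: "conjugate f t v \<le> conjugate f s v + M * h"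
        unfolding h_def using st v1 M norm_min[of s v] v by (intro conjugate_growth[OF req]) auto
      have move: "norm (x - p u) \<le> K1 * h" if u: "u \<in> {s..t}" for u
      proof -
        have "(1 - r) * norm (x - p u) \<le> (1 - norm v) * norm (x - p u)"
          using v by (intro mult_right_mono) auto
        also have "\<dots> \<le> M * h + min \<epsilon> h"
          using split[OF u, folded A_def] growth enn2real_nonneg[of A] unfolding x_def pt by linarith
        also have "\<dots> \<le> (M + 1) * h" by (simp add: algebra_simps)
        finally show ?thesis using r by (simp add: K1_def field_simps)
      qed
      have serve: "f u x - L * K1 * h \<le> f u (p u)" if u: "u \<in> {s<..t}" for u
      proof -
        have "norm (p u) \<le> norm x + norm (x - p u)"
          using norm_triangle_ineq4[of x "x - p u"] by simp
        also have "\<dots> \<le> R + K1 * h" using nx move[of u] u by auto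
        also have "\<dots> \<le> R + K1 * T" using st K1 by (intro add_left_mono mult_left_mono) (auto simp: h_def)
        finally have "norm (p u) \<le> R + K1 * T" .
        moreover have "norm x \<le> R + K1 * T" using nx K1 st by (simp add: add_increasing2)
        ultimately have "f u x - f u (p u) \<le> L * norm (x - p u)" using u st by (intro L(2)) auto
        also have "\<dots> \<le> L * (K1 * h)" using L(1) move[of u] u by (intro mult_left_mono) auto
        finally show ?thesis by simp
      qed
      \<comment> \<open>The service cost along \<open>p\<close> may be a lower integral of a
        non-measurable function. It is therefore compared with an integrable minorant, using only
        monotonicity of the nonnegative integral.\<close>
      define g where "g u = indicator {s<..t} u * f u x - L * K1 * h * indicator {s<..t} u" for u
      have int_ind: "integrable lborel (\<lambda>u. L * K1 * h * indicator {s<..t} u)"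
        by (intro integrable_mult_right integrable_real_indicator) (use st in auto)
      note int_f = convex_requests_integrable[OF req st(1,3), of x]
      have g_int: "integrable lborel g"
        unfolding g_def[abs_def] by (intro Bochner_Integration.integrable_diff int_ind int_f)
      have "cumulative_cost f s t x - (L * K1) * h\<^sup>2 = (\<integral>u. g u \<partial>lborel)"
        unfolding g_def cumulative_cost_def using int_f int_ind st
        by (simp add: h_def power2_eq_square)
      also have "\<dots> \<le> enn2real (\<integral>\<^sup>+u. ennreal (g u) \<partial>lborel)"
        using real_lebesgue_integral_def[OF g_int] enn2real_nonneg by simp
      also have "\<dots> \<le> enn2real A"
      proof (rule enn2real_mono)
        show "(\<integral>\<^sup>+u. ennreal (g u) \<partial>lborel) \<le> A"
          unfolding A_def g_def using serve
          by (intro nn_integral_mono) (auto simp: indicator_def intro: ennreal_leI)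
        show "A < top" using finA by (simp add: A_def)
      qed
      finally have "cumulative_cost f s t x - (L * K1) * h\<^sup>2 \<le> enn2real A" .
      moreover have "conjugate f s v + enn2real A \<le> conjugate f t v + \<epsilon>"
        using split[of t] st by (simp add: A_def)
      ultimately show ?thesis by simp
    qed (use st eps h in auto)
    then have "cumulative_cost f s t x - (L * K1) * h\<^sup>2 + conjugate f s v \<le> conjugate f t v"
      by (rule field_le_epsilon)
    then show ?thesis by (simp add: x_def h_def)
  qed
  then show ?thesis using L(1) K1 by (intro exI[of _ "L * K1"]) auto
qed

section \<open>The Steiner path and its movement cost\<close>

locale convex_request_sequence =
  fixes f :: "real \<Rightarrow> 'a::euclidean_space \<Rightarrow> real" and T C :: real
  assumes T: "0 \<le> T" and req: "convex_requests T f"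
    and C: "0 \<le> C" "\<And>t. t \<in> {0..T} \<Longrightarrow> work_function f t 0 \<le> ennreal C"
begin

lemma work_function_0_finite: "t \<in> {0..T} \<Longrightarrow> work_function f t 0 < \<infinity>"
  using C(2)[of t] by (simp add: order_le_less_trans less_top)

lemma supergradient: "t \<in> {0..T} \<Longrightarrow> ball_supergradient (conjugate f t) (minimiser f t) C"
  using C by (intro conjugate_supergradient) auto

lemma conjugate_increasing:
  "0 \<le> s \<Longrightarrow> s \<le> t \<Longrightarrow> t \<le> T \<Longrightarrow> norm v < 1 \<Longrightarrow> conjugate f s v \<le> conjugate f t v"
  by (intro conjugate_mono work_function_0_finite) auto

lemma offline_opt_eq: "offline_opt f T = ennreal (conjugate f T 0)"
proof -
  have T': "T \<in> {0..T}" using T by simp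
  note fin = work_function_0_finite[OF T']
  have W: "work_function f T (minimiser f T 0) = ennreal (conjugate f T 0)"
    using work_function_minimiser_finite[OF T fin, of 0] by (simp add: conjugate_def)
  show ?thesis
  proof (rule antisym)
    show "offline_opt f T \<le> ennreal (conjugate f T 0)"
      unfolding offline_opt_def W[symmetric] by (rule INF_lower) simp
    show "ennreal (conjugate f T 0) \<le> offline_opt f T"
      unfolding offline_opt_def
    proof (rule INF_greatest)
      fix x
      show "ennreal (conjugate f T 0) \<le> work_function f T x"
      proof (cases "work_function f T x < \<infinity>")
        case True
        then have "ennreal (conjugate f T 0) \<le> ennreal (enn2real (work_function f T x))"
          using conjugate_le[OF T fin, of 0 x] by (intro ennreal_leI) simp
        also have "\<dots> = work_function f T x" using True by simp
        finally show ?thesis .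
      qed (simp add: less_top[symmetric])
    qed
  qed
qed

text \<open>The definition integrates over the closed ball, but the minimisers are controlled only
  in the open one. The sphere is negligible, which transfers both integrability and the value of the
  integral.\<close>

lemma steiner_path_eq:
  assumes t: "t \<in> {0..T}"
  shows "steiner_path f t = (1 / measure lborel (ball (0::'a) 1)) *\<^sub>R ball_integral (minimiser f t)"
proof -
  interpret ball_supergradient "conjugate f t" "minimiser f t" C by (rule supergradient[OF t])
  have int: "minimiser f t absolutely_integrable_on ball 0 1"
    unfolding set_integrable_def by (rule integrable_gradient)
  have negl: "negligible {v \<in> ball 0 1 - cball 0 1. minimiser f t v \<noteq> 0}"
    "negligible {v \<in> cball (0::'a) 1 - ball 0 1. minimiser f t v \<noteq> 0}"
    by (rule negligible_subset[OF negligible_sphere[of 0 1]]; force)+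
  have int': "minimiser f t absolutely_integrable_on cball 0 1"
    by (rule absolutely_integrable_spike_set[OF int]) (use negl in auto)
  have "(LINT v:cball 0 1|lebesgue. minimiser f t v) = integral (cball 0 1) (minimiser f t)"
    by (rule set_lebesgue_integral_eq_integral(2)[OF int'])
  also have "\<dots> = integral (ball 0 1) (minimiser f t)"
    by (rule integral_spike_set) (use negl in \<open>auto simp: conj_commute\<close>)
  also have "\<dots> = ball_integral (minimiser f t)"
    unfolding ball_integral_def set_lebesgue_integral_eq_integral(2)[OF int, symmetric]
    by (simp add: set_lebesgue_integral_def)
  finally show ?thesis
    by (simp add: steiner_path_def functional_steiner_point_def minimiser_def[abs_def] measure_completion
        content_cball content_ball)
qed

text \<open>The sample times of a partition yield an increasing chain of conjugates, to which the
  telescoping estimate applies; the normalisation by the volume cancels, and only the dimension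
  remains.\<close>

lemma movement_cost_steiner_path_le:
  "movement_cost T (steiner_path f) \<le> ennreal (real DIM('a)) * offline_opt f T"
proof (rule movement_cost_leI)
  fix n :: nat and \<tau> :: "nat \<Rightarrow> real"
  assume \<tau>: "mono_on {..n} \<tau>" "\<tau> ` {..n} \<subseteq> {0..T}"
  have in_T: "\<tau> i \<in> {0..T}" if "i \<le> n" for i using \<tau>(2) that by blast
  have mono: "\<tau> i \<le> \<tau> (Suc i)" if "i < n" for i using \<tau>(1) that by (auto simp: mono_on_def)
  define V where "V = measure lborel (ball (0::'a) 1)"
  have V: "V > 0" by (simp add: V_def content_ball)
  have "(\<Sum>i<n. norm (steiner_path f (\<tau> (Suc i)) - steiner_path f (\<tau> i))) =
      (1 / V) * (\<Sum>i<n. norm (ball_integral (minimiser f (\<tau> (Suc i))) - ball_integral (minimiser f (\<tau> i))))"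
    unfolding sum_distrib_left
  proof (rule sum.cong[OF refl])
    fix i assume "i \<in> {..<n}"
    then have "steiner_path f (\<tau> (Suc i)) - steiner_path f (\<tau> i) =
        (1 / V) *\<^sub>R (ball_integral (minimiser f (\<tau> (Suc i))) - ball_integral (minimiser f (\<tau> i)))"
      using steiner_path_eq[OF in_T[of i]] steiner_path_eq[OF in_T[of "Suc i"]]
      by (simp add: V_def scaleR_diff_right)
    then show "norm (steiner_path f (\<tau> (Suc i)) - steiner_path f (\<tau> i)) =
        (1 / V) * norm (ball_integral (minimiser f (\<tau> (Suc i))) - ball_integral (minimiser f (\<tau> i)))"
      using V by simp
  qed
  also have "\<dots> \<le> (1 / V) * (DIM('a) * V * conjugate f (\<tau> n) 0)"
    unfolding V_def
  proof (intro mult_left_mono ball_integral_variation_le)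
    show "ball_supergradient (conjugate f (\<tau> i)) (minimiser f (\<tau> i)) C" if "i \<le> n" for i
      by (rule supergradient[OF in_T[OF that]])
    show "conjugate f (\<tau> i) v \<le> conjugate f (\<tau> (Suc i)) v" if "i < n" "norm v < 1" for i v
      using in_T[of i] in_T[of "Suc i"] mono[OF that(1)] that by (intro conjugate_increasing) auto
  qed simp
  also have "\<dots> = DIM('a) * conjugate f (\<tau> n) 0" using V by simp
  also have "\<dots> \<le> DIM('a) * conjugate f T 0"
    using in_T[of n] by (intro mult_left_mono conjugate_increasing) auto
  finally have "(\<Sum>i<n. norm (steiner_path f (\<tau> (Suc i)) - steiner_path f (\<tau> i))) \<le> DIM('a) * conjugate f T 0" .
  then have "ennreal (\<Sum>i<n. norm (steiner_path f (\<tau> (Suc i)) - steiner_path f (\<tau> i))) \<le>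
      ennreal (DIM('a) * conjugate f T 0)"
    by (rule ennreal_leI)
  then show "(\<Sum>i<n. ennreal (norm (steiner_path f (\<tau> (Suc i)) - steiner_path f (\<tau> i)))) \<le>
      ennreal (real DIM('a)) * offline_opt f T"
    by (simp add: offline_opt_eq ennreal_mult' sum_ennreal)
qed

section \<open>Averages over smaller balls and the service cost\<close>

definition vol :: "real \<Rightarrow> real" where "vol r = measure lborel (cball (0::'a) r)"

text \<open>A radius below 1 keeps the minimisers bounded, which makes the quadratic error of the
  increment estimate uniform over the domain of averaging.\<close>

definition mean_conjugate :: "real \<Rightarrow> real \<Rightarrow> real" where
  "mean_conjugate r t =
    (1 / vol r) * (\<integral>v. indicator (cball 0 r) v * ball_supergradient.H (conjugate f t) v \<partial>lborel)"

definition mean_minimiser :: "real \<Rightarrow> real \<Rightarrow> 'a" where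
  "mean_minimiser r t = (1 / vol r) *\<^sub>R (\<integral>v. indicator (cball 0 r) v *\<^sub>R minimiser f t v \<partial>lebesgue)"

lemma vol_pos: "0 < r \<Longrightarrow> 0 < vol r"
  by (simp add: vol_def)

lemma mean_minimiser_tendsto:
  assumes t: "t \<in> {0..T}" and r: "\<And>k. 0 < r k" "\<And>k. r k < 1" "r \<longlonglongrightarrow> 1"
  shows "(\<lambda>k. mean_minimiser (r k) t) \<longlonglongrightarrow> steiner_path f t"
proof -
  interpret ball_supergradient "conjugate f t" "minimiser f t" C by (rule supergradient[OF t])
  have "(\<lambda>k. \<integral>v. indicator (cball 0 (r k)) v *\<^sub>R minimiser f t v \<partial>lebesgue) \<longlonglongrightarrow>
      (\<integral>v. indicator (ball 0 1) v *\<^sub>R minimiser f t v \<partial>lebesgue)"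
  proof (rule integral_dominated_convergence[where w = "\<lambda>v. norm (indicator (ball 0 1) v *\<^sub>R minimiser f t v)"])
    show "(\<lambda>v. indicator (ball 0 1) v *\<^sub>R minimiser f t v) \<in> borel_measurable lebesgue"
      by (rule gradient_measurable)
    show "(\<lambda>v. indicator (cball 0 (r k)) v *\<^sub>R minimiser f t v) \<in> borel_measurable lebesgue" for k
      using integrable_gradient_cball[OF r(1,2)] by (rule borel_measurable_integrable)
    show "integrable lebesgue (\<lambda>v. norm (indicator (ball 0 1) v *\<^sub>R minimiser f t v))"
      by (rule integrable_norm[OF integrable_gradient])
    show "AE v in lebesgue. norm (indicator (cball 0 (r k)) v *\<^sub>R minimiser f t v) \<le>
        norm (indicator (ball 0 1) v *\<^sub>R minimiser f t v)" for k
    proof (rule AE_I2)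
      fix v :: 'a
      show "norm (indicator (cball 0 (r k)) v *\<^sub>R minimiser f t v) \<le>
          norm (indicator (ball 0 1) v *\<^sub>R minimiser f t v)"
        using r(2)[of k] by (cases "norm v \<le> r k") auto
    qed
    show "AE v in lebesgue. (\<lambda>k. indicator (cball 0 (r k)) v *\<^sub>R minimiser f t v) \<longlonglongrightarrow>
        indicator (ball 0 1) v *\<^sub>R minimiser f t v"
    proof (rule AE_I2)
      fix v :: 'a
      have "eventually (\<lambda>k. indicator (cball 0 (r k)) v *\<^sub>R minimiser f t v =
          indicator (ball 0 1) v *\<^sub>R minimiser f t v) sequentially"
      proof (cases "norm v < 1")
        case True
        then have "eventually (\<lambda>k. norm v < r k) sequentially"
          by (intro order_tendstoD(1)[OF r(3)])
        then show ?thesis by eventually_elim (use True in auto)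
      next
        case False
        then have "\<not> norm v \<le> r k" for k using r(2)[of k] by linarith
        then show ?thesis using False by simp
      qed
      then show "(\<lambda>k. indicator (cball 0 (r k)) v *\<^sub>R minimiser f t v) \<longlonglongrightarrow>
          indicator (ball 0 1) v *\<^sub>R minimiser f t v"
        by (rule tendsto_eventually)
    qed
  qed
  moreover have "(\<lambda>k. 1 / vol (r k)) \<longlonglongrightarrow> 1 / measure lborel (ball (0::'a) 1)"
  proof -
    have "(\<lambda>k. unit_ball_vol DIM('a) * r k ^ DIM('a)) \<longlonglongrightarrow> unit_ball_vol DIM('a) * 1 ^ DIM('a)"
      by (intro tendsto_intros r(3))
    moreover have "vol (r k) = unit_ball_vol DIM('a) * r k ^ DIM('a)" for k
      using r(1)[of k] by (simp add: vol_def content_cball)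
    ultimately have "(\<lambda>k. vol (r k)) \<longlonglongrightarrow> measure lborel (ball (0::'a) 1)"
      by (simp add: content_ball)
    moreover have "0 < measure lborel (ball (0::'a) 1)" by (simp only: content_ball_gt_0_iff zero_less_one)
    ultimately show ?thesis by (intro tendsto_intros) simp_all
  qed
  ultimately show ?thesis
    unfolding mean_minimiser_def steiner_path_eq[OF t] ball_integral_def by (intro tendsto_scaleR)
qed

lemma mean_conjugate_nonneg:
  assumes r: "0 < r" "r < 1" and t: "t \<in> {0..T}"
  shows "0 \<le> mean_conjugate r t"
proof -
  interpret ball_supergradient "conjugate f t" "minimiser f t" C by (rule supergradient[OF t])
  show ?thesis
    unfolding mean_conjugate_def using vol_pos[OF r(1)]
    by (intro mult_nonneg_nonneg Bochner_Integration.integral_nonneg) (auto simp: H_nonneg)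
qed

lemma mean_conjugate_le:
  assumes r: "0 < r" "r < 1" and t: "t \<in> {0..T}"
  shows "mean_conjugate r t \<le> conjugate f t 0"
proof -
  interpret ball_supergradient "conjugate f t" "minimiser f t" C by (rule supergradient[OF t])
  have "(\<integral>v. indicator (cball 0 r) v * H v \<partial>lborel) \<le> vol r * conjugate f t 0"
    unfolding vol_def by (rule integral_symmetric_le) (use r in auto)
  then show ?thesis
    using vol_pos[OF r(1)] by (simp add: mean_conjugate_def pos_divide_le_eq mult.commute)
qed

lemma mean_conjugate_mono:
  assumes r: "0 < r" "r < 1" and st: "0 \<le> s" "s \<le> t" "t \<le> T"
  shows "mean_conjugate r s \<le> mean_conjugate r t"
proof -
  interpret s: ball_supergradient "conjugate f s" "minimiser f s" C by (rule supergradient) (use st in auto)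
  interpret t: ball_supergradient "conjugate f t" "minimiser f t" C by (rule supergradient) (use st in auto)
  have "(\<integral>v. indicator (cball 0 r) v * s.H v \<partial>lborel) \<le> (\<integral>v. indicator (cball 0 r) v * t.H v \<partial>lborel)"
  proof (rule integral_mono)
    fix v :: 'a
    show "indicator (cball 0 r) v * s.H v \<le> indicator (cball 0 r) v * t.H v"
      using conjugate_increasing[OF st, of v] r by (auto simp: indicator_def s.H_def t.H_def)
  qed (auto intro: s.integrable_H_indicator t.integrable_H_indicator)
  then show ?thesis
    unfolding mean_conjugate_def using vol_pos[OF r(1)] by (intro mult_left_mono) auto
qed

text \<open>Jensen's inequality for the convex function \<open>cumulative_cost f s t\<close> and the mean over \<open>cball 0 r\<close>,
  via a supporting affine function.\<close>

lemma mean_conjugate_increment_ge: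
  assumes r: "0 < r" "r < 1"
  shows "\<exists>K\<ge>0. \<forall>s t. 0 \<le> s \<longrightarrow> s \<le> t \<longrightarrow> t \<le> T \<longrightarrow>
    cumulative_cost f s t (mean_minimiser r t) - K * (t - s)\<^sup>2 \<le> mean_conjugate r t - mean_conjugate r s"
proof -
  obtain K where K: "K \<ge> 0" "\<And>s t v. 0 \<le> s \<Longrightarrow> s \<le> t \<Longrightarrow> t \<le> T \<Longrightarrow> norm v \<le> r \<Longrightarrow>
      cumulative_cost f s t (minimiser f t v) - K * (t - s)\<^sup>2 \<le> conjugate f t v - conjugate f s v"
    using conjugate_increment_ge[OF req, of r] r by (meson less_imp_le)
  have "cumulative_cost f s t (mean_minimiser r t) - K * (t - s)\<^sup>2 \<le> mean_conjugate r t - mean_conjugate r s"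
    if st: "0 \<le> s" "s \<le> t" "t \<le> T" for s t
  proof -
    interpret s: ball_supergradient "conjugate f s" "minimiser f s" C by (rule supergradient) (use st in auto)
    interpret t: ball_supergradient "conjugate f t" "minimiser f t" C by (rule supergradient) (use st in auto)
    let ?I = "indicator (cball (0::'a) r) :: 'a \<Rightarrow> real"
    define x where "x = mean_minimiser r t"
    obtain y where y: "\<And>z. cumulative_cost f s t x + y \<bullet> (z - x) \<le> cumulative_cost f s t z"
      using convex_on_subgradient_exists[OF cumulative_cost_convex[OF req st(1,3)], of x] by blast
    \<comment> \<open>Constant term of the affine minorant
      \<open>c + y \<bullet> minimiser f t v\<close> for the increment of the conjugate, with the
      quadratic error included.\<close>
    define c where "c = cumulative_cost f s t x - K * (t - s)\<^sup>2 - y \<bullet> x"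
    note int_m = t.integrable_gradient_cball[OF r]
    have int_I: "integrable lebesgue (\<lambda>v. c * ?I v)"
      by (intro integrable_mult_right integrable_real_indicator)
         (use emeasure_lborel_cball_finite[of "0::'a" r] in auto)
    have int_ym: "integrable lebesgue (\<lambda>v. (?I v *\<^sub>R minimiser f t v) \<bullet> y)"
      using int_m by (rule integrable_inner_left)
    have Ht: "integrable lborel (\<lambda>v. ?I v * t.H v)" by (rule t.integrable_H_indicator) auto
    have Hs: "integrable lborel (\<lambda>v. ?I v * s.H v)" by (rule s.integrable_H_indicator) auto
    have mt [measurable]: "(\<lambda>v. ?I v * t.H v) \<in> borel_measurable lborel"
      using Ht by (rule borel_measurable_integrable)
    have ms [measurable]: "(\<lambda>v. ?I v * s.H v) \<in> borel_measurable lborel"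
      using Hs by (rule borel_measurable_integrable)
    have Ht': "integrable lebesgue (\<lambda>v. ?I v * t.H v)" using Ht integrable_completion[OF mt] by simp
    have Hs': "integrable lebesgue (\<lambda>v. ?I v * s.H v)" using Hs integrable_completion[OF ms] by simp
    \<comment> \<open>The average of an affine function of the minimiser is its value at the mean
      \<open>x\<close>; this is the equality case on which Jensen's inequality rests.\<close>
    have "vol r * (c + y \<bullet> x) = c * vol r + (vol r *\<^sub>R x) \<bullet> y"
      by (simp add: algebra_simps inner_commute)
    also have "vol r *\<^sub>R x = (\<integral>v. ?I v *\<^sub>R minimiser f t v \<partial>lebesgue)"
      using vol_pos[OF r(1)] by (simp add: x_def mean_minimiser_def)
    also have "c * vol r + (\<integral>v. ?I v *\<^sub>R minimiser f t v \<partial>lebesgue) \<bullet> y =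
        (\<integral>v. c * ?I v \<partial>lebesgue) + (\<integral>v. (?I v *\<^sub>R minimiser f t v) \<bullet> y \<partial>lebesgue)"
      using integral_inner_left[OF int_m, of y] by (simp add: vol_def measure_completion)
    also have "\<dots> = (\<integral>v. c * ?I v + (?I v *\<^sub>R minimiser f t v) \<bullet> y \<partial>lebesgue)"
      by (rule Bochner_Integration.integral_add[OF int_I int_ym, symmetric])
    also have "\<dots> \<le> (\<integral>v. ?I v * t.H v - ?I v * s.H v \<partial>lebesgue)"
    proof (rule integral_mono)
      fix v :: 'a
      show "c * ?I v + (?I v *\<^sub>R minimiser f t v) \<bullet> y \<le> ?I v * t.H v - ?I v * s.H v"
      proof (cases "norm v \<le> r")
        case True
        have "c + minimiser f t v \<bullet> y = cumulative_cost f s t x + y \<bullet> (minimiser f t v - x) - K * (t - s)\<^sup>2"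
          by (simp add: c_def inner_diff_right inner_commute)
        also have "\<dots> \<le> conjugate f t v - conjugate f s v"
          using y[of "minimiser f t v"] K(2)[OF st True] by linarith
        finally show ?thesis using True r by (simp add: t.H_eq s.H_eq)
      qed simp
    qed (intro Bochner_Integration.integrable_add Bochner_Integration.integrable_diff int_I int_ym Ht' Hs')+
    also have "\<dots> = (\<integral>v. ?I v * t.H v \<partial>lebesgue) - (\<integral>v. ?I v * s.H v \<partial>lebesgue)"
      by (rule Bochner_Integration.integral_diff[OF Ht' Hs'])
    also have "\<dots> = (\<integral>v. ?I v * t.H v \<partial>lborel) - (\<integral>v. ?I v * s.H v \<partial>lborel)"
      by (simp only: integral_completion[OF mt] integral_completion[OF ms])
    also have "\<dots> = vol r * (mean_conjugate r t - mean_conjugate r s)"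
      using vol_pos[OF r(1)] by (simp add: mean_conjugate_def right_diff_distrib)
    finally have "c + y \<bullet> x \<le> mean_conjugate r t - mean_conjugate r s"
      using vol_pos[OF r(1)] by simp
    then show ?thesis by (simp add: c_def x_def)
  qed
  then show ?thesis using K(1) by blast
qed

text \<open>Extended by 0 to negative times and by a constant after \<open>T\<close>, so that it is
  monotone on the whole line and its backward quotients near time 0 make sense.\<close>

definition profile :: "real \<Rightarrow> real \<Rightarrow> real" where
  "profile r t = (if t < 0 then 0 else mean_conjugate r (min t T))"

lemma mono_profile: "0 < r \<Longrightarrow> r < 1 \<Longrightarrow> mono (profile r)"
  using T by (intro monoI)
    (auto simp: profile_def min_def intro!: mean_conjugate_mono mean_conjugate_nonneg)

text \<open>Just before \<open>t\<close> the request at the fixed point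
  \<open>mean_minimiser r t\<close> is close to its value at time \<open>t\<close>, and the
  quadratic error divided by the step tends to 0.\<close>

lemma lower_left_derivative_ge:
  assumes r: "0 < r" "r < 1" and t: "0 < t" "t \<le> T"
    and cont: "\<And>x. ((\<lambda>u. f u x) \<longlongrightarrow> f t x) (at t within {0..T})"
  shows "ennreal (f t (mean_minimiser r t)) \<le> lower_left_derivative (profile r) t"
  unfolding lower_left_derivative_def
proof (subst le_Liminf_iff, intro allI impI)
  fix y :: ennreal assume y: "y < ennreal (f t (mean_minimiser r t))"
  define x where "x = mean_minimiser r t"
  define c where "c = f t x"
  obtain K where K: "K \<ge> 0" "\<And>s t. 0 \<le> s \<Longrightarrow> s \<le> t \<Longrightarrow> t \<le> T \<Longrightarrow>
    cumulative_cost f s t (mean_minimiser r t) - K * (t - s)\<^sup>2 \<le> mean_conjugate r t - mean_conjugate r s"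
    using mean_conjugate_increment_ge[OF r] by blast
  have "y < top" using y by (rule less_trans) simp
  then obtain b where b: "0 \<le> b" "y = ennreal b" by (cases y rule: ennreal_cases) auto
  have bc: "b < c" using y b by (simp add: ennreal_less_iff c_def x_def)
  \<comment> \<open>One third is lost to continuity in time and less than one third to the error
    \<open>K * h\<close>, which still leaves more than \<open>b\<close>.\<close>
  define \<epsilon> where "\<epsilon> = (c - b) / 3"
  have eps: "\<epsilon> > 0" using bc by (simp add: \<epsilon>_def)
  have "eventually (\<lambda>u. c - \<epsilon> < f u x) (at t within {0..T})"
    by (rule order_tendstoD(1)[OF cont]) (use eps in \<open>simp add: c_def\<close>)
  then obtain d where d: "d > 0" "\<And>u. u \<in> {0..T} \<Longrightarrow> u \<noteq> t \<Longrightarrow> dist u t < d \<Longrightarrow> c - \<epsilon> < f u x"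
    by (auto simp: eventually_at)
  have near: "c - \<epsilon> \<le> f u x" if "u \<in> {0..T}" "dist u t < d" for u
    using d(2)[OF that(1) _ that(2)] eps by (cases "u = t") (auto simp: c_def)
  have lim: "(\<lambda>n. 1 / real (Suc n)) \<longlonglongrightarrow> 0"
    using LIMSEQ_inverse_real_of_nat by (simp add: inverse_eq_divide)
  have "eventually (\<lambda>n. 1 / real (Suc n) < min d t) sequentially"
    by (rule order_tendstoD(2)[OF lim]) (use d t in simp)
  moreover have "eventually (\<lambda>n. K * (1 / real (Suc n)) < \<epsilon>) sequentially"
    by (rule order_tendstoD(2)[OF tendsto_mult_right_zero[OF lim] eps])
  ultimately show "eventually (\<lambda>n. y < ennreal ((profile r t - profile r (t - 1 / real (Suc n))) / (1 / real (Suc n)))) sequentially"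
  proof eventually_elim
    case (elim n)
    define h where "h = 1 / real (Suc n)"
    have h: "0 < h" "h < d" "h < t" "K * h < \<epsilon>" using elim by (auto simp: h_def)
    have int: "integrable lborel (\<lambda>u. indicator {t - h<..t} u * f u x)"
      by (rule convex_requests_integrable[OF req]) (use h t in auto)
    have "(c - \<epsilon>) * h = (\<integral>u. (c - \<epsilon>) * indicator {t - h<..t} u \<partial>lborel)"
      using h by simp
    also have "\<dots> \<le> cumulative_cost f (t - h) t x"
      unfolding cumulative_cost_def
    proof (rule integral_mono[OF _ int])
      show "integrable lborel (\<lambda>u. (c - \<epsilon>) * indicator {t - h<..t} u)"
        by (intro integrable_mult_right integrable_real_indicator) (use h in auto)
      show "(c - \<epsilon>) * indicator {t - h<..t} u \<le> indicator {t - h<..t} u * f u x" for u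
        using near[of u] h t by (auto simp: indicator_def dist_real_def)
    qed
    finally have "(c - \<epsilon>) * h - K * h\<^sup>2 \<le> mean_conjugate r t - mean_conjugate r (t - h)"
      using K(2)[of "t - h" t] h t by (simp add: x_def)
    also have "\<dots> = profile r t - profile r (t - h)"
      using h t by (simp add: profile_def)
    finally have "(c - \<epsilon> - K * h) * h \<le> profile r t - profile r (t - h)"
      by (simp add: algebra_simps power2_eq_square)
    then have "c - \<epsilon> - K * h \<le> (profile r t - profile r (t - h)) / h"
      using h by (simp add: pos_le_divide_eq)
    moreover have "b < c - \<epsilon> - K * h" using h bc by (simp add: \<epsilon>_def field_simps)
    ultimately have "b < (profile r t - profile r (t - h)) / h" by linarith
    then show ?case
      unfolding h_def[symmetric] b(2) using b(1) by (simp only: ennreal_less_iff)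
  qed
qed

text \<open>For each fixed radius the lower left derivative dominates the request at the mean
  minimiser, and its integral is at most the offline optimum. As the radius tends to 1, Fatou's
  lemma and continuity of \<open>f t\<close> replace the mean minimiser by the Steiner
  point.\<close>

lemma service_cost_steiner_path_le: "service_cost f T (steiner_path f) \<le> offline_opt f T"
proof -
  define r where "r k = 1 - 1 / (real k + 2)" for k
  have r: "0 < r k" "r k < 1" for k by (auto simp: r_def field_simps)
  have r_lim: "r \<longlonglongrightarrow> 1" unfolding r_def by real_asymp
  obtain E where E: "countable E" "\<And>t x. t \<in> {0..T} - E \<Longrightarrow> ((\<lambda>u. f u x) \<longlongrightarrow> f t x) (at t within {0..T})"
    using convex_requests_continuous_in_time[OF req] by blast
  let ?l = "\<lambda>k. lower_left_derivative (profile (r k))"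
  have [measurable]: "?l k \<in> borel_measurable borel" for k
    by (rule lower_left_derivative_measurable[OF mono_profile[OF r]])
  \<comment> \<open>The times in \<open>E\<close> may lack continuity of some request, and at time 0
    there is no room for a step to the left; together they form a null set.\<close>
  have "AE t in lborel. t \<notin> E \<union> {0::real}"
    by (rule AE_not_in) (use E(1) in \<open>auto intro!: countable_imp_null_set_lborel\<close>)
  then have "service_cost f T (steiner_path f) \<le>
      (\<integral>\<^sup>+t. liminf (\<lambda>k. ?l k t * indicator {0..T} t) \<partial>lborel)"
    unfolding service_cost_def
  proof (intro nn_integral_mono_AE, eventually_elim)
    case (elim t)
    show ?case
    proof (cases "t \<in> {0..T}")
      case True
      then have t: "0 < t" "t \<le> T" "t \<in> {0..T} - E" using elim by auto
      have "continuous_on UNIV (f t)"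
        by (rule convex_on_continuous[OF open_UNIV convex_requests_convex[OF req True]])
      then have "(\<lambda>k. f t (mean_minimiser (r k) t)) \<longlonglongrightarrow> f t (steiner_path f t)"
        by (intro continuous_on_tendsto_compose[OF _ mean_minimiser_tendsto[OF True r r_lim]]) auto
      then have "(\<lambda>k. ennreal (f t (mean_minimiser (r k) t))) \<longlonglongrightarrow> ennreal (f t (steiner_path f t))"
        by (rule tendsto_ennrealI)
      then have "ennreal (f t (steiner_path f t)) = liminf (\<lambda>k. ennreal (f t (mean_minimiser (r k) t)))"
        by (intro lim_imp_Liminf[symmetric]) simp
      also have "\<dots> \<le> liminf (\<lambda>k. ?l k t)"
        by (intro Liminf_mono always_eventually allI lower_left_derivative_ge r t(1,2) E(2)[OF t(3)])
      finally show ?thesis using True by simp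
    qed simp
  qed
  also have "\<dots> \<le> liminf (\<lambda>k. \<integral>\<^sup>+t\<in>{0..T}. ?l k t \<partial>lborel)"
    by (rule nn_integral_liminf) measurable
  also have "\<dots> \<le> liminf (\<lambda>k::nat. offline_opt f T)"
  proof (intro Liminf_mono always_eventually allI)
    fix k
    have "(\<integral>\<^sup>+t\<in>{0..T}. ?l k t \<partial>lborel) \<le> ennreal (profile (r k) T)"
      by (rule nn_integral_lower_left_derivative_le[OF mono_profile[OF r] _ T]) (simp add: profile_def)
    also have "\<dots> \<le> offline_opt f T"
      unfolding offline_opt_eq using mean_conjugate_le[OF r, of T k] T
      by (intro ennreal_leI) (simp add: profile_def)
    finally show "(\<integral>\<^sup>+t\<in>{0..T}. ?l k t \<partial>lborel) \<le> offline_opt f T" .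
  qed
  also have "\<dots> = offline_opt f T" by (rule Liminf_const) simp
  finally show ?thesis .
qed

lemma steiner_path_0: "steiner_path f 0 = 0"
proof -
  have "minimiser f 0 v = 0" if "norm v < 1" for v
    using work_function_minimiser_finite[OF _ work_function_0_finite that, of 0] T
    by (auto simp: work_function_0 split: if_splits)
  then have "(\<lambda>v. indicator (ball 0 1) v *\<^sub>R minimiser f 0 v) = (\<lambda>v. 0)"
    by (auto simp: indicator_def fun_eq_iff)
  then have "ball_integral (minimiser f 0) = 0" by (simp add: ball_integral_def)
  then show ?thesis using steiner_path_eq[of 0] T by simp
qed

end

lemma online_steiner_path: "online steiner_path"
  unfolding online_def
proof (intro allI impI)
  fix f g :: "real \<Rightarrow> 'a \<Rightarrow> real" and t :: real
  assume "\<forall>s\<in>{0..t}. f s = g s"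
  then have "service_cost f t p = service_cost g t p" for p
    unfolding service_cost_def by (intro nn_integral_cong) (auto simp: indicator_def)
  then show "steiner_path f t = steiner_path g t"
    by (simp add: steiner_path_def work_function_def total_cost_def)
qed

theorem theorem4p1:
  "competitive (real DIM('a) + 1)
     (steiner_path :: (real \<Rightarrow> 'a::euclidean_space \<Rightarrow> real) \<Rightarrow> real \<Rightarrow> 'a) \<and>
   (\<forall>(f :: real \<Rightarrow> 'a \<Rightarrow> real) (T :: real). 0 \<le> T \<longrightarrow> convex_requests T f \<longrightarrow>
      movement_cost T (steiner_path f) \<le> ennreal (real DIM('a)) * offline_opt f T \<and>
      service_cost f T (steiner_path f) \<le> offline_opt f T)"
proof -
  have main: "movement_cost T (steiner_path f) \<le> ennreal (real DIM('a)) * offline_opt f T \<and>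
      service_cost f T (steiner_path f) \<le> offline_opt f T \<and> steiner_path f 0 = 0 \<and> offline_opt f T < \<infinity>"
    if "0 \<le> T" "convex_requests T f" for f :: "real \<Rightarrow> 'a \<Rightarrow> real" and T
  proof -
    obtain C where "0 \<le> C" "\<And>t. t \<in> {0..T} \<Longrightarrow> work_function f t 0 \<le> ennreal C"
      using work_function_0_bounded[OF \<open>convex_requests T f\<close>] by blast
    then interpret convex_request_sequence f T C
      by unfold_locales (use that in auto)
    show ?thesis
      using movement_cost_steiner_path_le service_cost_steiner_path_le steiner_path_0
      by (simp add: offline_opt_eq)
  qed
  have "competitive (real DIM('a) + 1) (steiner_path :: (real \<Rightarrow> 'a \<Rightarrow> real) \<Rightarrow> real \<Rightarrow> 'a)"
    unfolding competitive_def
  proof (intro conjI allI impI online_steiner_path)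
    fix f :: "real \<Rightarrow> 'a \<Rightarrow> real" and T :: real
    assume "0 \<le> T" "convex_requests T f"
    note * = main[OF this]
    show "steiner_path f 0 = 0" using * by simp
    have "ennreal (real DIM('a)) * offline_opt f T < \<infinity>"
      using * by (simp add: ennreal_mult_less_top)
    then show "movement_cost T (steiner_path f) < \<infinity>" using * by (meson le_less_trans)
    have "total_cost f T (steiner_path f) \<le> offline_opt f T + ennreal (real DIM('a)) * offline_opt f T"
      unfolding total_cost_def using * by (intro add_mono) auto
    also have "\<dots> = ennreal (real DIM('a) + 1) * offline_opt f T"
      by (simp add: ennreal_plus distrib_right add.commute)
    finally show "total_cost f T (steiner_path f) \<le> ennreal (real DIM('a) + 1) * offline_opt f T" .
  qed
  then show ?thesis using main by blast
qed

end
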